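(* Let $\mu,\nu\in\mathcal P_2(\mathbb R^d)$ have the same barycentre $[\mu]=[\nu]$. Then $$Z_2(\mu,\nu)=\min\Big\{\int_X\!\int_Y \tfrac12\Big(\Big|\tfrac{dq}{d\gamma}(x,y)-x\Big|^2+\Big|\tfrac{dq}{d\gamma}(x,y)-y\Big|^2\Big)\gamma(dxdy)\ :\ (\gamma,q)\in\Gamma Q(\mu,\nu)\Big\},$$ $$\mathcal C(\mu,\nu)=\min\Big\{\int_X\!\int_Y \Big|\tfrac{dq}{d\gamma}(x,y)\Big|^2\gamma(dxdy)\ :\ (\gamma,q)\in\Gamma Q(\mu,\nu)\Big\},$$ and both minimization problems have the same non-empty set of minimizers. Moreover, for any pair $(\gamma,q)=(\gamma,\zeta\gamma)\in\Gamma Q(\mu,\nu)$ (with $\zeta=\frac{dq}{d\gamma}$) the following are equivalent: (i) $(\gamma,\zeta\gamma)$ is a minimizer of either of the two problems above; (ii) for every optimal potential $\overline u$ of the Zolotarev problem defining $Z_2(\mu,\nu)$, one has $\zeta=\overline\zeta$ $\gamma$-a.e., where $\overline\zeta(x,y):=\frac{x+y}{2}+\frac{\nabla\overline u(x)-\nabla\overline u(y)}{2}$ (a Lipschitz map $\mathbb R^d\times\mathbb R^d\to\mathbb R^d$); (iii) $\rho=\zeta\#\gamma$ is a minimizer of the problem defining $\mathcal C(\mu,\nu)$; (iv) $\rho=\zeta\#\gamma\in\Pi_{\succeq_c\mu}(\nu)$; (v) $\rho=\zeta\#\gamma\in\Pi_{\succeq_c\nu}(\mu)$.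
   Context: $\mathcal P_p(\mathbb R^d)$ denotes Borel probability measures on $\mathbb R^d$ with finite $p$-th moment; $m_2(\rho)=\int|z|^2\rho(dz)$; $[\mu]=\int x\,\mu(dx)$. Convex order: $\mu\preceq_c\nu$ (also written $\nu\succeq_c\mu$) iff $\int\varphi\,d\mu\le\int\varphi\,d\nu$ for every convex $\varphi:\mathbb R^d\to\mathbb R$. Let $X,Y$ be the supports of $\mu,\nu$. $\Gamma(\mu,\nu)$ is the set of probability measures on $X\times Y$ with marginals $\mu,\nu$. $Q(\mu,\nu)$ is the set of finite $\mathbb R^d$-valued Borel measures $q$ on $X\times Y$ with $\pi_1\#q=x\mu$ and $\pi_2\#q=y\nu$, i.e. $\int\langle\Phi(x),q(dxdy)\rangle=\int\langle\Phi(x),x\rangle\mu(dx)$ and $\int\langle\Psi(y),q(dxdy)\rangle=\int\langle\Psi(y),y\rangle\nu(dy)$ for all bounded Borel $\Phi,\Psi:\mathbb R^d\to\mathbb R^d$. $\Gamma Q(\mu,\nu)=\{(\gamma,q)\in\Gamma(\mu,\nu)\times Q(\mu,\nu): q\ll\gamma\}$ and $\frac{dq}{d\gamma}$ is the Radon–Nikodym derivative. $Z_2(\mu,\nu)=\max\{\int u\,d(\mu-\nu): u\in C^{1,1}(\mathbb R^d),\ \mathrm{lip}(\nabla u)\le1\}$ (the Zolotarev problem); a maximizer is called an optimal potential. $\mathcal C(\mu,\nu)=\min\{m_2(\rho):\rho\in\mathcal P_2(\mathbb R^d),\ \rho\succeq_c\mu,\ \rho\succeq_c\nu\}$. For $\mu$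 fixed, the Zolotarev projection is the set $\Pi_{\succeq_c\mu}(\nu)=\operatorname{arg\,min}\{Z_2(\nu,\rho):\rho\in\mathcal P_2(\mathbb R^d),\ \rho\succeq_c\mu\}$. $\#$ denotes push-forward. *)

theory Defs
  imports "HOL-Probability.Probability"
begin

definition P2 :: "'a::euclidean_space measure set" where
  "P2 = {M. prob_space M \<and> sets M = sets borel \<and> integrable M (\<lambda>x. (norm x)\<^sup>2)}"

definition m2 :: "'a::euclidean_space measure \<Rightarrow> real" where
  "m2 M = (\<integral>x. (norm x)\<^sup>2 \<partial>M)"

definition bary :: "'a::euclidean_space measure \<Rightarrow> 'a" where
  "bary M = (\<integral>x. x \<partial>M)"

text \<open>Extended-valued integral (positive part minus negative part), used for
  integrals of convex functions, which are bounded below by affine maps.\<close>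
definition ext_integral :: "'a measure \<Rightarrow> ('a \<Rightarrow> real) \<Rightarrow> ereal" where
  "ext_integral M f =
     enn2ereal (\<integral>\<^sup>+x. ennreal (f x) \<partial>M) - enn2ereal (\<integral>\<^sup>+x. ennreal (- f x) \<partial>M)"

definition cx_le :: "'a::euclidean_space measure \<Rightarrow> 'a measure \<Rightarrow> bool" where
  "cx_le \<mu> \<nu> = (\<forall>\<phi>::'a \<Rightarrow> real. convex_on UNIV \<phi> \<longrightarrow> ext_integral \<mu> \<phi> \<le> ext_integral \<nu> \<phi>)"

definition lip1_grad :: "('a::euclidean_space \<Rightarrow> real) \<Rightarrow> ('a \<Rightarrow> 'a) \<Rightarrow> bool" where
  "lip1_grad u G = ((\<forall>x. (u has_derivative (\<lambda>h. G x \<bullet> h)) (at x)) \<and>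
                    (\<forall>x y. norm (G x - G y) \<le> norm (x - y)))"

definition Z2 :: "'a::euclidean_space measure \<Rightarrow> 'a measure \<Rightarrow> real" where
  "Z2 \<mu> \<nu> = Sup {(\<integral>x. u x \<partial>\<mu>) - (\<integral>x. u x \<partial>\<nu>) | u. \<exists>G. lip1_grad u G}"

definition optimal_potential ::
  "'a::euclidean_space measure \<Rightarrow> 'a measure \<Rightarrow> ('a \<Rightarrow> real) \<Rightarrow> ('a \<Rightarrow> 'a) \<Rightarrow> bool" where
  "optimal_potential \<mu> \<nu> u G =
     (lip1_grad u G \<and> (\<integral>x. u x \<partial>\<mu>) - (\<integral>x. u x \<partial>\<nu>) = Z2 \<mu> \<nu>)"

definition Ccost :: "'a::euclidean_space measure \<Rightarrow> 'a measure \<Rightarrow> real" where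
  "Ccost \<mu> \<nu> = Inf {m2 \<rho> | \<rho>. \<rho> \<in> P2 \<and> cx_le \<mu> \<rho> \<and> cx_le \<nu> \<rho>}"

definition C_minimizer :: "'a::euclidean_space measure \<Rightarrow> 'a measure \<Rightarrow> 'a measure \<Rightarrow> bool" where
  "C_minimizer \<mu> \<nu> \<rho> = (\<rho> \<in> P2 \<and> cx_le \<mu> \<rho> \<and> cx_le \<nu> \<rho> \<and> m2 \<rho> = Ccost \<mu> \<nu>)"

definition zproj :: "'a::euclidean_space measure \<Rightarrow> 'a measure \<Rightarrow> 'a measure set" where
  "zproj \<mu> \<nu> = {\<rho> \<in> P2. cx_le \<mu> \<rho> \<and> (\<forall>\<rho>'\<in>P2. cx_le \<mu> \<rho>' \<longrightarrow> Z2 \<nu> \<rho> \<le> Z2 \<nu> \<rho>')}"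

definition coupling :: "'a::euclidean_space measure \<Rightarrow> 'a measure \<Rightarrow> ('a \<times> 'a) measure \<Rightarrow> bool" where
  "coupling \<mu> \<nu> \<gamma> = (prob_space \<gamma> \<and> sets \<gamma> = sets borel \<and>
      distr \<gamma> borel fst = \<mu> \<and> distr \<gamma> borel snd = \<nu>)"

text \<open>GammaQ(mu,nu): pairs (gamma, q) with q << gamma, represented by (gamma, zeta) where
  zeta = dq/dgamma is a gamma-integrable vector density (so q = zeta gamma is a finite
  R^d-valued Borel measure), subject to the marginal conditions defining Q(mu,nu).\<close>
definition GammaQ :: "'a::euclidean_space measure \<Rightarrow> 'a measure \<Rightarrow>
    (('a \<times> 'a) measure \<times> ('a \<times> 'a \<Rightarrow> 'a)) set" where
  "GammaQ \<mu> \<nu> = {(\<gamma>, \<zeta>). coupling \<mu> \<nu> \<gamma> \<and> \<zeta> \<in> borel_measurable \<gamma> \<and> integrable \<gamma> \<zeta> \<and>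
      (\<forall>\<Phi>::'a \<Rightarrow> 'a. \<Phi> \<in> borel_measurable borel \<and> bounded (range \<Phi>) \<longrightarrow>
          (\<integral>z. \<Phi> (fst z) \<bullet> \<zeta> z \<partial>\<gamma>) = (\<integral>x. \<Phi> x \<bullet> x \<partial>\<mu>)) \<and>
      (\<forall>\<Psi>::'a \<Rightarrow> 'a. \<Psi> \<in> borel_measurable borel \<and> bounded (range \<Psi>) \<longrightarrow>
          (\<integral>z. \<Psi> (snd z) \<bullet> \<zeta> z \<partial>\<gamma>) = (\<integral>y. \<Psi> y \<bullet> y \<partial>\<nu>))}"

definition costZ :: "('a::euclidean_space \<times> 'a) measure \<Rightarrow> ('a \<times> 'a \<Rightarrow> 'a) \<Rightarrow> ennreal" where
  "costZ \<gamma> \<zeta> = (\<integral>\<^sup>+z. ennreal ((1/2) * ((norm (\<zeta> z - fst z))\<^sup>2 + (norm (\<zeta> z - snd z))\<^sup>2)) \<partial>\<gamma>)"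

definition costC :: "('a::euclidean_space \<times> 'a) measure \<Rightarrow> ('a \<times> 'a \<Rightarrow> 'a) \<Rightarrow> ennreal" where
  "costC \<gamma> \<zeta> = (\<integral>\<^sup>+z. ennreal ((norm (\<zeta> z))\<^sup>2) \<partial>\<gamma>)"

definition argminGQ :: "'a::euclidean_space measure \<Rightarrow> 'a measure \<Rightarrow>
    (('a \<times> 'a) measure \<Rightarrow> ('a \<times> 'a \<Rightarrow> 'a) \<Rightarrow> ennreal) \<Rightarrow>
    (('a \<times> 'a) measure \<times> ('a \<times> 'a \<Rightarrow> 'a)) set" where
  "argminGQ \<mu> \<nu> cost = {(\<gamma>, \<zeta>) \<in> GammaQ \<mu> \<nu>.
      \<forall>(\<gamma>', \<zeta>') \<in> GammaQ \<mu> \<nu>. cost \<gamma> \<zeta> \<le> cost \<gamma>' \<zeta>'}"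

definition is_min_GQ :: "'a::euclidean_space measure \<Rightarrow> 'a measure \<Rightarrow>
    (('a \<times> 'a) measure \<Rightarrow> ('a \<times> 'a \<Rightarrow> 'a) \<Rightarrow> ennreal) \<Rightarrow> real \<Rightarrow> bool" where
  "is_min_GQ \<mu> \<nu> cost v =
     ((\<exists>(\<gamma>, \<zeta>) \<in> GammaQ \<mu> \<nu>. enn2ereal (cost \<gamma> \<zeta>) = ereal v) \<and>
      (\<forall>(\<gamma>, \<zeta>) \<in> GammaQ \<mu> \<nu>. ereal v \<le> enn2ereal (cost \<gamma> \<zeta>)))"

end

theory Submission
  imports Defs
begin

text \<open>
  Feasible pairs \<open>(\<gamma>, \<zeta>)\<close> arise from laws of triples \<open>(x, y, z)\<close> with \<open>E[z|x] = x\<close>, \<open>E[z|y] = y\<close> by taking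
  \<open>\<zeta> = E[z|x,y]\<close>. Minimising \<open>E|z|\<^sup>2\<close> is dual to maximising \<open>\<integral>f d\<mu> + \<integral>g d\<nu>\<close> subject to
  \<open>f x + g y + \<Phi> x \<bullet> (z - x) + \<Psi> y \<bullet> (z - y) \<le> |z|\<^sup>2\<close>. Suprema over \<open>x\<close> and \<open>y\<close> turn a dual candidate into
  convex \<open>\<phi>, \<psi>\<close> with \<open>\<phi> + \<psi> \<le> |.|\<^sup>2\<close>, and a convex envelope produces \<open>F\<close> with \<open>F\<close> and \<open>|.|\<^sup>2 - F\<close> convex, i.e.
  \<open>F = u + |.|\<^sup>2 / 2\<close> with \<open>u\<close> admissible for \<open>Z2\<close>; so the dual value is \<open>V = Z2 \<mu> \<nu> + (m2 \<mu> + m2 \<nu>) / 2\<close>.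
  A Hahn-Banach extension below the superhedging price gives a positive functional of value at most \<open>V\<close>, and its
  representing measure is an optimal triple law. Conversely, for every \<open>u\<close> the two-point inequality of \<open>C\<^sup>1\<^sup>,\<^sup>1\<close>
  functions has quadratic defect \<open>|\<zeta> - \<zeta>\<^sub>u|\<^sup>2\<close>, which identifies the minimisers.
\<close>

subsection \<open>Convexity and functions with 1-Lipschitz gradient\<close>

text \<open>Existence of a minimiser is the hard half, and it is obtained without weak compactness
  of measures. The Hahn-Banach functional lives on all functions of quadratic growth, measurable or
  not, and is only finitely additive: it may keep part of the second moment at infinity. Hence its
  representing measure is compared with it on bounded Lipschitz functions only, and the rest is
  recovered by truncation: the second moment can only drop, which is the favourable direction, while
  the martingale constraints survive because they are linear in \<open>z\<close>. The offset in
  \<open>V\<close> is the constant by which the two costs differ once the identity is used as test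
  map for both marginals; so both problems select the pairs with second moment \<open>V\<close>. In
  the converse direction of the density characterisation the coupling is arbitrary; there the
  density prescribed by one potential fixes the second moment through the marginals alone, and
  comparison with one known optimal pair finishes. The three conditions on the push-forward all say
  that \<open>distr \<gamma> borel \<zeta>\<close> has second moment \<open>V\<close>.\<close>

lemma convex_subgradient_exists:
  fixes \<phi> :: "'a::euclidean_space \<Rightarrow> real"
  assumes "convex_on UNIV \<phi>"
  obtains p where "\<And>w. \<phi> z + p \<bullet> (w - z) \<le> \<phi> w"
proof -
  \<comment> \<open>The strict epigraph is convex and misses the graph point over \<open>z\<close>;
    a hyperplane separating the two is, once shown not to be vertical, the graph of the supporting
    affine function.\<close>
  define S where "S = {(w, r). \<phi> w < r}"
  have "convex S"
  proof (rule convexI)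
    fix a b and s t :: real
    assume "a \<in> S" "b \<in> S" and st: "0 \<le> s" "0 \<le> t" "s + t = 1"
    obtain w r w' r' where ab: "a = (w, r)" "b = (w', r')" by (metis surj_pair)
    have r: "\<phi> w < r" "\<phi> w' < r'" using \<open>a \<in> S\<close> \<open>b \<in> S\<close> by (auto simp: S_def ab)
    have "\<phi> (s *\<^sub>R w + t *\<^sub>R w') \<le> s * \<phi> w + t * \<phi> w'"
      using assms st by (simp add: convex_on_def)
    also have "\<dots> < s * r + t * r'"
    proof (cases "s = 0")
      case False
      then have "s * \<phi> w < s * r" using r st by simp
      moreover have "t * \<phi> w' \<le> t * r'" using r st by (simp add: mult_left_mono)
      ultimately show ?thesis by linarith
    qed (use r st in simp)
    finally show "s *\<^sub>R a + t *\<^sub>R b \<in> S" by (simp add: S_def ab)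
  qed
  moreover have "S \<noteq> {}" proof -
    have "(0, \<phi> 0 + 1) \<in> S" by (simp add: S_def)
    then show ?thesis by blast
  qed
  moreover have "S \<inter> {(z, \<phi> z)} = {}" by (auto simp: S_def)
  ultimately obtain a b where "a \<noteq> 0" and Sb: "\<And>x. x \<in> S \<Longrightarrow> a \<bullet> x \<le> b" and zb: "a \<bullet> (z, \<phi> z) \<ge> b"
    using separating_hyperplane_sets[of S "{(z, \<phi> z)}"] by (metis convex_singleton insert_not_empty insertI1)
  obtain v s where a: "a = (v, s)" by (metis surj_pair)
  have sep: "v \<bullet> w + s * r \<le> v \<bullet> z + s * \<phi> z" if "\<phi> w < r" for w r
    using Sb[of "(w, r)"] zb that by (auto simp: a S_def)
  have "s \<le> 0" using sep[of z "\<phi> z + 1"] by (simp add: algebra_simps)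
  \<comment> \<open>Since \<open>\<phi>\<close> is finite at \<open>z + v\<close>, a vertical
    hyperplane would force \<open>v \<bullet> v \<le> 0\<close>.\<close>
  moreover have "s \<noteq> 0"
  proof
    assume "s = 0"
    then have "v \<bullet> (z + v) \<le> v \<bullet> z" using sep[of "z + v" "\<phi> (z + v) + 1"] by simp
    then have "v \<bullet> v \<le> 0" by (simp add: inner_add_right)
    then have "v = 0" by (metis inner_eq_zero_iff inner_ge_zero order_antisym)
    then show False using \<open>a \<noteq> 0\<close> \<open>s = 0\<close> by (simp add: a zero_prod_def)
  qed
  ultimately have "s < 0" by simp
  show ?thesis
  proof (rule that)
    fix w
    show "\<phi> z + (- (1 / s) *\<^sub>R v) \<bullet> (w - z) \<le> \<phi> w"
    proof (rule dense_ge)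
      fix r assume "\<phi> w < r"
      from sep[OF this] have "s * r \<le> s * (\<phi> z + (- (1 / s) *\<^sub>R v) \<bullet> (w - z))"
        using \<open>s < 0\<close> by (simp add: algebra_simps)
      then show "\<phi> z + (- (1 / s) *\<^sub>R v) \<bullet> (w - z) \<le> r" using \<open>s < 0\<close> by simp
    qed
  qed
qed

lemma convex_on_if_subgradients:
  fixes \<phi> :: "'a::real_inner \<Rightarrow> real"
  assumes "\<And>z w. \<phi> z + p z \<bullet> (w - z) \<le> \<phi> w"
  shows "convex_on UNIV \<phi>"
proof (rule convex_onI)
  fix t :: real and x y :: 'a
  assume t: "0 < t" "t < 1"
  define z where "z = (1 - t) *\<^sub>R x + t *\<^sub>R y"
  have "(1 - t) * (\<phi> z + p z \<bullet> (x - z)) + t * (\<phi> z + p z \<bullet> (y - z)) \<le> (1 - t) * \<phi> x + t * \<phi> y"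
    using t assms[of z x] assms[of z y] by (intro add_mono mult_left_mono) auto
  moreover have "(1 - t) * (\<phi> z + p z \<bullet> (x - z)) + t * (\<phi> z + p z \<bullet> (y - z))
     = \<phi> z + p z \<bullet> ((1 - t) *\<^sub>R x + t *\<^sub>R y - z)"
    by (simp add: algebra_simps inner_add_right inner_diff_right)
  ultimately show "\<phi> ((1 - t) *\<^sub>R x + t *\<^sub>R y) \<le> (1 - t) * \<phi> x + t * \<phi> y"
    by (simp add: z_def)
qed simp

text \<open>Taylor form of the condition that the gradient is 1-Lipschitz. It mentions no
  derivative, so it can be checked by algebra, and it says that \<open>u + |.|^2/2\<close> and
  \<open>|.|^2/2 - u\<close> have supporting affine functions with slopes \<open>G z + z\<close> and
  \<open>z - G z\<close>.\<close>

definition C11 :: "('a::real_inner \<Rightarrow> real) \<Rightarrow> ('a \<Rightarrow> 'a) \<Rightarrow> bool" where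
  "C11 u G = (\<forall>z w. \<bar>u w - u z - G z \<bullet> (w - z)\<bar> \<le> (norm (w - z))\<^sup>2 / 2)"

lemma C11_upper: "C11 u G \<Longrightarrow> u w \<le> u z + G z \<bullet> (w - z) + (norm (w - z))\<^sup>2 / 2"
  unfolding C11_def by (smt (verit))

lemma C11_lower: "C11 u G \<Longrightarrow> u z + G z \<bullet> (w - z) - (norm (w - z))\<^sup>2 / 2 \<le> u w"
  unfolding C11_def by (smt (verit))

lemma C11_uminus: "C11 u G \<Longrightarrow> C11 (\<lambda>x. - u x) (\<lambda>x. - G x)"
  unfolding C11_def by (smt (verit) inner_minus_left)

text \<open>As a function of \<open>z\<close> the right-hand side is a quadratic polynomial with
  leading part \<open>|z|^2\<close>; its minimiser is the point \<open>m\<close>, so moving from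
  \<open>m\<close> to \<open>z\<close> costs exactly \<open>|z - m|^2\<close>. At \<open>m\<close>
  itself the claim compares the lower parabola of \<open>u\<close> touching at \<open>x\<close> with
  the upper parabola touching at \<open>y\<close>.\<close>

lemma C11_two_point:
  fixes u :: "'a::real_inner \<Rightarrow> real"
  assumes "C11 u G"
  shows "u x - u y + (norm (z - ((1/2) *\<^sub>R (x + y) + (1/2) *\<^sub>R (G x - G y))))\<^sup>2
    \<le> G x \<bullet> (x - z) + G y \<bullet> (z - y) + ((norm (z - x))\<^sup>2 + (norm (z - y))\<^sup>2) / 2"
proof -
  define m where "m = (1/2) *\<^sub>R (x + y) + (1/2) *\<^sub>R (G x - G y)"
  have "u x + G x \<bullet> (m - x) - (norm (m - x))\<^sup>2 / 2 \<le> u y + G y \<bullet> (m - y) + (norm (m - y))\<^sup>2 / 2"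
    using C11_lower[OF assms, of x m] C11_upper[OF assms, of m y] by linarith
  moreover have "G x \<bullet> (x - z) + G y \<bullet> (z - y) + ((norm (z - x))\<^sup>2 + (norm (z - y))\<^sup>2) / 2
    = (norm (z - m))\<^sup>2 + (G x \<bullet> (x - m) + G y \<bullet> (m - y) + ((norm (m - x))\<^sup>2 + (norm (m - y))\<^sup>2) / 2)"
    unfolding m_def power2_norm_eq_inner
    by (simp add: inner_commute algebra_simps inner_add_left inner_add_right inner_diff_left inner_diff_right add_divide_distrib diff_divide_distrib)
  ultimately show ?thesis unfolding m_def[symmetric] inner_diff_right add_divide_distrib by linarith
qed

text \<open>The two-point inequality is used for \<open>(x, y)\<close> and for
  \<open>(y, x)\<close>, each at its own minimising point, where the squared defect is zero. The
  values of \<open>u\<close> cancel in the sum, and the right-hand sides add up to half of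
  \<open>|x - y|^2 - |G x - G y|^2\<close>.\<close>

lemma C11_gradient_lipschitz:
  fixes u :: "'a::real_inner \<Rightarrow> real"
  assumes "C11 u G"
  shows "norm (G x - G y) \<le> norm (x - y)"
proof -
  define z where "z = (1/2) *\<^sub>R (x + y) + (1/2) *\<^sub>R (G x - G y)"
  define z' where "z' = (1/2) *\<^sub>R (y + x) + (1/2) *\<^sub>R (G y - G x)"
  have "0 \<le> G x \<bullet> (x - z) + G y \<bullet> (z - y) + ((norm (z - x))\<^sup>2 + (norm (z - y))\<^sup>2) / 2
     + (G y \<bullet> (y - z') + G x \<bullet> (z' - x) + ((norm (z' - y))\<^sup>2 + (norm (z' - x))\<^sup>2) / 2)"
    using C11_two_point[OF assms, of x y z] C11_two_point[OF assms, of y x z']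
    by (simp add: z_def z'_def)
  also have "\<dots> = ((norm (x - y))\<^sup>2 - (norm (G x - G y))\<^sup>2) / 2"
    unfolding z_def z'_def power2_norm_eq_inner
    by (simp add: inner_commute algebra_simps inner_add_left inner_add_right inner_diff_left inner_diff_right add_divide_distrib diff_divide_distrib)
  finally show ?thesis by (simp add: abs_le_square_iff[symmetric])
qed

lemma C11_imp_lip1_grad:
  fixes u :: "'a::euclidean_space \<Rightarrow> real"
  assumes "C11 u G"
  shows "lip1_grad u G"
  unfolding lip1_grad_def
proof (intro conjI allI)
  fix x y show "norm (G x - G y) \<le> norm (x - y)"
    by (rule C11_gradient_lipschitz[OF assms])
next
  fix x
  show "(u has_derivative (\<lambda>h. G x \<bullet> h)) (at x)"
    unfolding has_derivative_iff_norm
  proof (intro conjI)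
    show "bounded_linear ((\<bullet>) (G x))" by (rule bounded_linear_inner_right)
    show "((\<lambda>y. norm (u y - u x - G x \<bullet> (y - x)) / norm (y - x)) \<longlongrightarrow> 0) (at x)"
    proof (rule tendsto_sandwich[of "\<lambda>_. 0" _ _ "\<lambda>y. norm (y - x) / 2"])
      have "eventually (\<lambda>y. y \<noteq> x) (at x)" by (rule eventually_neq_at_within)
      then show "eventually (\<lambda>y. norm (u y - u x - G x \<bullet> (y - x)) / norm (y - x) \<le> norm (y - x) / 2) (at x)"
      proof eventually_elim
        case (elim y)
        then have "norm (y - x) > 0" by simp
        moreover have "\<bar>u y - u x - G x \<bullet> (y - x)\<bar> \<le> (norm (y - x))\<^sup>2 / 2" using assms by (simp add: C11_def)
        ultimately show ?case by (simp add: field_simps power2_eq_square)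
      qed
      have "((\<lambda>y. norm (y - x) / 2) \<longlongrightarrow> norm (x - x) / 2) (at x)" by (intro tendsto_intros) auto
      then show "((\<lambda>y. norm (y - x) / 2) \<longlongrightarrow> 0) (at x)" by simp
    qed auto
  qed
qed

lemma lip1_grad_imp_C11:
  fixes u :: "'a::euclidean_space \<Rightarrow> real"
  assumes "lip1_grad u G"
  shows "C11 u G"
proof -
  have der: "(u has_derivative (\<lambda>h. G x \<bullet> h)) (at x)" and lip: "norm (G x - G y) \<le> norm (x - y)" for x y
    using assms by (auto simp: lip1_grad_def)
  have main: "s * (u w - u z - G z \<bullet> (w - z)) \<le> (norm (w - z))\<^sup>2 / 2" if s: "s = 1 \<or> s = -1" for s z w
  proof -
    define k where "k = w - z"
    \<comment> \<open>\<open>g\<close> vanishes at 0, and \<open>g 1 \<le> 0\<close> is the claim;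
      the Lipschitz bound makes it nonincreasing along the segment. The sign \<open>s\<close> yields
      the upper and the lower estimate from one computation.\<close>
    define g where "g t = s * (u (z + t *\<^sub>R k) - u z - t * (G z \<bullet> k)) - t\<^sup>2 * (norm k)\<^sup>2 / 2" for t
    have "g 1 \<le> g 0"
    proof (rule DERIV_nonpos_imp_nonincreasing[of 0 1 g])
      fix t :: real assume t: "0 \<le> t" "t \<le> 1"
      have "((\<lambda>t. u (z + t *\<^sub>R k)) has_derivative (\<lambda>h. G (z + t *\<^sub>R k) \<bullet> (h *\<^sub>R k))) (at t)"
        by (rule has_derivative_compose[of "\<lambda>t. z + t *\<^sub>R k" _ _ _ u, OF _ der])
           (auto intro!: derivative_eq_intros)
      then have d: "((\<lambda>t. u (z + t *\<^sub>R k)) has_field_derivative (G (z + t *\<^sub>R k) \<bullet> k)) (at t)"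
        by (simp add: has_field_derivative_def mult_commute_abs)
      have "(g has_field_derivative (s * (G (z + t *\<^sub>R k) \<bullet> k - G z \<bullet> k) - t * (norm k)\<^sup>2)) (at t)"
        unfolding g_def
        by (rule derivative_eq_intros d refl | simp)+
      moreover have "s * (G (z + t *\<^sub>R k) \<bullet> k - G z \<bullet> k) - t * (norm k)\<^sup>2 \<le> 0"
      proof -
        have "\<bar>(G (z + t *\<^sub>R k) - G z) \<bullet> k\<bar> \<le> norm (G (z + t *\<^sub>R k) - G z) * norm k"
          by (rule Cauchy_Schwarz_ineq2)
        also have "\<dots> \<le> norm (t *\<^sub>R k) * norm k"
          using lip[of "z + t *\<^sub>R k" z] by (intro mult_right_mono) auto
        also have "\<dots> = t * (norm k)\<^sup>2" using t by (simp add: power2_eq_square)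
        finally have "\<bar>G (z + t *\<^sub>R k) \<bullet> k - G z \<bullet> k\<bar> \<le> t * (norm k)\<^sup>2" by (simp add: inner_diff_left)
        then show ?thesis using s by (auto simp: abs_le_iff)
      qed
      ultimately show "\<exists>y. (g has_real_derivative y) (at t) \<and> y \<le> 0" by blast
    qed simp
    then show ?thesis by (simp add: g_def k_def)
  qed
  show ?thesis unfolding C11_def
  proof (intro allI)
    fix z w show "\<bar>u w - u z - G z \<bullet> (w - z)\<bar> \<le> (norm (w - z))\<^sup>2 / 2"
      using main[of 1 w z, simplified] main[of "-1" w z, simplified] unfolding abs_le_iff by linarith
  qed
qed

lemma lip1_grad_iff_C11: "lip1_grad u G \<longleftrightarrow> C11 u G"
  using C11_imp_lip1_grad lip1_grad_imp_C11 by blast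

text \<open>At each point \<open>\<phi>\<close> is squeezed between a supporting affine function and
  a paraboloid supplied by convexity of \<open>|.|^2 - \<phi>\<close>; both touch there, so their
  slopes agree. Subtracting half of the square turns this one-sided window into the symmetric bound
  of \<open>C11\<close>.\<close>

lemma C11_if_convex:
  fixes \<phi> :: "'a::euclidean_space \<Rightarrow> real"
  assumes "convex_on UNIV \<phi>" "convex_on UNIV (\<lambda>x. (norm x)\<^sup>2 - \<phi> x)"
  shows "\<exists>G. C11 (\<lambda>x. \<phi> x - (norm x)\<^sup>2 / 2) G"
proof -
  have "\<exists>p. (\<forall>w. 0 \<le> \<phi> w - \<phi> z - p \<bullet> (w - z) \<and> \<phi> w - \<phi> z - p \<bullet> (w - z) \<le> (norm (w - z))\<^sup>2)" for z
  proof -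
    obtain p where p: "\<And>w. \<phi> z + p \<bullet> (w - z) \<le> \<phi> w" using convex_subgradient_exists[OF assms(1)] by blast
    obtain q where q: "\<And>w. ((norm z)\<^sup>2 - \<phi> z) + q \<bullet> (w - z) \<le> (norm w)\<^sup>2 - \<phi> w"
      using convex_subgradient_exists[OF assms(2)] by blast
    define d where "d = p - (2 *\<^sub>R z - q)"
    have up: "\<phi> w \<le> \<phi> z + (2 *\<^sub>R z - q) \<bullet> (w - z) + (norm (w - z))\<^sup>2" for w
      using q[of w] unfolding power2_norm_eq_inner
      by (simp add: inner_commute algebra_simps inner_add_left inner_add_right inner_diff_left inner_diff_right add_divide_distrib diff_divide_distrib)
    have "d \<bullet> (w - z) \<le> (norm (w - z))\<^sup>2" for w
      using p[of w] up[of w] by (simp add: d_def inner_diff_left)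
    \<comment> \<open>At half of \<open>d\<close> the linear term \<open>|d|^2/2\<close> exceeds the
      quadratic one \<open>|d|^2/4\<close> unless \<open>d = 0\<close>.\<close>
    from this[of "z + (1/2) *\<^sub>R d"] have "(norm d)\<^sup>2 / 2 \<le> (norm d)\<^sup>2 / 4"
      by (simp add: power2_norm_eq_inner power_divide)
    then have "d = 0" by simp
    then have "2 *\<^sub>R z - q = p" by (simp add: d_def)
    with p up show ?thesis by (intro exI[of _ p] allI) (smt (verit))
  qed
  then obtain P where P: "\<And>z w. 0 \<le> \<phi> w - \<phi> z - P z \<bullet> (w - z)"
      "\<And>z w. \<phi> w - \<phi> z - P z \<bullet> (w - z) \<le> (norm (w - z))\<^sup>2"
    by metis
  have "C11 (\<lambda>x. \<phi> x - (norm x)\<^sup>2 / 2) (\<lambda>x. P x - x)"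
    unfolding C11_def
  proof (intro allI)
    fix z w
    have "(\<phi> w - (norm w)\<^sup>2 / 2) - (\<phi> z - (norm z)\<^sup>2 / 2) - (P z - z) \<bullet> (w - z)
       = (\<phi> w - \<phi> z - P z \<bullet> (w - z)) - (norm (w - z))\<^sup>2 / 2"
      unfolding power2_norm_eq_inner
      by (simp add: inner_commute algebra_simps inner_add_left inner_add_right inner_diff_left inner_diff_right add_divide_distrib diff_divide_distrib)
    then show "\<bar>(\<phi> w - (norm w)\<^sup>2 / 2) - (\<phi> z - (norm z)\<^sup>2 / 2) - (P z - z) \<bullet> (w - z)\<bar> \<le> (norm (w - z))\<^sup>2 / 2"
      unfolding abs_le_iff using P[of w z] by linarith
  qed
  then show ?thesis by blast
qed

lemma C11_convex:
  fixes u :: "'a::real_inner \<Rightarrow> real"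
  assumes "C11 u G"
  shows "convex_on UNIV (\<lambda>x. u x + (norm x)\<^sup>2 / 2)"
proof (rule convex_on_if_subgradients)
  fix z w
  show "u z + (norm z)\<^sup>2 / 2 + (G z + z) \<bullet> (w - z) \<le> u w + (norm w)\<^sup>2 / 2"
    using C11_lower[OF assms, of z w] unfolding power2_norm_eq_inner
    by (simp add: inner_commute algebra_simps inner_add_left inner_add_right inner_diff_left inner_diff_right add_divide_distrib diff_divide_distrib)
qed

text \<open>The largest convex minorant of \<open>|.|\<^sup>2 - \<psi>\<close> inherits semiconcavity: shifting both
  arguments of a convex combination and subtracting the quadratic defect gives another convex minorant.\<close>

lemma convex_sandwich:
  fixes \<phi> \<psi> :: "'a::euclidean_space \<Rightarrow> real"
  assumes \<phi>: "convex_on UNIV \<phi>" and \<psi>: "convex_on UNIV \<psi>" and le: "\<And>z. \<phi> z + \<psi> z \<le> (norm z)\<^sup>2"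
  obtains F where "convex_on UNIV F" "convex_on UNIV (\<lambda>x. (norm x)\<^sup>2 - F x)"
    "\<And>z. \<phi> z \<le> F z" "\<And>z. \<psi> z \<le> (norm z)\<^sup>2 - F z"
proof -
  define h where "h z = (norm z)\<^sup>2 - \<psi> z" for z
  define S where "S = {c. convex_on UNIV c \<and> (\<forall>z. c z \<le> h z)}"
  define F where "F z = (SUP c\<in>S. c z)" for z
  have \<phi>S: "\<phi> \<in> S" using \<phi> le by (auto simp: S_def h_def algebra_simps)
  have bdd: "bdd_above ((\<lambda>c. c z) ` S)" for z by (rule bdd_aboveI[of _ "h z"]) (auto simp: S_def)
  have F_ge: "c z \<le> F z" if "c \<in> S" for c z unfolding F_def by (rule cSUP_upper[OF that bdd])
  have F_le: "F z \<le> r" if "\<And>c. c \<in> S \<Longrightarrow> c z \<le> r" for z r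
    unfolding F_def using \<phi>S that by (intro cSUP_least) auto
  have Fh: "F z \<le> h z" for z by (rule F_le) (auto simp: S_def)
  have Fconv: "convex_on UNIV F"
  proof (rule convex_onI)
    fix t :: real and x y :: 'a assume t: "0 < t" "t < 1"
    show "F ((1 - t) *\<^sub>R x + t *\<^sub>R y) \<le> (1 - t) * F x + t * F y"
    proof (rule F_le)
      fix c assume c: "c \<in> S"
      have "c ((1 - t) *\<^sub>R x + t *\<^sub>R y) \<le> (1 - t) * c x + t * c y"
        using c t by (auto simp: S_def intro!: convex_onD)
      also have "\<dots> \<le> (1 - t) * F x + t * F y" using F_ge[OF c] t by (intro add_mono mult_left_mono) auto
      finally show "c ((1 - t) *\<^sub>R x + t *\<^sub>R y) \<le> (1 - t) * F x + t * F y" .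
    qed
  qed simp
  have Gconv: "convex_on UNIV (\<lambda>x. (norm x)\<^sup>2 - F x)"
  proof (rule convex_onI)
    fix t :: real and x y :: 'a assume t: "0 < t" "t < 1"
    define k where "k = x - y"
    \<comment> \<open>The shifts are chosen so that at the convex combination of \<open>x\<close>
      and \<open>y\<close> the two shifted points are exactly \<open>x\<close> and \<open>y\<close>;
      the subtracted constant is the defect of the square recorded in \<open>quad\<close>.\<close>
    define c where "c z = (1 - t) * F (z + t *\<^sub>R k) + t * F (z - (1 - t) *\<^sub>R k) - t * (1 - t) * (norm k)\<^sup>2" for z
    have quad: "(1 - t) * (norm (z + t *\<^sub>R k))\<^sup>2 + t * (norm (z - (1 - t) *\<^sub>R k))\<^sup>2 - t * (1 - t) * (norm k)\<^sup>2 = (norm z)\<^sup>2" for z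
      unfolding power2_norm_eq_inner
      by (simp add: inner_commute algebra_simps inner_add_left inner_add_right inner_diff_left inner_diff_right add_divide_distrib diff_divide_distrib)
    have "c \<in> S"
      unfolding S_def
    proof (intro CollectI conjI allI)
      have shift: "convex_on UNIV (\<lambda>z. F (z + v))" for v
      proof (rule convex_onI)
        fix s :: real and x y :: 'a assume s: "0 < s" "s < 1"
        have "F ((1 - s) *\<^sub>R (x + v) + s *\<^sub>R (y + v)) \<le> (1 - s) * F (x + v) + s * F (y + v)"
          using Fconv s by (auto intro!: convex_onD)
        then show "F ((1 - s) *\<^sub>R x + s *\<^sub>R y + v) \<le> (1 - s) * F (x + v) + s * F (y + v)"
          by (simp add: algebra_simps)
      qed simp
      have "convex_on UNIV (\<lambda>z. ((1 - t) * F (z + t *\<^sub>R k) + t * F (z + (- (1 - t) *\<^sub>R k))) + (- t * (1 - t) * (norm k)\<^sup>2))"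
        by (intro convex_on_add convex_on_cmul shift convex_onI) (use t in \<open>auto simp: algebra_simps\<close>)
      then show "convex_on UNIV c" by (simp add: c_def[abs_def] algebra_simps)
      fix z
      have "\<psi> ((1 - t) *\<^sub>R (z + t *\<^sub>R k) + t *\<^sub>R (z - (1 - t) *\<^sub>R k)) \<le> (1 - t) * \<psi> (z + t *\<^sub>R k) + t * \<psi> (z - (1 - t) *\<^sub>R k)"
        using \<psi> t by (intro convex_onD) auto
      then have \<psi>c: "\<psi> z \<le> (1 - t) * \<psi> (z + t *\<^sub>R k) + t * \<psi> (z - (1 - t) *\<^sub>R k)"
        by (simp add: algebra_simps)
      have "c z \<le> (1 - t) * h (z + t *\<^sub>R k) + t * h (z - (1 - t) *\<^sub>R k) - t * (1 - t) * (norm k)\<^sup>2"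
        unfolding c_def using Fh t by (intro diff_right_mono add_mono mult_left_mono) auto
      also have "\<dots> \<le> h z"
        using \<psi>c quad[of z] unfolding h_def by (simp add: right_diff_distrib)
      finally show "c z \<le> h z" .
    qed
    from F_ge[OF this, of "(1 - t) *\<^sub>R x + t *\<^sub>R y"]
    have "(1 - t) * F x + t * F y - t * (1 - t) * (norm k)\<^sup>2 \<le> F ((1 - t) *\<^sub>R x + t *\<^sub>R y)"
      by (simp add: c_def k_def algebra_simps)
    with quad[of "(1 - t) *\<^sub>R x + t *\<^sub>R y"]
    show "(norm ((1 - t) *\<^sub>R x + t *\<^sub>R y))\<^sup>2 - F ((1 - t) *\<^sub>R x + t *\<^sub>R y)
        \<le> (1 - t) * ((norm x)\<^sup>2 - F x) + t * ((norm y)\<^sup>2 - F y)"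
      by (simp add: k_def algebra_simps)
  qed simp
  show ?thesis
    by (rule that[OF Fconv Gconv]) (use F_ge[OF \<phi>S] Fh in \<open>auto simp: h_def algebra_simps\<close>)
qed

subsection \<open>Hahn-Banach for spaces of functions\<close>

text \<open>A sublinear functional that is minimal in the pointwise order is linear; Zorn's lemma yields a minimal one.\<close>

definition fun_space :: "('w \<Rightarrow> real) set \<Rightarrow> bool" where
  "fun_space E \<longleftrightarrow> (\<lambda>_. 0) \<in> E \<and> (\<forall>a\<in>E. \<forall>b\<in>E. (\<lambda>x. a x + b x) \<in> E) \<and> (\<forall>a\<in>E. \<forall>r. (\<lambda>x. r * a x) \<in> E)"

definition sublinear_on :: "('w \<Rightarrow> real) set \<Rightarrow> (('w \<Rightarrow> real) \<Rightarrow> real) \<Rightarrow> bool" where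
  "sublinear_on E p \<longleftrightarrow> (\<forall>a\<in>E. \<forall>b\<in>E. p (\<lambda>x. a x + b x) \<le> p a + p b) \<and>
     (\<forall>a\<in>E. \<forall>r\<ge>0. p (\<lambda>x. r * a x) \<le> r * p a)"

definition linear_on_space :: "('w \<Rightarrow> real) set \<Rightarrow> (('w \<Rightarrow> real) \<Rightarrow> real) \<Rightarrow> bool" where
  "linear_on_space E L \<longleftrightarrow> (\<forall>a\<in>E. \<forall>b\<in>E. L (\<lambda>x. a x + b x) = L a + L b) \<and>
     (\<forall>a\<in>E. \<forall>r. L (\<lambda>x. r * a x) = r * L a)"

context
  fixes E :: "('w \<Rightarrow> real) set"
  assumes E: "fun_space E"
begin

lemma fun_space_closed:
  "(\<lambda>_. 0) \<in> E" "a \<in> E \<Longrightarrow> b \<in> E \<Longrightarrow> (\<lambda>x. a x + b x) \<in> E" "a \<in> E \<Longrightarrow> (\<lambda>x. r * a x) \<in> E"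
  "a \<in> E \<Longrightarrow> (\<lambda>x. - a x) \<in> E"
proof -
  show 1: "(\<lambda>x. r * a x) \<in> E" if "a \<in> E" for a r using E that by (auto simp: fun_space_def)
  show "a \<in> E \<Longrightarrow> (\<lambda>x. - a x) \<in> E" using 1[of a "-1"] by simp
qed (use E in \<open>auto simp: fun_space_def\<close>)

lemma sublinear_on_basic:
  assumes "sublinear_on E q"
  shows "q (\<lambda>_. 0) = 0"
    and "a \<in> E \<Longrightarrow> b \<in> E \<Longrightarrow> q (\<lambda>x. a x + b x) \<le> q a + q b"
    and "a \<in> E \<Longrightarrow> 0 \<le> r \<Longrightarrow> q (\<lambda>x. r * a x) = r * q a"
    and "a \<in> E \<Longrightarrow> - q a \<le> q (\<lambda>x. - a x)"
proof -
  have hom: "q (\<lambda>x. r * a x) \<le> r * q a" if "a \<in> E" "0 \<le> r" for a r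
    using assms that by (auto simp: sublinear_on_def)
  show add: "q (\<lambda>x. a x + b x) \<le> q a + q b" if "a \<in> E" "b \<in> E" for a b
    using assms that by (auto simp: sublinear_on_def)
  show zero: "q (\<lambda>_. 0) = 0"
    using hom[of "\<lambda>_. 0" 0] add[of "\<lambda>_. 0" "\<lambda>_. 0"] by (simp add: fun_space_closed)
  show "q (\<lambda>x. r * a x) = r * q a" if "a \<in> E" "0 \<le> r" for a r
  proof (cases "r = 0")
    case False
    then have "q a \<le> (1 / r) * q (\<lambda>x. r * a x)"
      using hom[of "\<lambda>x. r * a x" "1 / r"] that by (simp add: fun_space_closed)
    then have "r * q a \<le> q (\<lambda>x. r * a x)" using False that by (simp add: field_simps)
    then show ?thesis using hom[OF that] by simp
  qed (simp add: zero)
  show "- q a \<le> q (\<lambda>x. - a x)" if "a \<in> E" for a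
    using add[of a "\<lambda>x. - a x"] that zero by (simp add: fun_space_closed)
qed

text \<open>The functional \<open>s\<close> improves \<open>q\<close> in the direction
  \<open>a\<close>: it is sublinear, lies below \<open>q\<close>, and at \<open>-a\<close> the
  choice \<open>t = 1\<close> already gives at most \<open>- q a\<close>. Minimality forbids a
  strict improvement, so \<open>q\<close> is odd, which is all that separates sublinear from
  linear.\<close>

lemma minimal_sublinear_reflects:
  assumes q: "sublinear_on E q" and a: "a \<in> E"
    and min: "\<And>s. sublinear_on E s \<Longrightarrow> (\<And>c. c \<in> E \<Longrightarrow> s c \<le> q c) \<Longrightarrow> (\<And>c. c \<in> E \<Longrightarrow> s c = q c)"
  shows "q (\<lambda>x. - a x) = - q a"
proof -
  note q_basic = sublinear_on_basic[OF q]
  define s where "s c = (INF t\<in>{0::real..}. q (\<lambda>x. c x + t * a x) - t * q a)" for c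
  have cE: "(\<lambda>x. c x + t * a x) \<in> E" if "c \<in> E" for c t
    using that a by (intro fun_space_closed)
  have bdd: "bdd_below ((\<lambda>t. q (\<lambda>x. c x + t * a x) - t * q a) ` {0..})" if c: "c \<in> E" for c
  proof (rule bdd_belowI2[of _ "- q (\<lambda>x. - c x)"])
    fix t :: real assume "t \<in> {0..}"
    then have "t * q a = q (\<lambda>x. t * a x)" using q_basic(3)[OF a] by simp
    also have "\<dots> = q (\<lambda>x. (c x + t * a x) + - c x)" by simp
    also have "\<dots> \<le> q (\<lambda>x. c x + t * a x) + q (\<lambda>x. - c x)"
      using c by (intro q_basic(2) cE fun_space_closed)
    finally show "- q (\<lambda>x. - c x) \<le> q (\<lambda>x. c x + t * a x) - t * q a" by simp
  qed
  have s_le: "s c \<le> q (\<lambda>x. c x + t * a x) - t * q a" if "c \<in> E" "0 \<le> t" for c t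
    unfolding s_def using bdd[OF that(1)] that(2) by (intro cINF_lower) auto
  have s_ge: "r \<le> s c" if "\<And>t. 0 \<le> t \<Longrightarrow> r \<le> q (\<lambda>x. c x + t * a x) - t * q a" for r c
    unfolding s_def using that by (intro cINF_greatest) auto
  have "sublinear_on E s"
    unfolding sublinear_on_def
  proof (intro conjI ballI allI impI)
    fix c d assume c: "c \<in> E" and d: "d \<in> E"
    have *: "s (\<lambda>x. c x + d x) \<le> (q (\<lambda>x. c x + t * a x) - t * q a) + (q (\<lambda>x. d x + t' * a x) - t' * q a)"
      if "0 \<le> t" "0 \<le> t'" for t t'
    proof -
      have "s (\<lambda>x. c x + d x) \<le> q (\<lambda>x. (c x + d x) + (t + t') * a x) - (t + t') * q a"
        using that c d by (intro s_le fun_space_closed) auto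
      also have "(\<lambda>x. (c x + d x) + (t + t') * a x) = (\<lambda>x. (c x + t * a x) + (d x + t' * a x))"
        by (simp add: fun_eq_iff algebra_simps)
      also have "q \<dots> \<le> q (\<lambda>x. c x + t * a x) + q (\<lambda>x. d x + t' * a x)"
        using c d by (intro q_basic(2) cE)
      finally show ?thesis by (simp add: algebra_simps)
    qed
    have "s (\<lambda>x. c x + d x) - (q (\<lambda>x. d x + t' * a x) - t' * q a) \<le> s c" if "0 \<le> t'" for t'
      using *[OF _ that] by (intro s_ge) (simp add: algebra_simps)
    then have "s (\<lambda>x. c x + d x) - s c \<le> s d"
      by (intro s_ge) (simp add: algebra_simps)
    then show "s (\<lambda>x. c x + d x) \<le> s c + s d" by simp
  next
    fix c and r :: real assume c: "c \<in> E" and r: "0 \<le> r"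
    show "s (\<lambda>x. r * c x) \<le> r * s c"
    proof (cases "r = 0")
      case True
      then show ?thesis using s_le[of "\<lambda>_. 0" 0] q_basic(1) by (simp add: fun_space_closed)
    next
      case False
      have "s (\<lambda>x. r * c x) / r \<le> s c"
      proof (rule s_ge)
        fix t :: real assume t: "0 \<le> t"
        have "s (\<lambda>x. r * c x) \<le> q (\<lambda>x. r * c x + (r * t) * a x) - (r * t) * q a"
          using t r c by (intro s_le fun_space_closed) auto
        also have "(\<lambda>x. r * c x + (r * t) * a x) = (\<lambda>x. r * (c x + t * a x))"
          by (simp add: fun_eq_iff algebra_simps)
        also have "q \<dots> = r * q (\<lambda>x. c x + t * a x)" using c r by (intro q_basic(3) cE)
        finally show "s (\<lambda>x. r * c x) / r \<le> q (\<lambda>x. c x + t * a x) - t * q a"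
          using r False by (simp add: field_simps)
      qed
      then show ?thesis using r False by (simp add: field_simps)
    qed
  qed
  moreover have "s c \<le> q c" if "c \<in> E" for c using s_le[OF that, of 0] by simp
  ultimately have "s (\<lambda>x. - a x) = q (\<lambda>x. - a x)" using a by (intro min fun_space_closed)
  moreover have "s (\<lambda>x. - a x) \<le> - q a" using s_le[of "\<lambda>x. - a x" 1] a q_basic(1) by (simp add: fun_space_closed)
  ultimately show ?thesis using q_basic(4)[OF a] by simp
qed

text \<open>No subspace and no prescribed values occur: whatever the functional is meant to satisfy
  has to be built into \<open>p\<close>, and equalities are then obtained by bounding both
  \<open>a\<close> and \<open>-a\<close>.\<close>

theorem hahn_banach_sublinear:
  assumes p: "sublinear_on E p"
  obtains L where "linear_on_space E L" "\<And>a. a \<in> E \<Longrightarrow> L a \<le> p a"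
proof -
  \<comment> \<open>Values outside \<open>E\<close> are pinned to 0; otherwise two functionals that
    agree on \<open>E\<close> could differ, and the order would not be antisymmetric.\<close>
  define A where "A = {q. sublinear_on E q \<and> (\<forall>a\<in>E. q a \<le> p a) \<and> (\<forall>a. a \<notin> E \<longrightarrow> q a = 0)}"
  \<comment> \<open>The order is reversed, so that the maximal element given by Zorn's lemma is a
    minimal functional.\<close>
  define P where "P q s \<longleftrightarrow> (\<forall>a\<in>E. s a \<le> q a)" for q s :: "('w \<Rightarrow> real) \<Rightarrow> real"
  have sub_restrict: "sublinear_on E (\<lambda>a. if a \<in> E then q a else 0)" if "sublinear_on E q" for q
    using that by (auto simp: sublinear_on_def fun_space_closed)
  have "\<exists>m\<in>A. \<forall>a\<in>A. P m a \<longrightarrow> a = m"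
  proof (rule predicate_Zorn)
    have "antisym (relation_of P A)"
    proof (rule antisymI)
      fix q s assume "(q, s) \<in> relation_of P A" "(s, q) \<in> relation_of P A"
      then have "q a = s a" for a
        by (cases "a \<in> E") (auto simp: relation_of_def P_def A_def intro!: antisym)
      then show "q = s" by auto
    qed
    moreover have "trans (relation_of P A)"
      by (rule transI) (force simp: relation_of_def P_def)
    ultimately show "partial_order_on A (relation_of P A)"
      unfolding partial_order_on_def preorder_on_def
      by (auto simp: refl_on_def relation_of_def P_def)
  next
    fix C assume C: "C \<in> Chains (relation_of P A)"
    have CA: "q \<in> A" if "q \<in> C" for q using C that by (auto simp: Chains_def relation_of_def)
    have CP: "P q s \<or> P s q" if "q \<in> C" "s \<in> C" for q s using C that by (auto simp: Chains_def relation_of_def)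
    show "\<exists>u\<in>A. \<forall>a\<in>C. P a u"
    proof (cases "C = {}")
      case True
      have "(\<lambda>a. if a \<in> E then p a else 0) \<in> A" using sub_restrict[OF p] by (auto simp: A_def)
      with True show ?thesis by blast
    next
      case False
      define u where "u a = (INF q\<in>C. q a)" for a
      \<comment> \<open>All members of the chain share this lower bound, so the infimum over the
        chain is a genuine real infimum.\<close>
      have low: "- p (\<lambda>x. - a x) \<le> q a" if "q \<in> C" "a \<in> E" for q a
      proof -
        have q: "sublinear_on E q" "q (\<lambda>x. - a x) \<le> p (\<lambda>x. - a x)"
          using CA[OF that(1)] that(2) by (auto simp: A_def fun_space_closed)
        then show ?thesis using sublinear_on_basic(4)[OF q(1) that(2)] by linarith
      qed
      have u_le: "u a \<le> q a" if "q \<in> C" "a \<in> E" for q a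
        unfolding u_def using that low by (intro cINF_lower bdd_belowI2[where m = "- p (\<lambda>x. - a x)"]) auto
      have u_ge: "r \<le> u a" if "\<And>q. q \<in> C \<Longrightarrow> r \<le> q a" for r a
        unfolding u_def using that False by (intro cINF_greatest) auto
      have "sublinear_on E u"
        unfolding sublinear_on_def
      proof (intro conjI ballI allI impI)
        fix a b assume a: "a \<in> E" and b: "b \<in> E"
        have *: "u (\<lambda>x. a x + b x) \<le> q a + s b" if q: "q \<in> C" and s: "s \<in> C" for q s
        proof -
          \<comment> \<open>In a chain the smaller of \<open>q\<close> and \<open>s\<close> serves
            both arguments at once; this is what makes the infimum subadditive.\<close>
          obtain m where m: "m \<in> C" "m a \<le> q a" "m b \<le> s b"
            using CP[OF q s] q s a b by (auto simp: P_def)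
          have "u (\<lambda>x. a x + b x) \<le> m (\<lambda>x. a x + b x)" using m a b by (intro u_le fun_space_closed)
          also have "\<dots> \<le> m a + m b" using CA[OF m(1)] a b by (auto simp: A_def sublinear_on_def)
          finally show ?thesis using m by linarith
        qed
        have "u (\<lambda>x. a x + b x) - s b \<le> u a" if "s \<in> C" for s
          using *[OF _ that] by (intro u_ge) (simp add: algebra_simps)
        then have "u (\<lambda>x. a x + b x) - u a \<le> u b"
          by (intro u_ge) (simp add: algebra_simps)
        then show "u (\<lambda>x. a x + b x) \<le> u a + u b" by simp
      next
        fix a and r :: real assume a: "a \<in> E" and r: "0 \<le> r"
        have *: "u (\<lambda>x. r * a x) \<le> r * q a" if "q \<in> C" for q
        proof -
          have "u (\<lambda>x. r * a x) \<le> q (\<lambda>x. r * a x)" using that a by (intro u_le fun_space_closed)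
          also have "\<dots> = r * q a" using CA[OF that] a r by (intro sublinear_on_basic(3)) (auto simp: A_def)
          finally show ?thesis .
        qed
        show "u (\<lambda>x. r * a x) \<le> r * u a"
        proof (cases "r = 0")
          case True then show ?thesis using * False by auto
        next
          case False
          then have "u (\<lambda>x. r * a x) / r \<le> u a" using * r by (intro u_ge) (simp add: field_simps)
          then show ?thesis using False r by (simp add: field_simps)
        qed
      qed
      note u_sub = sub_restrict[OF this]
      have "(\<lambda>a. if a \<in> E then u a else 0) \<in> A"
        unfolding A_def
      proof (intro CollectI conjI ballI allI impI)
        fix a assume "a \<in> E"
        obtain q where "q \<in> C" using False by blast
        then show "(if a \<in> E then u a else 0) \<le> p a"
          using u_le[of q a] CA[of q] \<open>a \<in> E\<close> by (auto simp: A_def intro: order_trans)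
      qed (use u_sub in auto)
      then show ?thesis using u_le by (intro bexI[of _ "\<lambda>a. if a \<in> E then u a else 0"]) (auto simp: P_def)
    qed
  qed
  then obtain L where L: "L \<in> A" and Lmin: "\<And>s. s \<in> A \<Longrightarrow> P L s \<Longrightarrow> s = L" by blast
  have subL: "sublinear_on E L" and Lp: "\<And>a. a \<in> E \<Longrightarrow> L a \<le> p a" using L by (auto simp: A_def)
  have neg: "L (\<lambda>x. - a x) = - L a" if "a \<in> E" for a
  proof (rule minimal_sublinear_reflects[OF subL that])
    fix s c assume s: "sublinear_on E s" "\<And>c. c \<in> E \<Longrightarrow> s c \<le> L c" and c: "c \<in> E"
    have "(\<lambda>a. if a \<in> E then s a else 0) = L"
    proof (rule Lmin)
      show "(\<lambda>a. if a \<in> E then s a else 0) \<in> A"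
        using sub_restrict[OF s(1)] order_trans[OF s(2) Lp] by (simp add: A_def)
      show "P L (\<lambda>a. if a \<in> E then s a else 0)" using s(2) by (simp add: P_def)
    qed
    from fun_cong[OF this, of c] show "s c = L c" using c by simp
  qed
  have "linear_on_space E L"
    unfolding linear_on_space_def
  proof (intro conjI ballI allI)
    fix a b assume a: "a \<in> E" and b: "b \<in> E"
    have "L a = L (\<lambda>x. (a x + b x) + - b x)" by simp
    also have "\<dots> \<le> L (\<lambda>x. a x + b x) + L (\<lambda>x. - b x)"
      using a b by (intro sublinear_on_basic(2)[OF subL] fun_space_closed)
    finally show "L (\<lambda>x. a x + b x) = L a + L b"
      using neg[OF b] sublinear_on_basic(2)[OF subL a b] by simp
  next
    fix a and r :: real assume a: "a \<in> E"
    show "L (\<lambda>x. r * a x) = r * L a"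
    proof (cases "0 \<le> r")
      case False
      then have "L (\<lambda>x. (- r) * a x) = (- r) * L a" using a by (intro sublinear_on_basic(3)[OF subL]) auto
      moreover have "L (\<lambda>x. (- r) * a x) = - L (\<lambda>x. r * a x)"
        using neg[OF fun_space_closed(3)[OF a]] by simp
      ultimately show ?thesis by simp
    qed (use sublinear_on_basic(3)[OF subL a] in auto)
  qed
  then show ?thesis using Lp by (rule that)
qed

end

subsection \<open>Representation of positive functionals on functions of quadratic growth\<close>

text \<open>Measurability is deliberately absent: a functional on this space also evaluates
  indicators of arbitrary sets, so the discretisations of the identity used below may be picked by
  choice.\<close>

definition quad_funs :: "('b::real_normed_vector \<Rightarrow> real) set" where
  "quad_funs = {c. \<exists>K. \<forall>w. \<bar>c w\<bar> \<le> K * (1 + (norm w)\<^sup>2)}"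

lemma quad_funsI: "(\<And>w. \<bar>c w\<bar> \<le> K * (1 + (norm w)\<^sup>2)) \<Longrightarrow> c \<in> quad_funs"
  by (auto simp: quad_funs_def)

lemma fun_space_quad_funs: "fun_space (quad_funs :: ('b::real_normed_vector \<Rightarrow> real) set)"
  unfolding fun_space_def
proof (intro conjI ballI allI)
  show "(\<lambda>_. 0) \<in> (quad_funs :: ('b \<Rightarrow> real) set)" by (rule quad_funsI[of _ 0]) simp
  fix a :: "'b \<Rightarrow> real" assume "a \<in> quad_funs"
  then obtain K where K: "\<And>w. \<bar>a w\<bar> \<le> K * (1 + (norm w)\<^sup>2)" by (auto simp: quad_funs_def)
  show "(\<lambda>x. r * a x) \<in> quad_funs" for r
  proof (rule quad_funsI)
    fix w
    have "\<bar>r\<bar> * \<bar>a w\<bar> \<le> \<bar>r\<bar> * (K * (1 + (norm w)\<^sup>2))" using K by (intro mult_left_mono) auto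
    then show "\<bar>r * a w\<bar> \<le> (\<bar>r\<bar> * K) * (1 + (norm w)\<^sup>2)" by (simp add: abs_mult mult.assoc)
  qed
  fix b :: "'b \<Rightarrow> real" assume "b \<in> quad_funs"
  then obtain K' where K': "\<And>w. \<bar>b w\<bar> \<le> K' * (1 + (norm w)\<^sup>2)" by (auto simp: quad_funs_def)
  show "(\<lambda>x. a x + b x) \<in> quad_funs"
  proof (rule quad_funsI)
    fix w
    show "\<bar>a w + b w\<bar> \<le> (K + K') * (1 + (norm w)\<^sup>2)"
      using K[of w] K'[of w] by (simp add: distrib_right)
  qed
qed

lemma quad_funs_bounded:
  fixes c :: "'b::real_normed_vector \<Rightarrow> real"
  shows "(\<And>w. \<bar>c w\<bar> \<le> K) \<Longrightarrow> c \<in> quad_funs"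
proof (rule quad_funsI)
  fix w :: 'b assume K: "\<And>w. \<bar>c w\<bar> \<le> K"
  have "0 \<le> K" using K[of w] by linarith
  then have "K * 1 \<le> K * (1 + (norm w)\<^sup>2)" by (intro mult_left_mono) auto
  then show "\<bar>c w\<bar> \<le> K * (1 + (norm w)\<^sup>2)" using K[of w] by simp
qed

lemma norm_le_quad: "norm (w :: 'b::real_normed_vector) \<le> 1 + (norm w)\<^sup>2"
proof -
  have "0 \<le> (norm w - 1)\<^sup>2 + (norm w)\<^sup>2 + 1" by (intro add_nonneg_nonneg) auto
  then show ?thesis by (simp add: power2_eq_square algebra_simps)
qed

lemma quad_funs_dominated:
  assumes "b \<in> quad_funs" "\<And>w. \<bar>a w\<bar> \<le> b w"
  shows "a \<in> quad_funs"
proof -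
  obtain K where K: "\<And>w. \<bar>b w\<bar> \<le> K * (1 + (norm w)\<^sup>2)" using assms(1) by (auto simp: quad_funs_def)
  show ?thesis
  proof (rule quad_funsI)
    fix w show "\<bar>a w\<bar> \<le> K * (1 + (norm w)\<^sup>2)" using K[of w] assms(2)[of w] by linarith
  qed
qed

lemma quad_funs_intros:
  fixes a b :: "'b::real_normed_vector \<Rightarrow> real"
  shows "(\<lambda>_::'b. c) \<in> quad_funs" "(\<lambda>w::'b. (norm w)\<^sup>2) \<in> quad_funs"
    "(norm :: 'b \<Rightarrow> real) \<in> quad_funs" "(indicator A :: 'b \<Rightarrow> real) \<in> quad_funs"
  "a \<in> quad_funs \<Longrightarrow> b \<in> quad_funs \<Longrightarrow> (\<lambda>w. a w + b w) \<in> quad_funs"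
  "a \<in> quad_funs \<Longrightarrow> b \<in> quad_funs \<Longrightarrow> (\<lambda>w. a w - b w) \<in> quad_funs"
  "a \<in> quad_funs \<Longrightarrow> (\<lambda>w. r * a w) \<in> quad_funs"
  "a \<in> quad_funs \<Longrightarrow> (\<lambda>w. - a w) \<in> quad_funs"
proof -
  show "(\<lambda>_::'b. c) \<in> quad_funs" by (rule quad_funs_bounded) (rule order_refl)
  show "(\<lambda>w::'b. (norm w)\<^sup>2) \<in> quad_funs" by (rule quad_funsI[of _ 1]) simp
  show "(norm :: 'b \<Rightarrow> real) \<in> quad_funs" by (rule quad_funsI[of _ 1]) (simp add: norm_le_quad)
  show "(indicator A :: 'b \<Rightarrow> real) \<in> quad_funs" by (rule quad_funs_bounded[of _ 1]) (auto simp: indicator_def)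
  show add: "a \<in> quad_funs \<Longrightarrow> b \<in> quad_funs \<Longrightarrow> (\<lambda>w. a w + b w) \<in> quad_funs" for a b :: "'b \<Rightarrow> real"
    by (rule fun_space_closed[OF fun_space_quad_funs])
  show "a \<in> quad_funs \<Longrightarrow> (\<lambda>w. r * a w) \<in> quad_funs"
    by (rule fun_space_closed[OF fun_space_quad_funs])
  show neg: "a \<in> quad_funs \<Longrightarrow> (\<lambda>w. - a w) \<in> quad_funs" for a :: "'b \<Rightarrow> real"
    by (rule fun_space_closed[OF fun_space_quad_funs])
  show "a \<in> quad_funs \<Longrightarrow> b \<in> quad_funs \<Longrightarrow> (\<lambda>w. a w - b w) \<in> quad_funs"
    using add[OF _ neg, of a b] by simp
qed

lemma quad_funs_sum: "(\<And>i. i \<in> I \<Longrightarrow> a i \<in> quad_funs) \<Longrightarrow> (\<lambda>w. \<Sum>i\<in>I. a i w) \<in> quad_funs"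
  by (induction I rule: infinite_finite_induct) (auto intro: quad_funs_intros)

text \<open>A finitely additive expectation. Continuity along monotone sequences is not assumed,
  since Zorn's lemma does not provide it.\<close>

locale quad_mean =
  fixes L :: "('b::euclidean_space \<Rightarrow> real) \<Rightarrow> real"
  assumes lin: "linear_on_space quad_funs L"
    and pos: "\<And>a. a \<in> quad_funs \<Longrightarrow> (\<And>w. 0 \<le> a w) \<Longrightarrow> 0 \<le> L a"
    and one: "L (\<lambda>_. 1) = 1"
begin

lemma L_add: "a \<in> quad_funs \<Longrightarrow> b \<in> quad_funs \<Longrightarrow> L (\<lambda>w. a w + b w) = L a + L b"
  using lin by (simp add: linear_on_space_def)

lemma L_cmult: "a \<in> quad_funs \<Longrightarrow> L (\<lambda>w. r * a w) = r * L a"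
  using lin by (simp add: linear_on_space_def)

lemma L_diff: "a \<in> quad_funs \<Longrightarrow> b \<in> quad_funs \<Longrightarrow> L (\<lambda>w. a w - b w) = L a - L b"
  using L_add[of a "\<lambda>w. - 1 * b w"] L_cmult[of b "-1"] quad_funs_intros(7)[of b "-1"] by simp

lemma L_mono: "a \<in> quad_funs \<Longrightarrow> b \<in> quad_funs \<Longrightarrow> (\<And>w. a w \<le> b w) \<Longrightarrow> L a \<le> L b"
  using pos[of "\<lambda>w. b w - a w"] L_diff[of b a] by (simp add: quad_funs_intros)

lemma L_const: "L (\<lambda>_. c) = c"
  using L_cmult[of "\<lambda>_. 1" c] one by (simp add: quad_funs_intros)

lemma L_sum: "(\<And>i. i \<in> I \<Longrightarrow> a i \<in> quad_funs) \<Longrightarrow> L (\<lambda>w. \<Sum>i\<in>I. a i w) = (\<Sum>i\<in>I. L (a i))"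
  by (induction I rule: infinite_finite_induct) (auto simp: L_const L_add quad_funs_sum)

lemma L_abs_le:
  assumes "a \<in> quad_funs" "b \<in> quad_funs" "\<And>w. \<bar>a w\<bar> \<le> b w"
  shows "\<bar>L a\<bar> \<le> L b"
proof -
  have "L a \<le> L b" using assms by (intro L_mono) (auto simp: abs_le_iff)
  moreover have "L (\<lambda>w. -1 * a w) \<le> L b"
    using assms by (intro L_mono quad_funs_intros) (auto simp: abs_le_iff)
  ultimately show ?thesis using L_cmult[OF assms(1), of "-1"] by simp
qed

lemma L_finite_range:
  assumes "finite (range D)"
  shows "(\<Sum>v\<in>range D. f v * L (indicator (D -` {v}))) = L (\<lambda>w. f (D w))"
proof -
  have "(\<Sum>v\<in>range D. f v * L (indicator (D -` {v}))) = (\<Sum>v\<in>range D. L (\<lambda>w. f v * indicator (D -` {v}) w))"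
    by (simp add: L_cmult quad_funs_intros)
  also have "\<dots> = L (\<lambda>w. \<Sum>v\<in>range D. f v * indicator (D -` {v}) w)"
    by (rule L_sum[symmetric]) (intro quad_funs_intros)
  also have "(\<lambda>w. \<Sum>v\<in>range D. f v * indicator (D -` {v}) w) = (\<lambda>w. f (D w))"
    using assms by (auto simp: fun_eq_iff indicator_def sum.delta)
  finally show ?thesis .
qed

text \<open>For a map with finite range, finite additivity suffices to make the values of
  \<open>L\<close> on the fibres a genuine probability distribution.\<close>

definition law :: "('b \<Rightarrow> 'v) \<Rightarrow> 'v pmf" where
  "law D = embed_pmf (\<lambda>v. L (indicator (D -` {v})))"

lemma pmf_law:
  assumes fin: "finite (range D)"
  shows "pmf (law D) v = L (indicator (D -` {v}))"
  unfolding law_def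
proof (rule pmf_embed_pmf)
  show nn: "0 \<le> L (indicator (D -` {v}))" for v by (rule pos) (auto intro: quad_funs_intros)
  have "L (indicator (D -` {v})) = 0" if "v \<notin> range D" for v
  proof -
    have "indicator (D -` {v}) = (\<lambda>_. 0::real)" using that by (auto simp: indicator_def fun_eq_iff)
    then show ?thesis by (simp add: L_const)
  qed
  then have "(\<integral>\<^sup>+v. ennreal (L (indicator (D -` {v}))) \<partial>count_space UNIV)
      = (\<Sum>v\<in>range D. ennreal (L (indicator (D -` {v}))))"
    using fin by (intro nn_integral_count_space') auto
  also have "\<dots> = ennreal (\<Sum>v\<in>range D. L (indicator (D -` {v})))" using nn by (simp add: sum_ennreal)
  also have "\<dots> = 1" using L_finite_range[OF fin, of "\<lambda>_. 1"] one by simp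
  finally show "(\<integral>\<^sup>+v. ennreal (L (indicator (D -` {v}))) \<partial>count_space UNIV) = 1" .
qed

lemma set_law: "finite (range D) \<Longrightarrow> set_pmf (law D) \<subseteq> range D"
proof
  fix v assume fin: "finite (range D)" and "v \<in> set_pmf (law D)"
  then have "L (indicator (D -` {v})) \<noteq> 0" by (simp add: pmf_law set_pmf_iff)
  moreover have "indicator (D -` {v}) = (\<lambda>_. 0::real)" if "v \<notin> range D"
    using that by (auto simp: indicator_def fun_eq_iff)
  ultimately show "v \<in> range D" by (metis L_const)
qed

lemma integral_law:
  fixes f :: "'v \<Rightarrow> real"
  assumes fin: "finite (range D)"
  shows "(\<integral>v. f v \<partial>law D) = L (\<lambda>w. f (D w))"
proof -
  have "(\<integral>v. f v \<partial>law D) = (\<Sum>v\<in>range D. f v * pmf (law D) v)"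
    using set_law[OF fin] by (subst integral_measure_pmf[OF fin]) (auto simp: mult.commute)
  then show ?thesis using L_finite_range[OF fin, of f] by (simp add: pmf_law[OF fin])
qed

lemma measure_law: "finite (range D) \<Longrightarrow> measure (law D) A = L (\<lambda>w. indicator A (D w))"
  using integral_law[of D "indicator A"] by simp

text \<open>The joint laws of finite-range maps \<open>D j\<close> under the finitely additive mean \<open>L\<close> are
  consistent, so Kolmogorov's extension theorem realises the whole sequence on one probability space.\<close>

lemma ex_joint_law:
  fixes D :: "nat \<Rightarrow> 'b \<Rightarrow> 'b"
  assumes fin: "\<And>j. finite (range (D j))"
  obtains \<Omega> :: "(nat \<Rightarrow> 'b) measure" where "prob_space \<Omega>" "sets \<Omega> = sets (PiM UNIV (\<lambda>_. borel))"
    "\<And>i j g. g \<in> borel_measurable borel \<Longrightarrow> (\<integral>\<omega>. g (\<omega> i, \<omega> j) \<partial>\<Omega>) = L (\<lambda>w. g (D i w, D j w))"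
    "\<And>i j (g :: 'b \<times> 'b \<Rightarrow> real). g \<in> borel_measurable borel \<Longrightarrow> integrable \<Omega> (\<lambda>\<omega>. g (\<omega> i, \<omega> j))"
proof -
  define DJ where "DJ J w = (\<lambda>j\<in>J. D j w)" for J w
  have finJ: "finite (range (DJ J))" if "finite J" for J
  proof (rule finite_subset)
    show "range (DJ J) \<subseteq> PiE J (\<lambda>j. range (D j))" by (auto simp: DJ_def)
    show "finite (PiE J (\<lambda>j. range (D j)))" using that fin by (intro finite_PiE)
  qed
  define P where "P J = distr (measure_pmf (law (DJ J))) (PiM J (\<lambda>_. borel)) (\<lambda>f. restrict f J)" for J
  have meas: "(\<lambda>f. restrict f J) \<in> measurable (measure_pmf (p :: (nat \<Rightarrow> 'b) pmf)) (PiM J (\<lambda>_. borel))" for J p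
    by (auto simp: space_PiM)
  have "projective_family UNIV P (\<lambda>_. borel)"
  proof (rule projective_family.intro)
    fix J H :: "nat set" assume JH: "J \<subseteq> H" "finite H"
    then have fJ: "finite J" by (rule finite_subset)
    have res: "restrict (restrict f H) J = restrict f J" for f :: "nat \<Rightarrow> 'b" using JH by (auto simp: restrict_def fun_eq_iff)
    have "distr (P H) (PiM J (\<lambda>_. borel)) (\<lambda>f. restrict f J)
        = distr (measure_pmf (law (DJ H))) (PiM J (\<lambda>_. borel)) (\<lambda>f. restrict f J)"
      unfolding P_def using JH by (subst distr_distr[OF measurable_restrict_subset meas]) (auto simp: comp_def res Int_absorb1)
    also have "\<dots> = P J"
    proof (rule measure_eqI)
      fix A assume "A \<in> sets (distr (measure_pmf (law (DJ H))) (PiM J (\<lambda>_. borel)) (\<lambda>f. restrict f J))"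
      then have A: "A \<in> sets (PiM J (\<lambda>_. borel))" by simp
      \<comment> \<open>Both sides are the mean of one and the same function of \<open>w\<close>, so
        consistency of the family needs no countable additivity.\<close>
      have "measure (law (DJ H)) ((\<lambda>f. restrict f J) -` A) = measure (law (DJ J)) ((\<lambda>f. restrict f J) -` A)"
        unfolding measure_law[OF finJ[OF JH(2)]] measure_law[OF finJ[OF fJ]]
        using JH by (simp add: indicator_def DJ_def Int_absorb1)
      then show "emeasure (distr (measure_pmf (law (DJ H))) (PiM J (\<lambda>_. borel)) (\<lambda>f. restrict f J)) A = emeasure (P J) A"
        using A by (simp add: P_def emeasure_distr[OF meas] measure_pmf.emeasure_eq_measure)
    qed (simp add: P_def)
    finally show "P J = distr (P H) (PiM J (\<lambda>_. borel)) (\<lambda>f. restrict f J)" by simp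
  next
    fix J :: "nat set"
    show "prob_space (P J)" unfolding P_def by (rule measure_pmf.prob_space_distr[OF meas])
  qed
  then interpret pp: polish_projective UNIV P by (simp add: polish_projective_def)
  have r: "(\<lambda>f. restrict f J) \<in> measurable pp.lim (PiM J (\<lambda>_. borel))" for J
    by (subst measurable_cong_sets[OF pp.sets_lim refl]) (rule measurable_restrict_subset, simp)
  have dist: "distr pp.lim (PiM J (\<lambda>_. borel)) (\<lambda>f. restrict f J) = P J" if J: "finite J" for J
  proof (rule measure_eqI)
    fix A assume "A \<in> sets (distr pp.lim (PiM J (\<lambda>_. borel)) (\<lambda>f. restrict f J))"
    then have A: "A \<in> sets (PiM J (\<lambda>_. borel))" by simp
    have "emeasure pp.lim (prod_emb UNIV (\<lambda>_. borel) J A) = emeasure (P J) A"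
      using J A by (intro pp.emeasure_lim_emb) auto
    then show "emeasure (distr pp.lim (PiM J (\<lambda>_. borel)) (\<lambda>f. restrict f J)) A = emeasure (P J) A"
      using A by (subst emeasure_distr[OF r]) (auto simp: prod_emb_def space_PiM)
  qed (use J in \<open>simp add: P_def\<close>)
  \<comment> \<open>Two coordinates suffice: later only distances between consecutive coordinates
    and functions of a single coordinate are integrated.\<close>
  have key: "(\<integral>\<omega>. g (\<omega> i, \<omega> j) \<partial>pp.lim) = L (\<lambda>w. g (D i w, D j w)) \<and> integrable pp.lim (\<lambda>\<omega>. g (\<omega> i, \<omega> j))"
    if g[measurable]: "g \<in> borel_measurable borel" for g :: "'b \<times> 'b \<Rightarrow> real" and i j
  proof -
    have finij: "finite {i, j}" by simp
    have [measurable]: "(\<lambda>f. g (f i, f j)) \<in> borel_measurable (PiM {i, j} (\<lambda>_. borel))"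
      by measurable
    have "(\<integral>\<omega>. g (\<omega> i, \<omega> j) \<partial>pp.lim) = (\<integral>f. g (f i, f j) \<partial>distr pp.lim (PiM {i, j} (\<lambda>_. borel)) (\<lambda>f. restrict f {i, j}))"
      by (subst integral_distr[OF r]) auto
    also have "\<dots> = (\<integral>f. g (f i, f j) \<partial>law (DJ {i, j}))"
      unfolding dist[OF finij] P_def by (subst integral_distr[OF meas]) auto
    also have "\<dots> = L (\<lambda>w. g (D i w, D j w))"
      by (subst integral_law[OF finJ]) (auto simp: DJ_def)
    finally have 1: "(\<integral>\<omega>. g (\<omega> i, \<omega> j) \<partial>pp.lim) = L (\<lambda>w. g (D i w, D j w))" .
    have "integrable (measure_pmf (law (DJ {i, j}))) (\<lambda>f. g (f i, f j))"
      using finite_subset[OF set_law[OF finJ[OF finij]] finJ[OF finij]] by (rule integrable_measure_pmf_finite)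
    then have "integrable (distr pp.lim (PiM {i, j} (\<lambda>_. borel)) (\<lambda>f. restrict f {i, j})) (\<lambda>f. g (f i, f j))"
      unfolding dist[OF finij] P_def by (subst integrable_distr_eq[OF meas]) auto
    then have "integrable pp.lim (\<lambda>\<omega>. g (\<omega> i, \<omega> j))"
      by (subst (asm) integrable_distr_eq[OF r]) auto
    with 1 show ?thesis by simp
  qed
  show ?thesis
    by (rule that[of pp.lim]) (use key in \<open>auto intro: pp.P.prob_space_axioms\<close>)
qed

text \<open>The finite mean of \<open>|w|^2\<close> plays the part of tightness. Inside a ball a
  finite net approximates the identity; outside the ball of radius \<open>R\<close> the point is
  sent to 0 and the error \<open>|w|\<close> is at most \<open>|w|^2 / R\<close>.\<close>

lemma ex_finite_range_approx:
  assumes "0 < \<epsilon>"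
  obtains D where "finite (range D)" "L (\<lambda>w. norm (D w - w)) \<le> \<epsilon>" "(\<lambda>w. norm (D w - w)) \<in> quad_funs"
proof -
  define V where "V = L (\<lambda>w. (norm w)\<^sup>2)"
  have V: "0 \<le> V" unfolding V_def by (rule pos) (auto intro: quad_funs_intros)
  \<comment> \<open>This radius makes the tail error \<open>V / R\<close> at most half of
    \<open>\<epsilon>\<close>; the added 1 keeps \<open>R\<close> positive when
    \<open>V = 0\<close>.\<close>
  define R where "R = 2 * (V + 1) / \<epsilon>"
  have R: "0 < R" using V assms by (simp add: R_def)
  obtain N where N: "finite N" "cball (0::'b) R \<subseteq> (\<Union>x\<in>N. ball x (\<epsilon> / 2))"
    using compactE_image[of "cball (0::'b) R" "cball 0 R" "\<lambda>x. ball x (\<epsilon>/2)"] assms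
    by (metis (no_types, lifting) UN_I centre_in_ball compact_cball half_gt_zero open_ball subsetI)
  define D where "D w = (if norm w \<le> R then SOME x. x \<in> N \<and> dist x w < \<epsilon> / 2 else 0)" for w
  have DN: "D w \<in> N \<and> dist (D w) w < \<epsilon> / 2" if "norm w \<le> R" for w
  proof -
    have "\<exists>x. x \<in> N \<and> dist x w < \<epsilon> / 2" using N(2) that by (auto simp: subset_eq)
    from someI_ex[OF this] that show ?thesis by (simp add: D_def)
  qed
  have le: "norm (D w - w) \<le> \<epsilon> / 2 + (1 / R) * (norm w)\<^sup>2" for w
  proof (cases "norm w \<le> R")
    case True
    then have "norm (D w - w) \<le> \<epsilon> / 2" using DN[of w] by (simp add: dist_norm)
    moreover have "0 \<le> (1 / R) * (norm w)\<^sup>2" using R by simp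
    ultimately show ?thesis by linarith
  next
    case False
    then have "norm w * R \<le> norm w * norm w" by (intro mult_left_mono) auto
    then have "norm w \<le> (1 / R) * (norm w)\<^sup>2" using R by (simp add: field_simps power2_eq_square)
    with False show ?thesis using assms by (simp add: D_def)
  qed
  have q: "(\<lambda>w. \<epsilon> / 2 + (1 / R) * (norm w)\<^sup>2) \<in> (quad_funs :: ('b \<Rightarrow> real) set)" by (intro quad_funs_intros)
  have q': "(\<lambda>w. norm (D w - w)) \<in> quad_funs"
    by (rule quad_funs_dominated[OF q]) (use le in simp)
  have "range D \<subseteq> insert 0 N" using DN by (auto simp: D_def)
  then have "finite (range D)" using N(1) by (meson finite_insert finite_subset)
  moreover have "L (\<lambda>w. norm (D w - w)) \<le> \<epsilon>"
  proof -
    have "L (\<lambda>w. norm (D w - w)) \<le> L (\<lambda>w. \<epsilon> / 2 + (1 / R) * (norm w)\<^sup>2)" using q q' le by (intro L_mono)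
    also have "\<dots> = L (\<lambda>_. \<epsilon> / 2) + L (\<lambda>w. (1 / R) * (norm w)\<^sup>2)" by (intro L_add quad_funs_intros)
    also have "\<dots> = \<epsilon> / 2 + (1 / R) * V"
      unfolding V_def by (simp only: L_const L_cmult[OF quad_funs_intros(2)])
    also have "(1 / R) * V = \<epsilon> / 2 * (V / (V + 1))" using V assms by (simp add: R_def field_simps)
    also have "\<dots> \<le> \<epsilon> / 2 * 1" using V assms by (intro mult_left_mono) auto
    finally show ?thesis by simp
  qed
  ultimately show ?thesis using q' by (intro that)
qed

text \<open>Finite-range maps \<open>D j\<close> at mean distance at most \<open>2^-j\<close> from
  the identity are realised as coordinates of one random sequence; the distances of consecutive
  coordinates are summable in expectation, so the sequence converges almost surely, and
  \<open>M\<close> is the law of the limit. Test functions are Lipschitz because \<open>L\<close>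
  controls only the mean of \<open>|D j w - w|\<close>, and bounded so that the limit passes under
  the integral by domination.\<close>

theorem representing_measure:
  obtains M :: "'b measure" where "prob_space M" "sets M = sets borel"
    "\<And>h C K. (\<And>w. \<bar>h w\<bar> \<le> K) \<Longrightarrow> C-lipschitz_on UNIV h \<Longrightarrow> (\<integral>w. h w \<partial>M) = L h"
proof -
  have "\<exists>D. finite (range D) \<and> L (\<lambda>w. norm (D w - w)) \<le> (1/2)^j \<and> (\<lambda>w. norm (D w - w)) \<in> quad_funs" for j :: nat
    by (rule ex_finite_range_approx[of "(1/2)^j"]) auto
  from choice[OF allI[OF this]] obtain D where
    D: "\<forall>j. finite (range (D j)) \<and> L (\<lambda>w. norm (D j w - w)) \<le> (1/2)^j \<and> (\<lambda>w. norm (D j w - w)) \<in> quad_funs" ..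
  have fin: "finite (range (D j))" and DL: "L (\<lambda>w. norm (D j w - w)) \<le> (1/2)^j"
    and Dq: "(\<lambda>w. norm (D j w - w)) \<in> quad_funs" for j using D by auto
  obtain \<Omega> :: "(nat \<Rightarrow> 'b) measure" where \<Omega>: "prob_space \<Omega>" and sets: "sets \<Omega> = sets (PiM UNIV (\<lambda>_. borel))"
    and int: "\<And>i j g. g \<in> borel_measurable borel \<Longrightarrow> (\<integral>\<omega>. g (\<omega> i, \<omega> j) \<partial>\<Omega>) = L (\<lambda>w. g (D i w, D j w))"
    and intb: "\<And>i j (g :: 'b \<times> 'b \<Rightarrow> real). g \<in> borel_measurable borel \<Longrightarrow> integrable \<Omega> (\<lambda>\<omega>. g (\<omega> i, \<omega> j))"
    by (rule ex_joint_law[of D]) (use fin in auto)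
  interpret \<Omega>: prob_space \<Omega> by (rule \<Omega>)
  note [measurable_cong] = sets
  have comp[measurable]: "(\<lambda>\<omega>. \<omega> j) \<in> borel_measurable \<Omega>" for j by measurable
  \<comment> \<open>The triangle inequality through \<open>w\<close> gives
    \<open>2^-j + 2^-(j+1)\<close>, rounded up to twice \<open>2^-j\<close>.\<close>
  have E: "(\<integral>\<^sup>+\<omega>. ennreal (dist (\<omega> j) (\<omega> (Suc j))) \<partial>\<Omega>) \<le> ennreal (2 * (1/2)^j)" for j
  proof -
    have g: "(\<lambda>(x, y). dist x y) \<in> borel_measurable (borel :: ('b \<times> 'b) measure)"
      by (auto intro!: borel_measurable_continuous_onI continuous_intros simp: case_prod_beta)
    have "(\<integral>\<^sup>+\<omega>. ennreal (dist (\<omega> j) (\<omega> (Suc j))) \<partial>\<Omega>) = ennreal (\<integral>\<omega>. dist (\<omega> j) (\<omega> (Suc j)) \<partial>\<Omega>)"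
      using intb[OF g, of j "Suc j"] by (intro nn_integral_eq_integral) auto
    also have "(\<integral>\<omega>. dist (\<omega> j) (\<omega> (Suc j)) \<partial>\<Omega>) = L (\<lambda>w. dist (D j w) (D (Suc j) w))"
      using int[OF g, of j "Suc j"] by simp
    also have "L (\<lambda>w. dist (D j w) (D (Suc j) w)) \<le> L (\<lambda>w. norm (D j w - w) + norm (D (Suc j) w - w))"
    proof (rule L_mono)
      show le: "dist (D j w) (D (Suc j) w) \<le> norm (D j w - w) + norm (D (Suc j) w - w)" for w
        by (metis dist_norm dist_triangle2)
      show q: "(\<lambda>w. norm (D j w - w) + norm (D (Suc j) w - w)) \<in> quad_funs" by (intro quad_funs_intros Dq)
      show "(\<lambda>w. dist (D j w) (D (Suc j) w)) \<in> quad_funs"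
        by (rule quad_funs_dominated[OF q]) (use le in simp)
    qed
    also have "\<dots> \<le> (1/2)^j + (1/2)^Suc j" using DL[of j] DL[of "Suc j"] by (subst L_add) (auto intro: Dq)
    also have "\<dots> \<le> 2 * (1/2)^j" by simp
    finally show ?thesis by (simp add: ennreal_leI)
  qed
  have "(\<integral>\<^sup>+\<omega>. (\<Sum>j. ennreal (dist (\<omega> j) (\<omega> (Suc j)))) \<partial>\<Omega>) = (\<Sum>j. \<integral>\<^sup>+\<omega>. ennreal (dist (\<omega> j) (\<omega> (Suc j))) \<partial>\<Omega>)"
    by (rule nn_integral_suminf) simp
  also have "\<dots> \<le> (\<Sum>j. ennreal (2 * (1/2)^j))" by (intro suminf_le E) auto
  also have "\<dots> = ennreal (\<Sum>j. 2 * (1/2)^j)"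
    by (intro suminf_ennreal2) (auto intro!: summable_mult summable_geometric)
  also have "\<dots> < \<infinity>" by simp
  finally have "AE \<omega> in \<Omega>. (\<Sum>j. ennreal (dist (\<omega> j) (\<omega> (Suc j)))) \<noteq> \<infinity>"
    by (intro nn_integral_PInf_AE) auto
  then have conv: "AE \<omega> in \<Omega>. (\<lambda>j. \<omega> j) \<longlonglongrightarrow> lim (\<lambda>j. \<omega> j)"
  proof eventually_elim
    case (elim \<omega>)
    then have "summable (\<lambda>j. dist (\<omega> j) (\<omega> (Suc j)))" by (intro summable_suminf_not_top) auto
    then have "summable (\<lambda>j. \<omega> (Suc j) - \<omega> j)"
      by (intro summable_norm_cancel[of "\<lambda>j. \<omega> (Suc j) - \<omega> j"]) (simp add: dist_norm norm_minus_commute)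
    then have "convergent (\<lambda>n. \<Sum>j<n. \<omega> (Suc j) - \<omega> j)" by (simp add: summable_iff_convergent)
    then have "convergent (\<lambda>n. \<omega> n - \<omega> 0)" by (simp add: sum_lessThan_telescope)
    then obtain l where "(\<lambda>n. \<omega> n - \<omega> 0) \<longlonglongrightarrow> l" by (auto simp: convergent_def)
    from tendsto_add[OF this tendsto_const[of "\<omega> 0"]] have "convergent (\<lambda>n. \<omega> n)" by (auto simp: convergent_def)
    then show ?case by (simp add: convergent_LIMSEQ_iff)
  qed
  define X where "X \<omega> = lim (\<lambda>j. \<omega> j)" for \<omega> :: "nat \<Rightarrow> 'b"
  have X[measurable]: "X \<in> borel_measurable \<Omega>"
    unfolding X_def by (rule borel_measurable_lim_metric) (rule comp)
  show ?thesis
  proof (rule that[of "distr \<Omega> borel X"])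
    show "prob_space (distr \<Omega> borel X)" by (rule \<Omega>.prob_space_distr) simp
    fix h :: "'b \<Rightarrow> real" and C K :: real assume K: "\<And>w. \<bar>h w\<bar> \<le> K" and lip: "C-lipschitz_on UNIV h"
    have cont: "continuous_on UNIV h" using lip by (rule lipschitz_on_continuous_on)
    then have [measurable]: "h \<in> borel_measurable borel" by (rule borel_measurable_continuous_onI)
    have hq: "h \<in> quad_funs" using K by (rule quad_funs_bounded)
    have hDq: "(\<lambda>w. h (D j w)) \<in> quad_funs" for j using K by (intro quad_funs_bounded)
    have "(\<lambda>j. \<integral>\<omega>. h (\<omega> j) \<partial>\<Omega>) \<longlonglongrightarrow> (\<integral>\<omega>. h (X \<omega>) \<partial>\<Omega>)"
    proof (rule integral_dominated_convergence[where w = "\<lambda>_. K"])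
      show "AE \<omega> in \<Omega>. (\<lambda>j. h (\<omega> j)) \<longlonglongrightarrow> h (X \<omega>)"
        using conv
      proof eventually_elim
        case (elim \<omega>)
        have "isCont h (lim (\<lambda>j. \<omega> j))" using cont by (simp add: continuous_on_eq_continuous_at)
        from isCont_tendsto_compose[OF this elim] show ?case by (simp add: X_def)
      qed
    qed (use K in auto)
    moreover have "(\<integral>\<omega>. h (\<omega> j) \<partial>\<Omega>) = L (\<lambda>w. h (D j w))" for j
    proof -
      have "(fst :: 'b \<times> 'b \<Rightarrow> 'b) \<in> borel_measurable borel"
        by (intro borel_measurable_continuous_onI continuous_intros)
      then have "(\<lambda>z :: 'b \<times> 'b. h (fst z)) \<in> borel_measurable borel" by measurable
      from int[OF this, of j j] show ?thesis by simp
    qed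
    moreover have "(\<lambda>j. L (\<lambda>w. h (D j w))) \<longlonglongrightarrow> L h"
    proof (rule LIM_zero_cancel, rule Lim_null_comparison)
      show "eventually (\<lambda>j. norm (L (\<lambda>w. h (D j w)) - L h) \<le> C * (1/2)^j) sequentially"
      proof (rule always_eventually, rule allI)
        fix j
        have C: "0 \<le> C" using lip by (rule lipschitz_on_nonneg)
        have "norm (L (\<lambda>w. h (D j w)) - L h) = \<bar>L (\<lambda>w. h (D j w) - h w)\<bar>"
          by (subst L_diff[OF hDq hq]) simp
        also have "\<dots> \<le> L (\<lambda>w. C * norm (D j w - w))"
        proof (rule L_abs_le)
          show "\<bar>h (D j w) - h w\<bar> \<le> C * norm (D j w - w)" for w
            using lipschitz_onD[OF lip, of "D j w" w] by (simp add: dist_norm)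
        qed (intro quad_funs_intros hDq hq Dq)+
        also have "\<dots> \<le> C * (1/2)^j" using C DL[of j] by (simp add: L_cmult[OF Dq] mult_left_mono)
        finally show "norm (L (\<lambda>w. h (D j w)) - L h) \<le> C * (1/2)^j" .
      qed
      show "(\<lambda>j. C * (1/2)^j) \<longlonglongrightarrow> 0" by (intro tendsto_mult_right_zero LIMSEQ_power_zero) simp
    qed
    ultimately have "(\<integral>\<omega>. h (X \<omega>) \<partial>\<Omega>) = L h" by (simp add: LIMSEQ_unique)
    then show "(\<integral>w. h w \<partial>distr \<Omega> borel X) = L h" by (subst integral_distr) auto
  qed simp
qed

end

subsection \<open>The Zolotarev problem and its optimal potentials\<close>

lemma C11_quad:
  assumes "C11 u G"
  shows "u \<in> quad_funs"
proof -
  have q: "(\<lambda>x. \<bar>u 0\<bar> + norm (G 0) * norm x + (1/2) * (norm x)\<^sup>2) \<in> quad_funs" by (intro quad_funs_intros)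
  show ?thesis
  proof (rule quad_funs_dominated[OF q])
    fix x
    have "\<bar>u x - u 0 - G 0 \<bullet> (x - 0)\<bar> \<le> (norm (x - 0))\<^sup>2 / 2" using assms unfolding C11_def by blast
    moreover have "\<bar>G 0 \<bullet> x\<bar> \<le> norm (G 0) * norm x" by (rule Cauchy_Schwarz_ineq2)
    ultimately show "\<bar>u x\<bar> \<le> \<bar>u 0\<bar> + norm (G 0) * norm x + (1/2) * (norm x)\<^sup>2" unfolding diff_zero by linarith
  qed
qed

lemma C11_continuous:
  fixes u :: "'a::euclidean_space \<Rightarrow> real"
  assumes "C11 u G"
  shows "continuous_on UNIV u" "continuous_on UNIV G"
proof -
  show "continuous_on UNIV u"
    using C11_imp_lip1_grad[OF assms] has_derivative_continuous
    by (fastforce simp: lip1_grad_def continuous_on_eq_continuous_at)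
  have "1-lipschitz_on UNIV G"
    using C11_gradient_lipschitz[OF assms] by (intro lipschitz_onI) (auto simp: dist_norm)
  then show "continuous_on UNIV G" by (rule lipschitz_on_continuous_on)
qed

lemma C11_measurable:
  fixes u :: "'a::euclidean_space \<Rightarrow> real"
  assumes "C11 u G"
  shows "u \<in> borel_measurable borel" "G \<in> borel_measurable borel"
  using C11_continuous[OF assms] by (auto intro: borel_measurable_continuous_onI)

abbreviation square_integrable :: "'w measure \<Rightarrow> ('w \<Rightarrow> 'a::real_normed_vector) \<Rightarrow> bool" where
  "square_integrable M f \<equiv> integrable M (\<lambda>z. (norm (f z))\<^sup>2)"

abbreviation second_moment :: "'w measure \<Rightarrow> ('w \<Rightarrow> 'a::real_normed_vector) \<Rightarrow> real" where
  "second_moment M f \<equiv> \<integral>z. (norm (f z))\<^sup>2 \<partial>M"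

abbreviation half_sq_dist :: "('a::real_normed_vector \<times> 'a \<Rightarrow> 'a) \<Rightarrow> 'a \<times> 'a \<Rightarrow> real" where
  "half_sq_dist \<zeta> z \<equiv> (1/2) * ((norm (\<zeta> z - fst z))\<^sup>2 + (norm (\<zeta> z - snd z))\<^sup>2)"

lemma P2_D:
  assumes "M \<in> P2"
  shows "prob_space M" "sets M = sets borel" "integrable M (\<lambda>x. (norm x)\<^sup>2)" "measurable M N = measurable borel N"
    "space M = UNIV"
  using assms sets_eq_imp_space_eq[of M borel] by (auto simp: P2_def cong: measurable_cong_sets)

lemma P2_integrable:
  fixes f :: "'a::euclidean_space \<Rightarrow> real"
  assumes M: "M \<in> P2" and f: "f \<in> borel_measurable borel" "f \<in> quad_funs"
  shows "integrable M f"
proof -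
  interpret prob_space M by (rule P2_D[OF M])
  obtain K where K: "\<And>x. \<bar>f x\<bar> \<le> K * (1 + (norm x)\<^sup>2)" using f(2) by (auto simp: quad_funs_def)
  have "integrable M (\<lambda>x. K * (1 + (norm x)\<^sup>2))"
    using P2_D(3)[OF M] by (intro integrable_mult_right Bochner_Integration.integrable_add) auto
  then show ?thesis
    by (rule Bochner_Integration.integrable_bound)
       (use f K P2_D[OF M] in \<open>auto intro!: AE_I2 intro: order_trans[OF _ abs_ge_self]\<close>)
qed

lemma P2_integrable_id:
  assumes M: "M \<in> P2"
  shows "integrable M (\<lambda>x::'a::euclidean_space. x)"
proof -
  have "integrable M (norm :: 'a \<Rightarrow> real)" by (rule P2_integrable[OF M]) (auto intro: quad_funs_intros)
  then show ?thesis by (rule Bochner_Integration.integrable_bound) (use P2_D[OF M] in auto)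
qed

lemma P2_integral_inner:
  assumes M: "M \<in> P2"
  shows "integrable M (\<lambda>x. v \<bullet> x)" "(\<integral>x. v \<bullet> x \<partial>M) = v \<bullet> bary M"
  using P2_integrable_id[OF M] by (auto simp: bary_def)

lemma C11_integrable: "M \<in> P2 \<Longrightarrow> C11 u G \<Longrightarrow> integrable M u"
  by (intro P2_integrable C11_measurable C11_quad)

lemma C11_zero: "C11 (\<lambda>_. 0) (\<lambda>_. 0)"
  by (simp add: C11_def)

lemma Z2_eq: "Z2 \<mu> \<nu> = Sup {(\<integral>x. u x \<partial>\<mu>) - (\<integral>x. u x \<partial>\<nu>) | u. \<exists>G. C11 u G}"
  by (simp add: Z2_def lip1_grad_iff_C11)

lemma Z2_least: "(\<And>u G. C11 u G \<Longrightarrow> (\<integral>x. u x \<partial>\<mu>) - (\<integral>x. u x \<partial>\<nu>) \<le> r) \<Longrightarrow> Z2 \<mu> \<nu> \<le> r"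
  unfolding Z2_eq using C11_zero by (intro cSup_least) blast+

lemma Z2_swap: "Z2 \<mu> \<nu> = Z2 \<nu> \<mu>"
proof -
  have sub: "{(\<integral>x. u x \<partial>\<mu>) - (\<integral>x. u x \<partial>\<nu>) | u. \<exists>G. C11 u G} \<subseteq> {(\<integral>x. u x \<partial>\<nu>) - (\<integral>x. u x \<partial>\<mu>) | u. \<exists>G. C11 u G}"
    for \<mu> \<nu> :: "'a::euclidean_space measure"
  proof
    fix r assume "r \<in> {(\<integral>x. u x \<partial>\<mu>) - (\<integral>x. u x \<partial>\<nu>) | u. \<exists>G. C11 u G}"
    then obtain u G where u: "r = (\<integral>x. u x \<partial>\<mu>) - (\<integral>x. u x \<partial>\<nu>)" "C11 u G" by blast
    have "r = (\<integral>x. - u x \<partial>\<nu>) - (\<integral>x. - u x \<partial>\<mu>)" using u by simp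
    then show "r \<in> {(\<integral>x. u x \<partial>\<nu>) - (\<integral>x. u x \<partial>\<mu>) | u. \<exists>G. C11 u G}"
      using C11_uminus[OF u(2)] by blast
  qed
  show ?thesis unfolding Z2_eq using sub[of \<mu> \<nu>] sub[of \<nu> \<mu>] by (intro arg_cong[where f = Sup]) blast
qed

locale P2_pair =
  fixes \<mu> \<nu> :: "'a::euclidean_space measure"
  assumes \<mu>: "\<mu> \<in> P2" and \<nu>: "\<nu> \<in> P2" and bary: "bary \<mu> = bary \<nu>"
begin

lemma swap: "P2_pair \<nu> \<mu>"
  using \<mu> \<nu> bary by (simp add: P2_pair_def)

sublocale M: prob_space \<mu> by (rule P2_D(1)[OF \<mu>])
sublocale N: prob_space \<nu> by (rule P2_D(1)[OF \<nu>])

text \<open>Expansion at the origin bounds \<open>u\<close> above under \<open>\<mu>\<close> and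
  below under \<open>\<nu>\<close>. The constant and linear terms cancel because masses and
  barycentres agree; without this the supremum defining \<open>Z2\<close> could be infinite.\<close>

lemma C11_value_bound:
  assumes "C11 u G"
  shows "(\<integral>x. u x \<partial>\<mu>) - (\<integral>x. u x \<partial>\<nu>) \<le> (m2 \<mu> + m2 \<nu>) / 2"
proof -
  have "(\<integral>x. u x \<partial>\<mu>) \<le> (\<integral>x. u 0 + G 0 \<bullet> x + (norm x)\<^sup>2 / 2 \<partial>\<mu>)"
    using C11_upper[OF assms, of _ 0] P2_integral_inner[OF \<mu>] P2_D(3)[OF \<mu>]
    by (intro integral_mono C11_integrable[OF \<mu> assms]) auto
  also have "\<dots> = u 0 + G 0 \<bullet> bary \<mu> + m2 \<mu> / 2"
    using P2_integral_inner[OF \<mu>] P2_D(3)[OF \<mu>] by (simp add: m2_def M.prob_space)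
  finally have 1: "(\<integral>x. u x \<partial>\<mu>) \<le> u 0 + G 0 \<bullet> bary \<mu> + m2 \<mu> / 2" .
  have "u 0 + G 0 \<bullet> bary \<nu> - m2 \<nu> / 2 = (\<integral>x. u 0 + G 0 \<bullet> x - (norm x)\<^sup>2 / 2 \<partial>\<nu>)"
    using P2_integral_inner[OF \<nu>] P2_D(3)[OF \<nu>] by (simp add: m2_def N.prob_space)
  also have "\<dots> \<le> (\<integral>x. u x \<partial>\<nu>)"
    using C11_lower[OF assms, of 0] P2_integral_inner[OF \<nu>] P2_D(3)[OF \<nu>]
    by (intro integral_mono C11_integrable[OF \<nu> assms]) auto
  finally show ?thesis using 1 by (simp add: bary)
qed

lemma Z2_upper:
  assumes "C11 u G"
  shows "(\<integral>x. u x \<partial>\<mu>) - (\<integral>x. u x \<partial>\<nu>) \<le> Z2 \<mu> \<nu>"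
  unfolding Z2_eq
proof (rule cSup_upper)
  show "bdd_above {(\<integral>x. u x \<partial>\<mu>) - (\<integral>x. u x \<partial>\<nu>) | u. \<exists>G. C11 u G}"
    using C11_value_bound by (intro bdd_aboveI[of _ "(m2 \<mu> + m2 \<nu>) / 2"]) blast
qed (use assms in blast)

text \<open>Subtracting the affine part at the origin does not change the value, again by equality
  of masses and barycentres. The normalisation supplies the uniform bounds needed for
  compactness.\<close>

lemma ex_near_optimal:
  assumes "0 < e"
  obtains u G where "C11 u G" "Z2 \<mu> \<nu> - e < (\<integral>x. u x \<partial>\<mu>) - (\<integral>x. u x \<partial>\<nu>)" "u 0 = 0" "G 0 = 0"
proof -
  obtain u G where u: "C11 u G" "Z2 \<mu> \<nu> - e < (\<integral>x. u x \<partial>\<mu>) - (\<integral>x. u x \<partial>\<nu>)"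
    using Z2_least[of \<mu> \<nu> "Z2 \<mu> \<nu> - e"] assms by force
  define v where "v x = u x - u 0 - G 0 \<bullet> x" for x
  have "C11 v (\<lambda>x. G x - G 0)"
    using u(1) unfolding C11_def v_def by (simp add: inner_diff_left inner_diff_right algebra_simps)
  moreover have "(\<integral>x. v x \<partial>\<mu>) - (\<integral>x. v x \<partial>\<nu>) = (\<integral>x. u x \<partial>\<mu>) - (\<integral>x. u x \<partial>\<nu>)"
    using C11_integrable[OF \<mu> u(1)] C11_integrable[OF \<nu> u(1)] P2_integral_inner[OF \<mu>] P2_integral_inner[OF \<nu>]
    by (simp add: v_def M.prob_space N.prob_space bary)
  ultimately show ?thesis using u(2) by (intro that[of v "\<lambda>x. G x - G 0"]) (auto simp: v_def)
qed

end

section \<open>Compactness of normalised potentials and existence of an optimal one\<close>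

lemma pointwise_convergent_subseq_countable:
  fixes f :: "nat \<Rightarrow> nat \<Rightarrow> real"
  assumes "\<And>n i. \<bar>f n i\<bar> \<le> B i"
  obtains r where "strict_mono r" "\<And>i. convergent (\<lambda>n. f (r n) i)"
proof -
  interpret subseqs "\<lambda>i s. convergent (\<lambda>n. f (s n) i)"
  proof
    fix i and s :: "nat \<Rightarrow> nat"
    have "bounded (range (\<lambda>n. f (s n) i))"
      using assms by (intro boundedI[of _ "B i"]) auto
    then obtain l r where "strict_mono r" "((\<lambda>n. f (s n) i) \<circ> r) \<longlonglongrightarrow> l"
      using bounded_imp_convergent_subsequence by blast
    then show "\<exists>r. strict_mono r \<and> convergent (\<lambda>n. f ((s \<circ> r) n) i)"
      by (auto simp: convergent_def comp_def)
  qed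
  show ?thesis
  proof (rule that[of diagseq])
    show "strict_mono diagseq" by (rule subseq_diagseq)
    fix i
    have "convergent (\<lambda>n. f ((diagseq \<circ> ((+) (Suc i))) n) i)"
    proof (rule diagseq_holds)
      fix r s :: "nat \<Rightarrow> nat" and n assume "strict_mono r" "convergent (\<lambda>k. f (s k) n)"
      then show "convergent (\<lambda>k. f ((s \<circ> r) k) n)"
        using convergent_subseq_convergent[of "\<lambda>k. f (s k) n" r] by (simp add: comp_def)
    qed
    then have "convergent (\<lambda>n. f (diagseq (n + Suc i)) i)" by (simp add: comp_def add.commute)
    then show "convergent (\<lambda>n. f (diagseq n) i)"
      by (rule convergent_ignore_initial_segment[THEN iffD1, of _ "Suc i"])
  qed
qed

text \<open>An Arzela-Ascoli argument for pointwise convergence: a diagonal subsequence converges on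
  a dense set, and equicontinuity carries this to every point. The gradients \<open>G n\<close> need
  not be followed, since convexity of \<open>v + |.|^2/2\<close> and of \<open>|.|^2/2 - v\<close>
  passes to pointwise limits and \<open>C11_if_convex\<close> recovers a gradient.\<close>

lemma C11_subseq_limit:
  fixes u :: "nat \<Rightarrow> 'a::euclidean_space \<Rightarrow> real"
  assumes u: "\<And>n. C11 (u n) (G n)" "\<And>n. u n 0 = 0" "\<And>n. G n 0 = 0"
  obtains r v H where "strict_mono r" "C11 v H" "\<And>x. (\<lambda>n. u (r n) x) \<longlonglongrightarrow> v x"
proof -
  have ub: "\<bar>u n x\<bar> \<le> (norm x)\<^sup>2 / 2" for n x
    using u(1)[of n, unfolded C11_def, rule_format, of x 0] u(2,3) by simp
  \<comment> \<open>Equicontinuity, uniform in \<open>n\<close>: the normalisation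
    \<open>G n 0 = 0\<close> and the Lipschitz bound give \<open>|G n y| \<le> |y|\<close>.\<close>
  have loc: "\<bar>u n x - u n y\<bar> \<le> norm y * norm (x - y) + (norm (x - y))\<^sup>2 / 2" for n x y
  proof -
    have "\<bar>G n y \<bullet> (x - y)\<bar> \<le> norm (G n y) * norm (x - y)" by (rule Cauchy_Schwarz_ineq2)
    also have "\<dots> \<le> norm y * norm (x - y)"
      using C11_gradient_lipschitz[OF u(1), of n y 0] u(3) by (intro mult_right_mono) auto
    finally show ?thesis using u(1)[of n, unfolded C11_def, rule_format, of x y] by linarith
  qed
  obtain D :: "'a set" where D: "countable D" "\<And>X. open X \<Longrightarrow> X \<noteq> {} \<Longrightarrow> \<exists>d\<in>D. d \<in> X"
    using countable_dense_exists by blast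
  have "D \<noteq> {}" using D(2)[of UNIV] by auto
  define d where "d = from_nat_into D"
  have rd: "range d = D" unfolding d_def using D(1) \<open>D \<noteq> {}\<close> by (rule range_from_nat_into[rotated])
  obtain r where r: "strict_mono r" "\<And>i. convergent (\<lambda>n. u (r n) (d i))"
    using pointwise_convergent_subseq_countable[of "\<lambda>n i. u n (d i)" "\<lambda>i. (norm (d i))\<^sup>2 / 2"] ub by blast
  have "convergent (\<lambda>n. u (r n) x)" for x
  proof -
    have "Cauchy (\<lambda>n. u (r n) x)"
    proof (rule metric_CauchyI)
      fix e :: real assume e: "0 < e"
      have "((\<lambda>y. norm y * norm (x - y) + (norm (x - y))\<^sup>2 / 2) \<longlongrightarrow> norm x * norm (x - x) + (norm (x - x))\<^sup>2 / 2) (nhds x)"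
        by (intro tendsto_intros filterlim_ident) simp
      then have "((\<lambda>y. norm y * norm (x - y) + (norm (x - y))\<^sup>2 / 2) \<longlongrightarrow> 0) (nhds x)" by simp
      from order_tendstoD(2)[OF this, of "e / 3"] e obtain S where S: "open S" "x \<in> S"
        "\<And>y. y \<in> S \<Longrightarrow> norm y * norm (x - y) + (norm (x - y))\<^sup>2 / 2 < e / 3"
        by (auto simp: eventually_nhds)
      obtain y where "y \<in> D" "y \<in> S" using D(2)[of S] S by auto
      then obtain i where y: "y = d i" using rd by auto
      have "Cauchy (\<lambda>n. u (r n) y)" unfolding y using r(2) by (rule convergent_Cauchy)
      then obtain K where K: "\<And>m n. m \<ge> K \<Longrightarrow> n \<ge> K \<Longrightarrow> dist (u (r m) y) (u (r n) y) < e / 3"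
        using e by (meson metric_CauchyD zero_less_divide_iff zero_less_numeral)
      show "\<exists>M. \<forall>m\<ge>M. \<forall>n\<ge>M. dist (u (r m) x) (u (r n) x) < e"
      proof (intro exI[of _ K] allI impI)
        fix m n assume "K \<le> m" "K \<le> n"
        then have "\<bar>u (r m) y - u (r n) y\<bar> < e / 3" using K by (simp add: dist_real_def)
        moreover have "\<bar>u (r m) x - u (r m) y\<bar> < e / 3" "\<bar>u (r n) x - u (r n) y\<bar> < e / 3"
          using loc[of "r m" x y] loc[of "r n" x y] S(3)[OF \<open>y \<in> S\<close>] by linarith+
        ultimately show "dist (u (r m) x) (u (r n) x) < e" unfolding dist_real_def by linarith
      qed
    qed
    then show ?thesis by (rule Cauchy_convergent)
  qed
  then obtain v where v: "\<And>x. (\<lambda>n. u (r n) x) \<longlonglongrightarrow> v x" unfolding convergent_def by metis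
  have conv_lim: "convex_on UNIV w" if c: "\<And>n. convex_on UNIV (c n)" and l: "\<And>x. (\<lambda>n. c n x) \<longlonglongrightarrow> w x"
    for c :: "nat \<Rightarrow> 'a \<Rightarrow> real" and w
  proof (rule convex_onI)
    fix t :: real and x y :: 'a assume t: "0 < t" "t < 1"
    show "w ((1 - t) *\<^sub>R x + t *\<^sub>R y) \<le> (1 - t) * w x + t * w y"
    proof (rule LIMSEQ_le)
      show "(\<lambda>n. c n ((1 - t) *\<^sub>R x + t *\<^sub>R y)) \<longlonglongrightarrow> w ((1 - t) *\<^sub>R x + t *\<^sub>R y)" by (rule l)
      show "(\<lambda>n. (1 - t) * c n x + t * c n y) \<longlonglongrightarrow> (1 - t) * w x + t * w y" by (intro tendsto_intros l)
      show "\<exists>N. \<forall>n\<ge>N. c n ((1 - t) *\<^sub>R x + t *\<^sub>R y) \<le> (1 - t) * c n x + t * c n y"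
        using t by (intro exI[of _ 0] allI impI convex_onD[OF c]) auto
    qed
  qed simp
  have "convex_on UNIV (\<lambda>x. v x + (norm x)\<^sup>2 / 2)"
    by (rule conv_lim[of "\<lambda>n x. u (r n) x + (norm x)\<^sup>2 / 2", OF C11_convex[OF u(1)]]) (intro tendsto_intros v)
  moreover have "convex_on UNIV (\<lambda>x. - v x + (norm x)\<^sup>2 / 2)"
    by (rule conv_lim[of "\<lambda>n x. - u (r n) x + (norm x)\<^sup>2 / 2", OF C11_convex[OF C11_uminus[OF u(1)]]])
      (intro tendsto_intros v)
  then have "convex_on UNIV (\<lambda>x. (norm x)\<^sup>2 - (v x + (norm x)\<^sup>2 / 2))" by (simp add: algebra_simps)
  ultimately obtain H where "C11 (\<lambda>x. v x + (norm x)\<^sup>2 / 2 - (norm x)\<^sup>2 / 2) H"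
    using C11_if_convex by blast
  then have "C11 v H" by simp
  from that[OF r(1) this v] show ?thesis .
qed

context P2_pair begin

lemma ex_optimal_C11:
  obtains u G where "C11 u G" "(\<integral>x. u x \<partial>\<mu>) - (\<integral>x. u x \<partial>\<nu>) = Z2 \<mu> \<nu>"
proof -
  have "\<exists>p. C11 (fst p) (snd p) \<and> Z2 \<mu> \<nu> - 1 / real (Suc n) < (\<integral>x. fst p x \<partial>\<mu>) - (\<integral>x. fst p x \<partial>\<nu>)
      \<and> fst p 0 = 0 \<and> snd p 0 = 0" for n
  proof -
    have "0 < 1 / real (Suc n)" by simp
    then obtain u G where "C11 u G" "Z2 \<mu> \<nu> - 1 / real (Suc n) < (\<integral>x. u x \<partial>\<mu>) - (\<integral>x. u x \<partial>\<nu>)" "u 0 = 0" "G 0 = 0"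
      by (rule ex_near_optimal)
    then show ?thesis by (intro exI[of _ "(u, G)"] conjI) (simp_all only: fst_conv snd_conv)
  qed
  from choice[OF allI[OF this]] obtain p where
    p: "\<forall>n. C11 (fst (p n)) (snd (p n)) \<and> Z2 \<mu> \<nu> - 1 / real (Suc n) < (\<integral>x. fst (p n) x \<partial>\<mu>) - (\<integral>x. fst (p n) x \<partial>\<nu>)
      \<and> fst (p n) 0 = 0 \<and> snd (p n) 0 = 0" ..
  define u where "u n = fst (p n)" for n
  define G where "G n = snd (p n)" for n
  have u: "C11 (u n) (G n)" "u n 0 = 0" "G n 0 = 0"
    and val: "Z2 \<mu> \<nu> - 1 / real (Suc n) < (\<integral>x. u n x \<partial>\<mu>) - (\<integral>x. u n x \<partial>\<nu>)" for n
    using p by (auto simp: u_def G_def)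
  obtain r v H where r: "strict_mono r" and v: "C11 v H" "\<And>x. (\<lambda>n. u (r n) x) \<longlonglongrightarrow> v x"
    by (rule C11_subseq_limit[of u G, OF u]) (rule that)
  have ub: "\<bar>u n x\<bar> \<le> (norm x)\<^sup>2 / 2" for n x
    using u(1)[of n, unfolded C11_def, rule_format, of x 0] u(2,3) by simp
  \<comment> \<open>Normalisation at the origin gives the common bound \<open>|x|^2/2\<close>,
    integrable for every member of \<open>P2\<close>, so pointwise convergence of the potentials is
    enough.\<close>
  have lim: "(\<lambda>n. \<integral>x. u (r n) x \<partial>M) \<longlonglongrightarrow> (\<integral>x. v x \<partial>M)" if M: "M \<in> P2" for M
  proof (rule integral_dominated_convergence[where w = "\<lambda>x. (norm x)\<^sup>2 / 2"])
    show "integrable M (\<lambda>x. (norm x)\<^sup>2 / 2)" using P2_D(3)[OF M] by simp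
  qed (use v ub C11_measurable[OF v(1)] C11_measurable[OF u(1)] P2_D[OF M] in auto)
  have "Z2 \<mu> \<nu> \<le> (\<integral>x. v x \<partial>\<mu>) - (\<integral>x. v x \<partial>\<nu>)"
  proof (rule LIMSEQ_le)
    have "(\<lambda>n. Z2 \<mu> \<nu> - 1 / real (Suc n)) \<longlonglongrightarrow> Z2 \<mu> \<nu> - 0"
      by (intro tendsto_intros LIMSEQ_Suc[OF lim_1_over_n])
    then show "(\<lambda>n. Z2 \<mu> \<nu> - 1 / real (Suc n)) \<longlonglongrightarrow> Z2 \<mu> \<nu>" by simp
    show "(\<lambda>n. (\<integral>x. u (r n) x \<partial>\<mu>) - (\<integral>x. u (r n) x \<partial>\<nu>)) \<longlonglongrightarrow> (\<integral>x. v x \<partial>\<mu>) - (\<integral>x. v x \<partial>\<nu>)"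
      by (intro tendsto_diff lim \<mu> \<nu>)
    show "\<exists>N. \<forall>n\<ge>N. Z2 \<mu> \<nu> - 1 / real (Suc n) \<le> (\<integral>x. u (r n) x \<partial>\<mu>) - (\<integral>x. u (r n) x \<partial>\<nu>)"
    proof (intro exI[of _ 0] allI impI)
      fix n
      have "n \<le> r n" using r by (rule seq_suble)
      then have "1 / real (Suc (r n)) \<le> 1 / real (Suc n)" by (simp add: frac_le)
      then show "Z2 \<mu> \<nu> - 1 / real (Suc n) \<le> (\<integral>x. u (r n) x \<partial>\<mu>) - (\<integral>x. u (r n) x \<partial>\<nu>)"
        using val[of "r n"] by linarith
    qed
  qed
  with Z2_upper[OF v(1)] have "(\<integral>x. v x \<partial>\<mu>) - (\<integral>x. v x \<partial>\<nu>) = Z2 \<mu> \<nu>" by simp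
  with v(1) show ?thesis by (rule that)
qed

definition V where "V = Z2 \<mu> \<nu> + (m2 \<mu> + m2 \<nu>) / 2"

end

section \<open>The bound on dual candidates\<close>

lemma convex_on_SUP_affine:
  fixes p :: "'i \<Rightarrow> 'a::real_inner"
  assumes "\<And>z. bdd_above (range (\<lambda>i. f i + p i \<bullet> (z - q i)))"
  shows "convex_on UNIV (\<lambda>z. SUP i. f i + p i \<bullet> (z - q i))"
proof (rule convex_onI)
  fix t :: real and x y :: 'a assume t: "0 < t" "t < 1"
  show "(SUP i. f i + p i \<bullet> ((1 - t) *\<^sub>R x + t *\<^sub>R y - q i))
      \<le> (1 - t) * (SUP i. f i + p i \<bullet> (x - q i)) + t * (SUP i. f i + p i \<bullet> (y - q i))"
  proof (rule cSUP_least)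
    fix i
    have "f i + p i \<bullet> ((1 - t) *\<^sub>R x + t *\<^sub>R y - q i)
      = (1 - t) * (f i + p i \<bullet> (x - q i)) + t * (f i + p i \<bullet> (y - q i))"
      by (simp add: algebra_simps inner_add_right inner_diff_right)
    also have "\<dots> \<le> (1 - t) * (SUP i. f i + p i \<bullet> (x - q i)) + t * (SUP i. f i + p i \<bullet> (y - q i))"
      using t assms by (intro add_mono mult_left_mono cSUP_upper) auto
    finally show "f i + p i \<bullet> ((1 - t) *\<^sub>R x + t *\<^sub>R y - q i)
      \<le> (1 - t) * (SUP i. f i + p i \<bullet> (x - q i)) + t * (SUP i. f i + p i \<bullet> (y - q i))" .
  qed simp
qed simp

context P2_pair begin

text \<open>The multipliers \<open>\<Phi>\<close> and \<open>\<Psi>\<close> may be arbitrary maps: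
  they enter only as slopes of affine functions of \<open>z\<close> and are never integrated. After
  the suprema and the sandwich, \<open>f\<close> is below \<open>u + |.|^2/2\<close> and
  \<open>g\<close> is below \<open>|.|^2/2 - u\<close>, and integrating these two bounds produces
  the offset in \<open>V\<close>.\<close>

lemma dual_bound_unit:
  assumes f: "integrable \<mu> f" and g: "integrable \<nu> g"
    and le: "\<And>x y z. f x + g y + \<Phi> x \<bullet> (z - x) + \<Psi> y \<bullet> (z - y) \<le> (norm z)\<^sup>2"
  shows "(\<integral>x. f x \<partial>\<mu>) + (\<integral>y. g y \<partial>\<nu>) \<le> V"
proof -
  define \<phi> where "\<phi> z = (SUP x. f x + \<Phi> x \<bullet> (z - x))" for z
  define \<psi> where "\<psi> z = (SUP y. g y + \<Psi> y \<bullet> (z - y))" for z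
  \<comment> \<open>Freezing the other variable, here at 0, turns the dual inequality into an upper
    bound for the supremum.\<close>
  have bf: "bdd_above (range (\<lambda>x. f x + \<Phi> x \<bullet> (z - x)))" for z
    using le[of _ 0 z] by (intro bdd_aboveI[of _ "(norm z)\<^sup>2 - (g 0 + \<Psi> 0 \<bullet> (z - 0))"]) (auto simp: algebra_simps)
  have bg: "bdd_above (range (\<lambda>y. g y + \<Psi> y \<bullet> (z - y)))" for z
    using le[of 0 _ z] by (intro bdd_aboveI[of _ "(norm z)\<^sup>2 - (f 0 + \<Phi> 0 \<bullet> (z - 0))"]) (auto simp: algebra_simps)
  have "\<phi> z + \<psi> z \<le> (norm z)\<^sup>2" for z
  proof -
    have "\<psi> z \<le> (norm z)\<^sup>2 - (f x + \<Phi> x \<bullet> (z - x))" for x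
      unfolding \<psi>_def using le[of x _ z] by (intro cSUP_least) (auto simp: algebra_simps)
    then have "\<phi> z \<le> (norm z)\<^sup>2 - \<psi> z"
      unfolding \<phi>_def by (intro cSUP_least) (auto simp: algebra_simps)
    then show ?thesis by simp
  qed
  moreover have "convex_on UNIV \<phi>" unfolding \<phi>_def by (rule convex_on_SUP_affine[OF bf])
  moreover have "convex_on UNIV \<psi>" unfolding \<psi>_def by (rule convex_on_SUP_affine[OF bg])
  ultimately obtain F where F: "convex_on UNIV F" "convex_on UNIV (\<lambda>x. (norm x)\<^sup>2 - F x)"
    "\<And>z. \<phi> z \<le> F z" "\<And>z. \<psi> z \<le> (norm z)\<^sup>2 - F z"
    using convex_sandwich by blast
  define u where "u x = F x - (norm x)\<^sup>2 / 2" for x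
  obtain G where u: "C11 u G" using C11_if_convex[OF F(1,2)] by (auto simp: u_def[abs_def])
  have "f x \<le> \<phi> x" for x unfolding \<phi>_def using cSUP_upper[OF _ bf, of x x] by simp
  then have fu: "f x \<le> u x + (norm x)\<^sup>2 / 2" for x using F(3)[of x] order_trans[of "f x" "\<phi> x" "F x"] by (simp add: u_def)
  have "g y \<le> \<psi> y" for y unfolding \<psi>_def using cSUP_upper[OF _ bg, of y y] by simp
  then have gu: "g y \<le> (norm y)\<^sup>2 / 2 - u y" for y
    using F(4)[of y] order_trans[of "g y" "\<psi> y" "(norm y)\<^sup>2 - F y"] by (simp add: u_def)
  have "(\<integral>x. f x \<partial>\<mu>) \<le> (\<integral>x. u x + (norm x)\<^sup>2 / 2 \<partial>\<mu>)"
    using fu f C11_integrable[OF \<mu> u] P2_D(3)[OF \<mu>] by (intro integral_mono) auto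
  also have "\<dots> = (\<integral>x. u x \<partial>\<mu>) + m2 \<mu> / 2"
    using C11_integrable[OF \<mu> u] P2_D(3)[OF \<mu>] by (simp add: m2_def)
  finally have 1: "(\<integral>x. f x \<partial>\<mu>) \<le> (\<integral>x. u x \<partial>\<mu>) + m2 \<mu> / 2" .
  have "(\<integral>x. g x \<partial>\<nu>) \<le> (\<integral>x. (norm x)\<^sup>2 / 2 - u x \<partial>\<nu>)"
    using gu g C11_integrable[OF \<nu> u] P2_D(3)[OF \<nu>] by (intro integral_mono) auto
  also have "\<dots> = m2 \<nu> / 2 - (\<integral>x. u x \<partial>\<nu>)"
    using C11_integrable[OF \<nu> u] P2_D(3)[OF \<nu>] by (simp add: m2_def)
  finally show ?thesis using 1 Z2_upper[OF u] unfolding V_def add_divide_distrib by linarith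
qed

text \<open>Dividing by the coefficient of the square reduces to the unit case, but \<open>t\<close>
  may be 0. Hence the bound is shown for every positive \<open>s\<close> with
  \<open>t \<le> s\<close>, and \<open>s\<close> decreases to \<open>t\<close>.\<close>

lemma dual_bound:
  assumes f: "integrable \<mu> f" and g: "integrable \<nu> g" and t: "0 \<le> t"
    and le: "\<And>x y z. f x + g y + \<Phi> x \<bullet> (z - x) + \<Psi> y \<bullet> (z - y) \<le> t * (norm z)\<^sup>2"
  shows "(\<integral>x. f x \<partial>\<mu>) + (\<integral>y. g y \<partial>\<nu>) \<le> t * V"
proof -
  have *: "(\<integral>x. f x \<partial>\<mu>) + (\<integral>y. g y \<partial>\<nu>) \<le> s * V" if s: "0 < s" "t \<le> s" for s
  proof -
    have "(\<integral>x. f x / s \<partial>\<mu>) + (\<integral>y. g y / s \<partial>\<nu>) \<le> V"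
    proof (rule dual_bound_unit)
      fix x y z
      have "f x + g y + \<Phi> x \<bullet> (z - x) + \<Psi> y \<bullet> (z - y) \<le> s * (norm z)\<^sup>2"
        by (rule order_trans[OF le]) (use s in \<open>simp add: mult_right_mono\<close>)
      then have "(f x + g y + \<Phi> x \<bullet> (z - x) + \<Psi> y \<bullet> (z - y)) / s \<le> (norm z)\<^sup>2"
        using s by (simp add: field_simps)
      then show "f x / s + g y / s + (\<Phi> x /\<^sub>R s) \<bullet> (z - x) + (\<Psi> y /\<^sub>R s) \<bullet> (z - y) \<le> (norm z)\<^sup>2"
        by (simp add: divide_inverse_commute distrib_left)
    qed (use f g in auto)
    then have "((\<integral>x. f x \<partial>\<mu>) + (\<integral>y. g y \<partial>\<nu>)) / s \<le> V" by (simp add: add_divide_distrib)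
    then show ?thesis using s by (simp add: field_simps)
  qed
  have "((\<lambda>s. s * V) \<longlongrightarrow> t * V) (at_right t)" by (intro tendsto_intros)
  moreover have "eventually (\<lambda>s. (\<integral>x. f x \<partial>\<mu>) + (\<integral>y. g y \<partial>\<nu>) \<le> s * V) (at_right t)"
    using * t by (auto simp: eventually_at_right_field intro!: exI[of _ "t + 1"])
  ultimately show ?thesis by (rule tendsto_lowerbound) simp
qed

end

subsection \<open>Strong duality\<close>

lemma lipschitz_on_borel:
  fixes h :: "'b::metric_space \<Rightarrow> 'c::metric_space"
  assumes "C-lipschitz_on UNIV h"
  shows "h \<in> borel_measurable borel"
  using lipschitz_on_continuous_on[OF assms] by (rule borel_measurable_continuous_onI)

text \<open>The indicator of a nonempty closed set is a pointwise limit of the Lipschitz functions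
  \<open>max 0 (1 - n * infdist x A)\<close>, and the closed sets form an intersection-stable
  generator of the Borel sets.\<close>

lemma finite_measure_eqI_lipschitz:
  fixes M N :: "'b::metric_space measure"
  assumes M: "finite_measure M" "sets M = sets borel" and N: "finite_measure N" "sets N = sets borel"
    and eq: "\<And>(h :: 'b \<Rightarrow> real) C. (\<And>x. 0 \<le> h x \<and> h x \<le> 1) \<Longrightarrow> C-lipschitz_on UNIV h \<Longrightarrow> (\<integral>x. h x \<partial>M) = (\<integral>x. h x \<partial>N)"
  shows "M = N"
proof -
  interpret M: finite_measure M by fact
  interpret N: finite_measure N by fact
  note [measurable_cong] = M(2) N(2)
  have spM: "space M = UNIV" "space N = UNIV" using M(2) N(2) by (auto dest: sets_eq_imp_space_eq)
  have closed_eq: "emeasure M A = emeasure N A" if A: "closed A" for A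
  proof (cases "A = {}")
    case False
    define h where "h n x = max 0 (1 - real n * infdist x A)" for n x
    have h01: "0 \<le> h n x \<and> h n x \<le> 1" for n x by (auto simp: h_def infdist_nonneg)
    have lip: "(real n)-lipschitz_on UNIV (h n)" for n
    proof (rule lipschitz_onI)
      fix x y
      have "\<bar>infdist x A - infdist y A\<bar> \<le> dist x y"
        using infdist_triangle[of x A y] infdist_triangle[of y A x] by (simp add: dist_commute abs_le_iff)
      then have "real n * \<bar>infdist x A - infdist y A\<bar> \<le> real n * dist x y" by (rule mult_left_mono) simp
      moreover have "\<bar>h n x - h n y\<bar> \<le> \<bar>real n * infdist x A - real n * infdist y A\<bar>" by (simp add: h_def)
      ultimately show "dist (h n x) (h n y) \<le> real n * dist x y"
        by (simp add: dist_real_def right_diff_distrib[symmetric] abs_mult)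
    qed simp
    have hlim: "(\<lambda>n. h n x) \<longlonglongrightarrow> indicator A x" for x
    proof (cases "x \<in> A")
      case True
      then have "infdist x A = 0" by simp
      with True show ?thesis by (simp add: h_def)
    next
      case notin: False
      then have pos: "0 < infdist x A"
        using A False infdist_nonneg[of x A] in_closed_iff_infdist_zero[of A x] by fastforce
      obtain K where K: "1 < real K * infdist x A" using reals_Archimedean3[OF pos] by blast
      have "\<forall>n\<ge>K. h n x = 0"
      proof (intro allI impI)
        fix n assume "K \<le> n"
        then have "real K * infdist x A \<le> real n * infdist x A" using pos by (intro mult_right_mono) auto
        then show "h n x = 0" using K by (simp add: h_def)
      qed
      then have "eventually (\<lambda>n. h n x = 0) sequentially" by (auto simp: eventually_sequentially)
      then show ?thesis using notin by (simp add: tendsto_eventually)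
    qed
    have [measurable]: "h n \<in> borel_measurable borel" for n by (rule lipschitz_on_borel[OF lip])
    have [measurable]: "A \<in> sets borel" using A by simp
    have "(\<lambda>n. \<integral>x. h n x \<partial>M) \<longlonglongrightarrow> (\<integral>x. indicator A x \<partial>M)"
      by (rule integral_dominated_convergence[where w = "\<lambda>_. 1"]) (use hlim h01 in auto)
    moreover have "(\<lambda>n. \<integral>x. h n x \<partial>N) \<longlonglongrightarrow> (\<integral>x. indicator A x \<partial>N)"
      by (rule integral_dominated_convergence[where w = "\<lambda>_. 1"]) (use hlim h01 in auto)
    moreover have "(\<integral>x. h n x \<partial>M) = (\<integral>x. h n x \<partial>N)" for n by (rule eq[OF h01 lip])
    ultimately have "(\<integral>x. indicator A x \<partial>M) = (\<integral>x. indicator A x \<partial>N :: real)" by (simp add: LIMSEQ_unique)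
    then show ?thesis by (simp add: M.emeasure_eq_measure N.emeasure_eq_measure spM)
  qed simp
  show ?thesis
  proof (rule measure_eqI_generator_eq[where E = "Collect closed" and \<Omega> = UNIV and A = "\<lambda>_. UNIV"])
    show "Int_stable (Collect (closed :: 'b set \<Rightarrow> bool))" by (auto simp: Int_stable_def)
    show "sets M = sigma_sets UNIV (Collect closed)" "sets N = sigma_sets UNIV (Collect closed)"
      using M(2) N(2) by (simp_all add: borel_eq_closed)
    show "emeasure M X = emeasure N X" if "X \<in> Collect closed" for X using closed_eq that by simp
  qed auto
qed

text \<open>The claim is that the image under \<open>X\<close> of the signed measure with density
  \<open>W\<close> is zero. Splitting \<open>W\<close> into its positive and negative part gives two
  finite image measures, and Lipschitz tests show that they coincide.\<close>

lemma integral_zero_bounded_borel: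
  fixes X :: "'w \<Rightarrow> 'b::metric_space" and f :: "'b \<Rightarrow> real" and W :: "'w \<Rightarrow> real"
  assumes N: "finite_measure N" and X[measurable]: "X \<in> borel_measurable N" and W: "integrable N W"
    and zero: "\<And>(h :: 'b \<Rightarrow> real) C. (\<And>x. \<bar>h x\<bar> \<le> 1) \<Longrightarrow> C-lipschitz_on UNIV h \<Longrightarrow> (\<integral>w. h (X w) * W w \<partial>N) = 0"
    and f[measurable]: "f \<in> borel_measurable borel" and K: "\<And>x. \<bar>f x\<bar> \<le> K"
  shows "(\<integral>w. f (X w) * W w \<partial>N) = 0"
proof -
  interpret N: finite_measure N by fact
  have [measurable]: "W \<in> borel_measurable N" using W by simp
  \<comment> \<open>\<open>s = 1\<close> selects the positive part of \<open>W\<close>,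
    \<open>s = -1\<close> the negative part.\<close>
  define P where "P s = distr (density N (\<lambda>w. ennreal (max 0 (s * W w)))) borel X" for s :: real
  have intW: "integrable N (\<lambda>w. max 0 (s * W w))" for s using W by (intro integrable_max) auto
  have fin: "finite_measure (P s)" for s
  proof (rule finite_measureI)
    have "emeasure (P s) (space (P s)) = (\<integral>\<^sup>+w. ennreal (max 0 (s * W w)) \<partial>N)"
      unfolding P_def by (subst emeasure_distr) (auto simp: emeasure_density space_density intro!: nn_integral_cong)
    also have "\<dots> < \<infinity>" using intW[of s] by (simp add: integrable_iff_bounded)
    finally show "emeasure (P s) (space (P s)) \<noteq> \<infinity>" by simp
  qed
  have intP: "(\<integral>x. h x \<partial>P s) = (\<integral>w. max 0 (s * W w) * h (X w) \<partial>N)"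
    if [measurable]: "h \<in> borel_measurable borel" for h :: "'b \<Rightarrow> real" and s
    unfolding P_def by (subst integral_distr, simp, simp, subst integral_density) auto
  have inth: "integrable N (\<lambda>w. max 0 (s * W w) * h (X w))"
    if [measurable]: "h \<in> borel_measurable borel" and K: "\<And>x. \<bar>h x\<bar> \<le> K" for h :: "'b \<Rightarrow> real" and K s
  proof (rule Bochner_Integration.integrable_bound)
    show "integrable N (\<lambda>w. K * max 0 (s * W w))" using intW by simp
    show "AE w in N. norm (max 0 (s * W w) * h (X w)) \<le> norm (K * max 0 (s * W w))"
    proof (rule AE_I2)
      fix w
      have "\<bar>max 0 (s * W w) * h (X w)\<bar> = max 0 (s * W w) * \<bar>h (X w)\<bar>" by (simp add: abs_mult)
      also have "\<dots> \<le> max 0 (s * W w) * K" using K by (intro mult_left_mono) auto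
      finally show "norm (max 0 (s * W w) * h (X w)) \<le> norm (K * max 0 (s * W w))" by (simp add: mult.commute)
    qed
  qed simp
  have diff: "(\<integral>w. h (X w) * W w \<partial>N) = (\<integral>x. h x \<partial>P 1) - (\<integral>x. h x \<partial>P (-1))"
    if [measurable]: "h \<in> borel_measurable borel" and K: "\<And>x. \<bar>h x\<bar> \<le> K" for h :: "'b \<Rightarrow> real" and K
  proof -
    have "(\<integral>x. h x \<partial>P 1) - (\<integral>x. h x \<partial>P (-1)) = (\<integral>w. max 0 (1 * W w) * h (X w) - max 0 (-1 * W w) * h (X w) \<partial>N)"
      unfolding intP[OF that(1)] by (rule Bochner_Integration.integral_diff[symmetric]) (rule inth[OF that])+
    also have "\<dots> = (\<integral>w. h (X w) * W w \<partial>N)" by (intro Bochner_Integration.integral_cong) (auto simp: max_def)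
    finally show ?thesis by simp
  qed
  have "P 1 = P (-1)"
  proof (rule finite_measure_eqI_lipschitz[OF fin _ fin])
    fix h :: "'b \<Rightarrow> real" and C assume h: "\<And>x. 0 \<le> h x \<and> h x \<le> 1" and lip: "C-lipschitz_on UNIV h"
    have h1: "\<bar>h x\<bar> \<le> 1" for x using h[of x] by auto
    show "(\<integral>x. h x \<partial>P 1) = (\<integral>x. h x \<partial>P (-1))"
      using diff[OF lipschitz_on_borel[OF lip] h1] zero[OF h1 lip] by simp
  qed (simp_all add: P_def)
  then show ?thesis using diff[OF f K] by simp
qed

lemma norm_triple: "(norm (x, y, z))\<^sup>2 = (norm x)\<^sup>2 + (norm y)\<^sup>2 + (norm z)\<^sup>2"
  by (simp add: norm_Pair)

section \<open>Superhedging prices and the dual functional\<close>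

context P2_pair begin

text \<open>A superhedge of the claim \<open>c\<close>: static positions \<open>f\<close> and
  \<open>g\<close> in the marginals, martingale terms with arbitrary slopes, and a nonnegative
  amount \<open>t\<close> of the claim \<open>|z|^2\<close>.\<close>

definition majorizes where
  "majorizes f g \<Phi> \<Psi> t c \<longleftrightarrow> f \<in> borel_measurable borel \<and> f \<in> quad_funs \<and> g \<in> borel_measurable borel \<and> g \<in> quad_funs
     \<and> 0 \<le> t \<and> (\<forall>x y z. c (x, y, z) \<le> f x + g y + \<Phi> x \<bullet> (z - x) + \<Psi> y \<bullet> (z - y) + t * (norm z)\<^sup>2)"
  for f g :: "'a \<Rightarrow> real" and \<Phi> \<Psi> :: "'a \<Rightarrow> 'a"

text \<open>The martingale terms are free, which later forces their mean to vanish. Charging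
  \<open>V\<close> per unit of \<open>|z|^2\<close>, with \<open>t\<close> nonnegative, forces its
  mean to be at most \<open>V\<close>.\<close>

definition price where "price f g t = (\<integral>x. f x \<partial>\<mu>) + (\<integral>y. g y \<partial>\<nu>) + t * V"

definition superprice where
  "superprice c = Inf {price f g t | f g t. \<exists>\<Phi> \<Psi>. majorizes f g \<Phi> \<Psi> t c}"

lemma majorizes_add:
  assumes "majorizes f g \<Phi> \<Psi> t c" "majorizes f' g' \<Phi>' \<Psi>' t' c'"
  shows "majorizes (\<lambda>x. f x + f' x) (\<lambda>y. g y + g' y) (\<lambda>x. \<Phi> x + \<Phi>' x) (\<lambda>y. \<Psi> y + \<Psi>' y) (t + t') (\<lambda>w. c w + c' w)"
    "price (\<lambda>x. f x + f' x) (\<lambda>y. g y + g' y) (t + t') = price f g t + price f' g' t'"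
proof -
  show "majorizes (\<lambda>x. f x + f' x) (\<lambda>y. g y + g' y) (\<lambda>x. \<Phi> x + \<Phi>' x) (\<lambda>y. \<Psi> y + \<Psi>' y) (t + t') (\<lambda>w. c w + c' w)"
    unfolding majorizes_def
  proof (intro conjI allI)
    fix x y z
    have "c (x, y, z) + c' (x, y, z) \<le> (f x + g y + \<Phi> x \<bullet> (z - x) + \<Psi> y \<bullet> (z - y) + t * (norm z)\<^sup>2)
      + (f' x + g' y + \<Phi>' x \<bullet> (z - x) + \<Psi>' y \<bullet> (z - y) + t' * (norm z)\<^sup>2)"
      using assms unfolding majorizes_def by (intro add_mono) auto
    then show "c (x, y, z) + c' (x, y, z) \<le> f x + f' x + (g y + g' y) + (\<Phi> x + \<Phi>' x) \<bullet> (z - x)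
      + (\<Psi> y + \<Psi>' y) \<bullet> (z - y) + (t + t') * (norm z)\<^sup>2"
      by (simp add: inner_add_left distrib_right)
  qed (use assms in \<open>auto simp: majorizes_def intro: quad_funs_intros\<close>)
  have "integrable \<mu> f" "integrable \<mu> f'" "integrable \<nu> g" "integrable \<nu> g'"
    using assms by (auto simp: majorizes_def intro: P2_integrable[OF \<mu>] P2_integrable[OF \<nu>])
  then show "price (\<lambda>x. f x + f' x) (\<lambda>y. g y + g' y) (t + t') = price f g t + price f' g' t'"
    by (simp add: price_def distrib_right)
qed

lemma majorizes_scale:
  assumes "majorizes f g \<Phi> \<Psi> t c" and r: "0 \<le> r"
  shows "majorizes (\<lambda>x. r * f x) (\<lambda>y. r * g y) (\<lambda>x. r *\<^sub>R \<Phi> x) (\<lambda>y. r *\<^sub>R \<Psi> y) (r * t) (\<lambda>w. r * c w)"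
    "price (\<lambda>x. r * f x) (\<lambda>y. r * g y) (r * t) = r * price f g t"
proof -
  show "majorizes (\<lambda>x. r * f x) (\<lambda>y. r * g y) (\<lambda>x. r *\<^sub>R \<Phi> x) (\<lambda>y. r *\<^sub>R \<Psi> y) (r * t) (\<lambda>w. r * c w)"
    unfolding majorizes_def
  proof (intro conjI allI)
    fix x y z
    have "r * c (x, y, z) \<le> r * (f x + g y + \<Phi> x \<bullet> (z - x) + \<Psi> y \<bullet> (z - y) + t * (norm z)\<^sup>2)"
      using assms unfolding majorizes_def by (intro mult_left_mono) auto
    then show "r * c (x, y, z) \<le> r * f x + r * g y + (r *\<^sub>R \<Phi> x) \<bullet> (z - x) + (r *\<^sub>R \<Psi> y) \<bullet> (z - y) + (r * t) * (norm z)\<^sup>2"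
      by (simp add: distrib_left mult.assoc)
  qed (use assms in \<open>auto simp: majorizes_def intro: quad_funs_intros\<close>)
  show "price (\<lambda>x. r * f x) (\<lambda>y. r * g y) (r * t) = r * price f g t"
    by (simp add: price_def distrib_left mult.assoc)
qed

text \<open>Absence of arbitrage: the negated positions of a superhedge of a nonnegative claim form
  a dual candidate, so \<open>dual_bound\<close> applies. This is what keeps
  \<open>superprice\<close> bounded below.\<close>

lemma price_nonneg:
  assumes "majorizes f g \<Phi> \<Psi> t c" "\<And>w. 0 \<le> c w"
  shows "0 \<le> price f g t"
proof -
  have "(\<integral>x. - f x \<partial>\<mu>) + (\<integral>y. - g y \<partial>\<nu>) \<le> t * V"
  proof (rule dual_bound)
    show "integrable \<mu> (\<lambda>x. - f x)" "integrable \<nu> (\<lambda>x. - g x)" "0 \<le> t"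
      using assms by (auto simp: majorizes_def intro: P2_integrable[OF \<mu>] P2_integrable[OF \<nu>])
    fix x y z
    have "0 \<le> f x + g y + \<Phi> x \<bullet> (z - x) + \<Psi> y \<bullet> (z - y) + t * (norm z)\<^sup>2"
      using assms unfolding majorizes_def by (meson order_trans)
    then show "- f x + - g y + (- \<Phi> x) \<bullet> (z - x) + (- \<Psi> y) \<bullet> (z - y) \<le> t * (norm z)\<^sup>2"
      unfolding inner_minus_left by linarith
  qed
  then show ?thesis by (simp add: price_def)
qed

lemma ex_majorizes:
  assumes "c \<in> quad_funs"
  obtains f g \<Phi> \<Psi> t where "majorizes f g \<Phi> \<Psi> t c"
proof -
  obtain K where K: "\<And>w. \<bar>c w\<bar> \<le> K * (1 + (norm w)\<^sup>2)" using assms by (auto simp: quad_funs_def)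
  have "0 \<le> K" using K[of 0] by auto
  have "majorizes (\<lambda>x. K * (1 + (norm x)\<^sup>2)) (\<lambda>y. K * (norm y)\<^sup>2) (\<lambda>_. 0) (\<lambda>_. 0) K c"
    unfolding majorizes_def
  proof (intro conjI allI)
    fix x y z
    show "c (x, y, z) \<le> K * (1 + (norm x)\<^sup>2) + K * (norm y)\<^sup>2 + 0 \<bullet> (z - x) + 0 \<bullet> (z - y) + K * (norm z)\<^sup>2"
      using K[of "(x, y, z)"] unfolding norm_triple by (simp add: algebra_simps)
  qed (use \<open>0 \<le> K\<close> in \<open>auto intro!: quad_funs_intros\<close>)
  then show ?thesis by (rule that)
qed

lemma superprice_le:
  assumes "c \<in> quad_funs" "majorizes f g \<Phi> \<Psi> t c"
  shows "superprice c \<le> price f g t"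
  unfolding superprice_def
proof (rule cInf_lower)
  obtain f' g' \<Phi>' \<Psi>' t' where m: "majorizes f' g' \<Phi>' \<Psi>' t' (\<lambda>w. - c w)"
    using ex_majorizes[OF quad_funs_intros(8)[OF assms(1)]] .
  show "bdd_below {price f g t | f g t. \<exists>\<Phi> \<Psi>. majorizes f g \<Phi> \<Psi> t c}"
  proof (rule bdd_belowI[of _ "- price f' g' t'"])
    fix s assume "s \<in> {price f g t | f g t. \<exists>\<Phi> \<Psi>. majorizes f g \<Phi> \<Psi> t c}"
    then obtain f g t \<Phi> \<Psi> where s: "s = price f g t" "majorizes f g \<Phi> \<Psi> t c" by blast
    show "- price f' g' t' \<le> s"
      using price_nonneg[OF majorizes_add(1)[OF s(2) m]] majorizes_add(2)[OF s(2) m] s(1) by simp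
  qed
qed (use assms in blast)

lemma superprice_ge:
  assumes "c \<in> quad_funs" "\<And>f g \<Phi> \<Psi> t. majorizes f g \<Phi> \<Psi> t c \<Longrightarrow> r \<le> price f g t"
  shows "r \<le> superprice c"
  unfolding superprice_def
proof (rule cInf_greatest)
  obtain f g \<Phi> \<Psi> t where "majorizes f g \<Phi> \<Psi> t c" using ex_majorizes[OF assms(1)] .
  then show "{price f g t | f g t. \<exists>\<Phi> \<Psi>. majorizes f g \<Phi> \<Psi> t c} \<noteq> {}" by blast
qed (use assms in blast)

lemma sublinear_superprice: "sublinear_on quad_funs superprice"
  unfolding sublinear_on_def
proof (intro conjI ballI allI impI)
  fix a b :: "'a \<times> 'a \<times> 'a \<Rightarrow> real" assume a: "a \<in> quad_funs" and b: "b \<in> quad_funs"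
  have "superprice (\<lambda>x. a x + b x) - price f' g' t' \<le> superprice a" if "majorizes f' g' \<Phi>' \<Psi>' t' b" for f' g' \<Phi>' \<Psi>' t'
  proof (rule superprice_ge[OF a])
    fix f g \<Phi> \<Psi> t assume m: "majorizes f g \<Phi> \<Psi> t a"
    have "superprice (\<lambda>x. a x + b x) \<le> price (\<lambda>x. f x + f' x) (\<lambda>y. g y + g' y) (t + t')"
      by (rule superprice_le[OF quad_funs_intros(5)[OF a b] majorizes_add(1)[OF m that]])
    then show "superprice (\<lambda>x. a x + b x) - price f' g' t' \<le> price f g t"
      using majorizes_add(2)[OF m that] by simp
  qed
  then have "superprice (\<lambda>x. a x + b x) - superprice a \<le> superprice b"
    by (intro superprice_ge[OF b]) (simp add: algebra_simps)
  then show "superprice (\<lambda>x. a x + b x) \<le> superprice a + superprice b" by simp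
next
  fix a :: "'a \<times> 'a \<times> 'a \<Rightarrow> real" and r :: real assume a: "a \<in> quad_funs" and r: "0 \<le> r"
  have *: "superprice (\<lambda>x. r * a x) \<le> r * price f g t" if m: "majorizes f g \<Phi> \<Psi> t a" for f g \<Phi> \<Psi> t
    using superprice_le[OF quad_funs_intros(7)[OF a] majorizes_scale(1)[OF m r]] majorizes_scale(2)[OF m r] by simp
  show "superprice (\<lambda>x. r * a x) \<le> r * superprice a"
  proof (cases "r = 0")
    case True
    obtain f g \<Phi> \<Psi> t where "majorizes f g \<Phi> \<Psi> t a" using ex_majorizes[OF a] .
    from *[OF this] True show ?thesis by simp
  next
    case False
    have "superprice (\<lambda>x. r * a x) / r \<le> superprice a"
    proof (rule superprice_ge[OF a])
      fix f g \<Phi> \<Psi> t assume "majorizes f g \<Phi> \<Psi> t a"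
      from *[OF this] show "superprice (\<lambda>x. r * a x) / r \<le> price f g t" using r False by (simp add: field_simps)
    qed
    then show ?thesis using r False by (simp add: field_simps)
  qed
qed

text \<open>Every required property is read off from one superhedge. Claims replicated without the
  quadratic term get their exact price, positivity comes from the zero portfolio dominating
  \<open>- a\<close>, and the square in \<open>z\<close> is dominated by one unit of itself; as
  short positions in it are not allowed, only an inequality results for it.\<close>

lemma ex_quad_mean:
  obtains L :: "('a \<times> 'a \<times> 'a \<Rightarrow> real) \<Rightarrow> real" where "quad_mean L"
    "\<And>f. f \<in> borel_measurable borel \<Longrightarrow> f \<in> quad_funs \<Longrightarrow> L (\<lambda>(x, y, z). f x) = (\<integral>x. f x \<partial>\<mu>)"
    "\<And>g. g \<in> borel_measurable borel \<Longrightarrow> g \<in> quad_funs \<Longrightarrow> L (\<lambda>(x, y, z). g y) = (\<integral>y. g y \<partial>\<nu>)"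
    "\<And>\<Phi>. (\<lambda>(x, y::'a, z). \<Phi> x \<bullet> (z - x)) \<in> quad_funs \<Longrightarrow> L (\<lambda>(x, y, z). \<Phi> x \<bullet> (z - x)) = 0"
    "\<And>\<Psi>. (\<lambda>(x::'a, y, z). \<Psi> y \<bullet> (z - y)) \<in> quad_funs \<Longrightarrow> L (\<lambda>(x, y, z). \<Psi> y \<bullet> (z - y)) = 0"
    "L (\<lambda>(x, y, z). (norm z)\<^sup>2) \<le> V"
proof -
  obtain L where lin: "linear_on_space quad_funs L" and le: "\<And>a. a \<in> quad_funs \<Longrightarrow> L a \<le> superprice a"
    by (rule hahn_banach_sublinear[OF fun_space_quad_funs sublinear_superprice]) (rule that)
  have L_le: "L c \<le> price f g t" if "c \<in> quad_funs" "majorizes f g \<Phi> \<Psi> t c" for c f g \<Phi> \<Psi> t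
    using le[OF that(1)] superprice_le[OF that] by (rule order_trans)
  have L_neg: "L (\<lambda>w. - c w) = - L c" if "c \<in> quad_funs" for c
  proof -
    have "L (\<lambda>w. (-1) * c w) = (-1) * L c" using lin that unfolding linear_on_space_def by blast
    then show ?thesis by simp
  qed
  \<comment> \<open>With \<open>t = 0\<close> both \<open>c\<close> and \<open>- c\<close> are
    superhedged, at opposite prices.\<close>
  have L_eq: "L c = price f g 0"
    if c: "c \<in> quad_funs" and f: "f \<in> borel_measurable borel" "f \<in> quad_funs" and g: "g \<in> borel_measurable borel" "g \<in> quad_funs"
      and eq: "\<And>x y z. c (x, y, z) = f x + g y + \<Phi> x \<bullet> (z - x) + \<Psi> y \<bullet> (z - y)" for c f g \<Phi> \<Psi>
  proof -
    have "L c \<le> price f g 0"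
      by (rule L_le[of _ _ _ \<Phi> \<Psi>, OF c]) (use f g eq in \<open>auto simp: majorizes_def\<close>)
    moreover have "L (\<lambda>w. - c w) \<le> price (\<lambda>x. - f x) (\<lambda>x. - g x) 0"
      by (rule L_le[of _ _ _ "\<lambda>x. - \<Phi> x" "\<lambda>y. - \<Psi> y", OF quad_funs_intros(8)[OF c]])
        (use f g eq in \<open>auto simp: majorizes_def intro: quad_funs_intros\<close>)
    ultimately show ?thesis using L_neg[OF c] by (simp add: price_def)
  qed
  have q0: "(\<lambda>_. 0) \<in> (quad_funs :: ('a \<Rightarrow> real) set)" by (intro quad_funs_intros)
  have lift1: "(\<lambda>(x, y::'a, z::'a). f x) \<in> quad_funs" if f: "f \<in> quad_funs" for f :: "'a \<Rightarrow> real"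
  proof -
    obtain K where K: "\<And>x. \<bar>f x\<bar> \<le> K * (1 + (norm x)\<^sup>2)" using f by (auto simp: quad_funs_def)
    have "0 \<le> K" using K[of 0] by auto
    show ?thesis
    proof (rule quad_funsI[of _ K])
      fix w :: "'a \<times> 'a \<times> 'a"
      obtain x y z where w: "w = (x, y, z)" by (cases w)
      have "K * (1 + (norm x)\<^sup>2) \<le> K * (1 + (norm w)\<^sup>2)"
        unfolding w norm_triple using \<open>0 \<le> K\<close> by (intro mult_left_mono) auto
      then show "\<bar>(\<lambda>(x, y, z). f x) w\<bar> \<le> K * (1 + (norm w)\<^sup>2)" using K[of x] by (simp add: w)
    qed
  qed
  have lift2: "(\<lambda>(x::'a, y, z::'a). f y) \<in> quad_funs" if f: "f \<in> quad_funs" for f :: "'a \<Rightarrow> real"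
  proof -
    obtain K where K: "\<And>x. \<bar>f x\<bar> \<le> K * (1 + (norm x)\<^sup>2)" using f by (auto simp: quad_funs_def)
    have "0 \<le> K" using K[of 0] by auto
    show ?thesis
    proof (rule quad_funsI[of _ K])
      fix w :: "'a \<times> 'a \<times> 'a"
      obtain x y z where w: "w = (x, y, z)" by (cases w)
      have "K * (1 + (norm y)\<^sup>2) \<le> K * (1 + (norm w)\<^sup>2)"
        unfolding w norm_triple using \<open>0 \<le> K\<close> by (intro mult_left_mono) auto
      then show "\<bar>(\<lambda>(x, y, z). f y) w\<bar> \<le> K * (1 + (norm w)\<^sup>2)" using K[of y] by (simp add: w)
    qed
  qed
  have "quad_mean L"
  proof
    show "linear_on_space quad_funs L" by (rule lin)
    have "L (\<lambda>_. 1) = price (\<lambda>_. 1) (\<lambda>_. 0) 0"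
      by (rule L_eq[of _ _ _ "\<lambda>_. 0" "\<lambda>_. 0"]) (auto intro: quad_funs_intros)
    then show "L (\<lambda>_. 1) = 1" by (simp add: price_def M.prob_space)
    fix a :: "'a \<times> 'a \<times> 'a \<Rightarrow> real" assume a: "a \<in> quad_funs" "\<And>w. 0 \<le> a w"
    have "L (\<lambda>w. - a w) \<le> price (\<lambda>_. 0) (\<lambda>_. 0) 0"
      by (rule L_le[of _ _ _ "\<lambda>_. 0" "\<lambda>_. 0", OF quad_funs_intros(8)[OF a(1)]])
        (use a(2) q0 in \<open>auto simp: majorizes_def\<close>)
    then show "0 \<le> L a" using L_neg[OF a(1)] by (simp add: price_def)
  qed
  moreover have "L (\<lambda>(x, y, z). f x) = (\<integral>x. f x \<partial>\<mu>)" if "f \<in> borel_measurable borel" "f \<in> quad_funs" for f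
    by (subst L_eq[of _ f "\<lambda>_. 0" "\<lambda>_. 0" "\<lambda>_. 0", OF lift1[OF that(2)] that]) (auto simp: q0 price_def)
  moreover have "L (\<lambda>(x, y, z). g y) = (\<integral>y. g y \<partial>\<nu>)" if "g \<in> borel_measurable borel" "g \<in> quad_funs" for g
    by (subst L_eq[of _ "\<lambda>_. 0" g "\<lambda>_. 0" "\<lambda>_. 0", OF lift2[OF that(2)] _ _ that]) (auto simp: q0 price_def)
  moreover have "L (\<lambda>(x, y, z). \<Phi> x \<bullet> (z - x)) = 0" if "(\<lambda>(x, y::'a, z). \<Phi> x \<bullet> (z - x)) \<in> quad_funs" for \<Phi>
    by (subst L_eq[of _ "\<lambda>_. 0" "\<lambda>_. 0" \<Phi> "\<lambda>_. 0", OF that]) (auto simp: q0 price_def)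
  moreover have "L (\<lambda>(x, y, z). \<Psi> y \<bullet> (z - y)) = 0" if "(\<lambda>(x::'a, y, z). \<Psi> y \<bullet> (z - y)) \<in> quad_funs" for \<Psi>
    by (subst L_eq[of _ "\<lambda>_. 0" "\<lambda>_. 0" "\<lambda>_. 0" \<Psi>, OF that]) (auto simp: q0 price_def)
  moreover have "L (\<lambda>(x, y, z). (norm z)\<^sup>2) \<le> V"
  proof -
    have "(\<lambda>(x, y, z). (norm z)\<^sup>2) \<in> (quad_funs :: ('a \<times> 'a \<times> 'a \<Rightarrow> real) set)"
      by (rule quad_funsI[of _ 1]) (auto simp: norm_triple)
    then have "L (\<lambda>(x, y, z). (norm z)\<^sup>2) \<le> price (\<lambda>_. 0) (\<lambda>_. 0) 1"
      by (rule L_le[of _ _ _ "\<lambda>_. 0" "\<lambda>_. 0"]) (auto simp: majorizes_def q0)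
    then show ?thesis by (simp add: price_def)
  qed
  ultimately show ?thesis by (rule that)
qed

end

section \<open>From the finitely additive mean to a law of triples\<close>

lemma lipschitz_on_comp_nonexpansive:
  assumes "C-lipschitz_on UNIV h" "\<And>w w'. dist (X w) (X w') \<le> dist w w'"
  shows "C-lipschitz_on UNIV (\<lambda>w. h (X w))"
proof (rule lipschitz_onI)
  have C: "0 \<le> C" using assms(1) by (rule lipschitz_on_nonneg)
  then show "0 \<le> C" .
  fix w w'
  have "dist (h (X w)) (h (X w')) \<le> C * dist (X w) (X w')" by (rule lipschitz_onD[OF assms(1)]) auto
  also have "\<dots> \<le> C * dist w w'" using assms(2) C by (rule mult_left_mono)
  finally show "dist (h (X w)) (h (X w')) \<le> C * dist w w'" .
qed

lemma abs_diff_clamp_le: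
  fixes s :: real
  assumes "0 < n"
  shows "\<bar>s - max (- n) (min n s)\<bar> \<le> s\<^sup>2 / n"
proof (cases "\<bar>s\<bar> \<le> n")
  case True
  then have "max (- n) (min n s) = s" by auto
  then show ?thesis using assms by simp
next
  case False
  then have "\<bar>s - max (- n) (min n s)\<bar> \<le> \<bar>s\<bar>" using assms by (auto simp: max_def min_def abs_if)
  also have "\<dots> \<le> s\<^sup>2 / n"
  proof -
    have "\<bar>s\<bar> * n \<le> \<bar>s\<bar> * \<bar>s\<bar>" using False by (intro mult_left_mono) auto
    then show ?thesis using assms by (simp add: field_simps power2_eq_square)
  qed
  finally show ?thesis .
qed

lemma clamp_diff_le: "\<bar>max (- n) (min n s) - max (- n) (min n t)\<bar> \<le> \<bar>s - t :: real\<bar>"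
  by (auto simp: max_def min_def abs_if)

lemma abs_clamp_le: "0 \<le> n \<Longrightarrow> \<bar>max (- n) (min n s)\<bar> \<le> \<bar>s :: real\<bar>"
  by (auto simp: max_def min_def)

text \<open>The square of the truncated norm is bounded and Lipschitz, hence has equal integral and
  mean, and monotone convergence removes the truncation on the side of \<open>N\<close>. On the side
  of \<open>L\<close> there is no monotone convergence, so only an inequality is claimed.\<close>

lemma (in quad_mean) second_moment_le:
  fixes Z :: "'b \<Rightarrow> 'a::real_normed_vector"
  assumes N: "prob_space N" "sets N = sets borel"
    and rep: "\<And>h C K. (\<And>w. \<bar>h w\<bar> \<le> K) \<Longrightarrow> C-lipschitz_on UNIV h \<Longrightarrow> (\<integral>w. h w \<partial>N) = L h"
    and Z: "\<And>w w'. dist (Z w) (Z w') \<le> dist w w'" and ZV: "(\<lambda>w. (norm (Z w))\<^sup>2) \<in> quad_funs"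
  shows "(\<integral>\<^sup>+w. ennreal ((norm (Z w))\<^sup>2) \<partial>N) \<le> ennreal (L (\<lambda>w. (norm (Z w))\<^sup>2))"
proof -
  interpret N: prob_space N by (rule N)
  define h where "h n w = (min (norm (Z w)) (real n))\<^sup>2" for n w
  have lip: "(2 * real n)-lipschitz_on UNIV (h n)" for n
  proof (rule lipschitz_onI)
    fix w w'
    let ?a = "min (norm (Z w)) (real n)" and ?b = "min (norm (Z w')) (real n)"
    have "\<bar>?a - ?b\<bar> \<le> \<bar>norm (Z w) - norm (Z w')\<bar>" by (auto simp: min_def)
    also have "\<dots> \<le> dist w w'" using Z[of w w'] norm_triangle_ineq3[of "Z w" "Z w'"] by (simp add: dist_norm)
    finally have d: "\<bar>?a - ?b\<bar> \<le> dist w w'" .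
    have "dist (h n w) (h n w') = \<bar>?a + ?b\<bar> * \<bar>?a - ?b\<bar>"
      unfolding h_def dist_real_def abs_mult[symmetric] by (simp add: power2_eq_square algebra_simps)
    also have "\<dots> \<le> (2 * real n) * dist w w'" using d by (intro mult_mono) auto
    finally show "dist (h n w) (h n w') \<le> 2 * real n * dist w w'" .
  qed simp
  have hb: "\<bar>h n w\<bar> \<le> (real n)\<^sup>2" for n w unfolding h_def by (auto intro!: power_mono)
  have hm: "h n \<in> borel_measurable N" for n
    using lipschitz_on_borel[OF lip] N(2) by (simp cong: measurable_cong_sets)
  have hle: "h n w \<le> (norm (Z w))\<^sup>2" for n w unfolding h_def by (auto intro!: power_mono)
  have bound: "(\<integral>\<^sup>+w. ennreal (h n w) \<partial>N) \<le> ennreal (L (\<lambda>w. (norm (Z w))\<^sup>2))" for n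
  proof -
    have "integrable N (h n)" using hb hm by (intro N.integrable_const_bound[of _ "(real n)\<^sup>2"]) auto
    then have "(\<integral>\<^sup>+w. ennreal (h n w) \<partial>N) = ennreal (\<integral>w. h n w \<partial>N)"
      by (rule nn_integral_eq_integral) (simp add: h_def)
    also have "(\<integral>w. h n w \<partial>N) = L (h n)" by (rule rep[OF hb lip])
    also have "L (h n) \<le> L (\<lambda>w. (norm (Z w))\<^sup>2)"
      using hb hle by (intro L_mono ZV quad_funs_bounded)
    finally show ?thesis by (simp add: ennreal_leI)
  qed
  have "(\<lambda>n. \<integral>\<^sup>+w. ennreal (h n w) \<partial>N) \<longlonglongrightarrow> (\<integral>\<^sup>+w. ennreal ((norm (Z w))\<^sup>2) \<partial>N)"
  proof (rule nn_integral_LIMSEQ)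
    show "incseq (\<lambda>n w. ennreal (h n w))"
      by (auto simp: incseq_def le_fun_def h_def intro!: ennreal_leI power_mono)
    show "(\<lambda>w. ennreal (h n w)) \<in> borel_measurable N" for n using hm by simp
    show "(\<lambda>n. ennreal (h n w)) \<longlonglongrightarrow> ennreal ((norm (Z w))\<^sup>2)" for w
    proof (rule tendsto_eventually)
      obtain K :: nat where "norm (Z w) \<le> real K" using real_arch_simple by blast
      then show "eventually (\<lambda>n. ennreal (h n w) = ennreal ((norm (Z w))\<^sup>2)) sequentially"
        unfolding eventually_sequentially h_def
        by (intro exI[of _ K] allI impI) (auto simp: min_def dest: order_trans)
    qed
  qed
  then show ?thesis using bound by (intro LIMSEQ_le_const2) auto
qed

text \<open>Truncating \<open>Z\<close> costs at most \<open>|Z|\<^sup>2 / n\<close>, so the quadratic bound lets the martingale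
  constraint pass from the mean \<open>L\<close> to its representing measure although \<open>Z\<close> is unbounded.\<close>

lemma (in quad_mean) constrained_marginal:
  fixes X Z :: "'b \<Rightarrow> 'a::euclidean_space"
  assumes N: "prob_space N" "sets N = sets borel"
    and rep: "\<And>h C K. (\<And>w. \<bar>h w\<bar> \<le> K) \<Longrightarrow> C-lipschitz_on UNIV h \<Longrightarrow> (\<integral>w. h w \<partial>N) = L h"
    and X: "\<And>w w'. dist (X w) (X w') \<le> dist w w'" "\<And>w. norm (X w) \<le> norm w"
    and Z: "\<And>w w'. dist (Z w) (Z w') \<le> dist w w'" "\<And>w. norm (Z w) \<le> norm w"
    and Z2: "square_integrable N Z"
    and \<rho>: "\<rho> \<in> P2"
    and marg: "\<And>f. f \<in> borel_measurable borel \<Longrightarrow> f \<in> quad_funs \<Longrightarrow> L (\<lambda>w. f (X w)) = (\<integral>x. f x \<partial>\<rho>)"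
    and mart: "\<And>\<Phi>. (\<lambda>w. \<Phi> (X w) \<bullet> (Z w - X w)) \<in> quad_funs \<Longrightarrow> L (\<lambda>w. \<Phi> (X w) \<bullet> (Z w - X w)) = 0"
  shows "distr N borel X = \<rho>"
    and "f \<in> borel_measurable borel \<Longrightarrow> (\<And>x. \<bar>f x\<bar> \<le> K) \<Longrightarrow> (\<integral>w. f (X w) * ((Z w - X w) \<bullet> b) \<partial>N) = 0"
proof -
  interpret N: prob_space N by (rule N)
  note [measurable_cong] = N(2)
  have lipid: "1-lipschitz_on UNIV X" "1-lipschitz_on UNIV Z" using X Z by (auto intro!: lipschitz_onI)
  have Xm[measurable]: "X \<in> borel_measurable borel" and Zm[measurable]: "Z \<in> borel_measurable borel"
    using lipid[THEN lipschitz_on_borel] by auto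
  have XN: "X \<in> borel_measurable N" and ZN: "Z \<in> borel_measurable N" by measurable
  show dist: "distr N borel X = \<rho>"
  proof (rule finite_measure_eqI_lipschitz)
    show "finite_measure (distr N borel X)" by (rule N.finite_measure_distr[OF XN])
    show "finite_measure \<rho>" using P2_D(1)[OF \<rho>] by (rule prob_space.finite_measure)
    show "sets \<rho> = sets borel" by (rule P2_D(2)[OF \<rho>])
    fix h :: "'a \<Rightarrow> real" and C assume h: "\<And>x. 0 \<le> h x \<and> h x \<le> 1" and lip: "C-lipschitz_on UNIV h"
    have h1: "\<bar>h x\<bar> \<le> 1" for x using h[of x] by auto
    have [measurable]: "h \<in> borel_measurable borel" by (rule lipschitz_on_borel[OF lip])
    have "(\<integral>x. h x \<partial>distr N borel X) = (\<integral>w. h (X w) \<partial>N)" by (rule integral_distr) measurable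
    also have "\<dots> = L (\<lambda>w. h (X w))" by (rule rep[OF h1 lipschitz_on_comp_nonexpansive[OF lip X(1)]])
    also have "\<dots> = (\<integral>x. h x \<partial>\<rho>)" by (rule marg[OF _ quad_funs_bounded[OF h1]]) measurable
    finally show "(\<integral>x. h x \<partial>distr N borel X) = (\<integral>x. h x \<partial>\<rho>)" .
  qed simp
  have intX: "integrable N (\<lambda>w. X w \<bullet> b)"
  proof -
    have "integrable (distr N borel X) (\<lambda>x. x \<bullet> b)"
      unfolding dist using P2_integral_inner(1)[OF \<rho>, of b] by (simp add: inner_commute)
    then show ?thesis by (subst (asm) integrable_distr_eq[OF XN]) auto
  qed
  have intZn: "integrable N (\<lambda>w. norm (Z w))"
  proof (rule Bochner_Integration.integrable_bound)
    show "integrable N (\<lambda>w. 1 + (norm (Z w))\<^sup>2)" using Z2 by simp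
  qed (use norm_le_quad ZN in auto)
  have intZ: "integrable N (\<lambda>w. Z w \<bullet> b)"
  proof (rule Bochner_Integration.integrable_bound)
    show "integrable N (\<lambda>w. norm (Z w) * norm b)" using intZn by simp
  qed (use Cauchy_Schwarz_ineq2 ZN in auto)
  have zero: "(\<integral>w. h (X w) * ((Z w - X w) \<bullet> b) \<partial>N) = 0"
    if h1: "\<And>x. \<bar>h x\<bar> \<le> 1" and lip: "C-lipschitz_on UNIV h" for h :: "'a \<Rightarrow> real" and C
  proof -
    have hm[measurable]: "h \<in> borel_measurable borel" by (rule lipschitz_on_borel[OF lip])
    have C: "0 \<le> C" using lip by (rule lipschitz_on_nonneg)
    \<comment> \<open>Clamping \<open>Z \<bullet> b\<close> makes its product with a bounded
      Lipschitz function bounded and Lipschitz, so that \<open>rep\<close> applies; the level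
      \<open>Suc n\<close> is positive and can be divided by.\<close>
    define g where "g n w = h (X w) * max (- real (Suc n)) (min (real (Suc n)) (Z w \<bullet> b))" for n w
    have gm[measurable]: "g n \<in> borel_measurable borel" for n unfolding g_def by measurable
    have hbound: "\<bar>h x * s\<bar> \<le> \<bar>s\<bar>" for x s
      using mult_right_mono[OF h1[of x], of "\<bar>s\<bar>"] by (simp add: abs_mult)
    have gb: "\<bar>g n w\<bar> \<le> real (Suc n)" for n w
      unfolding g_def by (rule order_trans[OF hbound]) auto
    have gZ: "\<bar>g n w\<bar> \<le> norm (Z w) * norm b" for n w
      unfolding g_def by (rule order_trans[OF hbound], rule order_trans[OF abs_clamp_le Cauchy_Schwarz_ineq2]) simp
    have glip: "(norm b + C * real (Suc n))-lipschitz_on UNIV (g n)" for n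
    proof (rule lipschitz_onI)
      show "0 \<le> norm b + C * real (Suc n)" using C by simp
      fix w w'
      define t where "t w = max (- real (Suc n)) (min (real (Suc n)) (Z w \<bullet> b))" for w
      have "\<bar>t w - t w'\<bar> \<le> \<bar>(Z w - Z w') \<bullet> b\<bar>"
        unfolding t_def by (rule order_trans[OF clamp_diff_le]) (simp add: inner_diff_left)
      also have "\<dots> \<le> norm (Z w - Z w') * norm b" by (rule Cauchy_Schwarz_ineq2)
      also have "\<dots> \<le> dist w w' * norm b" using Z(1)[of w w'] by (intro mult_right_mono) (auto simp: dist_norm)
      finally have 1: "\<bar>h (X w) * (t w - t w')\<bar> \<le> dist w w' * norm b" by (rule order_trans[OF hbound])
      have "\<bar>h (X w) - h (X w')\<bar> \<le> C * dist w w'"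
        using lipschitz_onD[OF lipschitz_on_comp_nonexpansive[OF lip X(1)], of w w'] by (simp add: dist_real_def)
      then have 2: "\<bar>(h (X w) - h (X w')) * t w'\<bar> \<le> (C * dist w w') * real (Suc n)"
        unfolding abs_mult using C by (intro mult_mono) (auto simp: t_def)
      have "g n w - g n w' = h (X w) * (t w - t w') + (h (X w) - h (X w')) * t w'"
        unfolding g_def t_def[symmetric] by (simp add: algebra_simps)
      then have "\<bar>g n w - g n w'\<bar> \<le> dist w w' * norm b + (C * dist w w') * real (Suc n)" using 1 2 by linarith
      then show "dist (g n w) (g n w') \<le> (norm b + C * real (Suc n)) * dist w w'"
        by (simp add: dist_real_def algebra_simps)
    qed
    have qW: "(\<lambda>w. norm b * norm w) \<in> (quad_funs :: ('b \<Rightarrow> real) set)" by (intro quad_funs_intros)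
    have qN: "(\<lambda>w. (norm b)\<^sup>2 * (norm w)\<^sup>2) \<in> (quad_funs :: ('b \<Rightarrow> real) set)" by (intro quad_funs_intros)
    have hZle: "\<bar>h (X w) * (Z w \<bullet> b)\<bar> \<le> norm b * norm w" for w
    proof -
      have "\<bar>Z w \<bullet> b\<bar> \<le> norm (Z w) * norm b" by (rule Cauchy_Schwarz_ineq2)
      also have "\<dots> \<le> norm w * norm b" using Z(2) by (intro mult_right_mono) auto
      finally show ?thesis using hbound[of "X w" "Z w \<bullet> b"] by (simp add: mult.commute)
    qed
    have hXle: "\<bar>h (X w) * (X w \<bullet> b)\<bar> \<le> norm b * norm w" for w
    proof -
      have "\<bar>X w \<bullet> b\<bar> \<le> norm (X w) * norm b" by (rule Cauchy_Schwarz_ineq2)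
      also have "\<dots> \<le> norm w * norm b" using X(2) by (intro mult_right_mono) auto
      finally show ?thesis using hbound[of "X w" "X w \<bullet> b"] by (simp add: mult.commute)
    qed
    have qhZ: "(\<lambda>w. h (X w) * (Z w \<bullet> b)) \<in> quad_funs" by (rule quad_funs_dominated[OF qW hZle])
    have qhX: "(\<lambda>w. h (X w) * (X w \<bullet> b)) \<in> quad_funs" by (rule quad_funs_dominated[OF qW hXle])
    have qg: "g n \<in> quad_funs" for n by (rule quad_funs_bounded[OF gb])
    have "(\<lambda>n. \<integral>w. g n w \<partial>N) \<longlonglongrightarrow> (\<integral>w. h (X w) * (Z w \<bullet> b) \<partial>N)"
    proof (rule integral_dominated_convergence[where w = "\<lambda>w. norm (Z w) * norm b"])
      show "integrable N (\<lambda>w. norm (Z w) * norm b)" using intZn by simp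
      show "AE w in N. (\<lambda>n. g n w) \<longlonglongrightarrow> h (X w) * (Z w \<bullet> b)"
      proof (rule AE_I2, rule tendsto_eventually)
        fix w
        obtain K :: nat where K: "\<bar>Z w \<bullet> b\<bar> \<le> real K" using real_arch_simple by blast
        show "eventually (\<lambda>n. g n w = h (X w) * (Z w \<bullet> b)) sequentially"
          unfolding eventually_sequentially
        proof (intro exI[of _ K] allI impI)
          fix n assume "K \<le> n"
          then have "\<bar>Z w \<bullet> b\<bar> \<le> real (Suc n)" using K by simp
          then have "max (- real (Suc n)) (min (real (Suc n)) (Z w \<bullet> b)) = Z w \<bullet> b" by auto
          then show "g n w = h (X w) * (Z w \<bullet> b)" by (simp add: g_def)
        qed
      qed
      show "AE w in N. norm (g n w) \<le> norm (Z w) * norm b" for n using gZ by simp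
    qed measurable
    moreover have "(\<integral>w. g n w \<partial>N) = L (g n)" for n by (rule rep[OF gb glip])
    moreover have "(\<lambda>n. L (g n)) \<longlonglongrightarrow> L (\<lambda>w. h (X w) * (Z w \<bullet> b))"
    proof (rule LIM_zero_cancel, rule Lim_null_comparison)
      let ?B = "L (\<lambda>w. (norm b)\<^sup>2 * (norm w)\<^sup>2)"
      show "eventually (\<lambda>n. norm (L (g n) - L (\<lambda>w. h (X w) * (Z w \<bullet> b))) \<le> 1 / real (Suc n) * ?B) sequentially"
      proof (rule always_eventually, rule allI)
        fix n
        have "norm (L (g n) - L (\<lambda>w. h (X w) * (Z w \<bullet> b))) = \<bar>L (\<lambda>w. g n w - h (X w) * (Z w \<bullet> b))\<bar>"
          by (subst L_diff[OF qg qhZ]) simp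
        also have "\<dots> \<le> L (\<lambda>w. 1 / real (Suc n) * ((norm b)\<^sup>2 * (norm w)\<^sup>2))"
        proof (rule L_abs_le)
          fix w
          have "g n w - h (X w) * (Z w \<bullet> b) = - (h (X w) * (Z w \<bullet> b - max (- real (Suc n)) (min (real (Suc n)) (Z w \<bullet> b))))"
            by (simp add: g_def algebra_simps)
          then have "\<bar>g n w - h (X w) * (Z w \<bullet> b)\<bar> \<le> \<bar>Z w \<bullet> b - max (- real (Suc n)) (min (real (Suc n)) (Z w \<bullet> b))\<bar>"
            using hbound by (metis abs_minus_cancel)
          also have "\<dots> \<le> (Z w \<bullet> b)\<^sup>2 / real (Suc n)" by (rule abs_diff_clamp_le) simp
          also have "(Z w \<bullet> b)\<^sup>2 \<le> (norm b * norm w)\<^sup>2"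
          proof -
            have "\<bar>Z w \<bullet> b\<bar> \<le> norm (Z w) * norm b" by (rule Cauchy_Schwarz_ineq2)
            also have "\<dots> \<le> norm w * norm b" using Z(2) by (intro mult_right_mono) auto
            finally show ?thesis by (simp add: abs_le_square_iff[symmetric] abs_mult mult.commute)
          qed
          finally show "\<bar>g n w - h (X w) * (Z w \<bullet> b)\<bar> \<le> 1 / real (Suc n) * ((norm b)\<^sup>2 * (norm w)\<^sup>2)"
            by (simp add: divide_right_mono power_mult_distrib)
        qed (intro quad_funs_intros qg qhZ)+
        also have "\<dots> = 1 / real (Suc n) * ?B" by (rule L_cmult[OF qN])
        finally show "norm (L (g n) - L (\<lambda>w. h (X w) * (Z w \<bullet> b))) \<le> 1 / real (Suc n) * ?B" .
      qed
      show "(\<lambda>n. 1 / real (Suc n) * ?B) \<longlonglongrightarrow> 0"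
        by (intro tendsto_mult_left_zero LIMSEQ_Suc[OF lim_1_over_n])
    qed
    ultimately have EZ: "(\<integral>w. h (X w) * (Z w \<bullet> b) \<partial>N) = L (\<lambda>w. h (X w) * (Z w \<bullet> b))"
      by (simp add: LIMSEQ_unique)
    \<comment> \<open>The martingale hypothesis speaks only about \<open>Z - X\<close>; the
      remaining term in \<open>X\<close> is determined by the marginal, so both sides can be
      compared under \<open>N\<close>.\<close>
    have "(\<lambda>w. h (X w) * (Z w \<bullet> b)) = (\<lambda>w. h (X w) * (X w \<bullet> b) + (h (X w) *\<^sub>R b) \<bullet> (Z w - X w))"
      by (simp add: fun_eq_iff inner_diff_right inner_commute algebra_simps)
    moreover have qm: "(\<lambda>w. (h (X w) *\<^sub>R b) \<bullet> (Z w - X w)) \<in> quad_funs"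
      using quad_funs_intros(6)[OF qhZ qhX] by (simp add: inner_diff_right inner_commute algebra_simps)
    ultimately have "L (\<lambda>w. h (X w) * (Z w \<bullet> b)) = L (\<lambda>w. h (X w) * (X w \<bullet> b)) + L (\<lambda>w. (h (X w) *\<^sub>R b) \<bullet> (Z w - X w))"
      using L_add[OF qhX qm] by simp
    also have "L (\<lambda>w. (h (X w) *\<^sub>R b) \<bullet> (Z w - X w)) = 0" using qm by (rule mart)
    also have "L (\<lambda>w. h (X w) * (X w \<bullet> b)) = (\<integral>x. h x * (x \<bullet> b) \<partial>\<rho>)"
    proof (rule marg)
      have q: "(\<lambda>x::'a. norm b * norm x) \<in> quad_funs" by (intro quad_funs_intros)
      show "(\<lambda>x. h x * (x \<bullet> b)) \<in> quad_funs"
      proof (rule quad_funs_dominated[OF q])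
        show "\<bar>h x * (x \<bullet> b)\<bar> \<le> norm b * norm x" for x
          using order_trans[OF hbound Cauchy_Schwarz_ineq2[of x b]] by (simp add: mult.commute)
      qed
    qed measurable
    also have "\<dots> = (\<integral>w. h (X w) * (X w \<bullet> b) \<partial>N)" unfolding dist[symmetric] by (rule integral_distr) measurable
    finally have "(\<integral>w. h (X w) * (Z w \<bullet> b) \<partial>N) = (\<integral>w. h (X w) * (X w \<bullet> b) \<partial>N)" using EZ by simp
    moreover have "integrable N (\<lambda>w. h (X w) * (Z w \<bullet> b))"
      by (rule Bochner_Integration.integrable_bound[OF intZ]) (use hbound in auto)
    moreover have "integrable N (\<lambda>w. h (X w) * (X w \<bullet> b))"
      by (rule Bochner_Integration.integrable_bound[OF intX]) (use hbound in auto)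
    ultimately show ?thesis by (simp add: inner_diff_left right_diff_distrib)
  qed
  show "(\<integral>w. f (X w) * ((Z w - X w) \<bullet> b) \<partial>N) = 0" if "f \<in> borel_measurable borel" "\<And>x. \<bar>f x\<bar> \<le> K"
  proof (rule integral_zero_bounded_borel[OF _ XN _ zero that])
    show "integrable N (\<lambda>w. (Z w - X w) \<bullet> b)" using intX intZ by (simp add: inner_diff_left)
  qed (rule N.finite_measure_axioms)
qed

context P2_pair begin

lemma ex_triple_law:
  obtains N :: "('a \<times> 'a \<times> 'a) measure" where "prob_space N" "sets N = sets borel"
    "distr N borel fst = \<mu>" "distr N borel (\<lambda>w. fst (snd w)) = \<nu>"
    "square_integrable N (\<lambda>w. snd (snd w))" "second_moment N (\<lambda>w. snd (snd w)) \<le> V"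
    "\<And>f b. f \<in> borel_measurable borel \<Longrightarrow> bounded (range f) \<Longrightarrow>
      (\<integral>w. f (fst w) * ((snd (snd w) - fst w) \<bullet> b) \<partial>N) = 0"
    "\<And>f b. f \<in> borel_measurable borel \<Longrightarrow> bounded (range f) \<Longrightarrow>
      (\<integral>w. f (fst (snd w)) * ((snd (snd w) - fst (snd w)) \<bullet> b) \<partial>N) = 0"
proof -
  obtain L :: "('a \<times> 'a \<times> 'a \<Rightarrow> real) \<Rightarrow> real" where "quad_mean L"
    and L1: "\<And>f. f \<in> borel_measurable borel \<Longrightarrow> f \<in> quad_funs \<Longrightarrow> L (\<lambda>(x, y, z). f x) = (\<integral>x. f x \<partial>\<mu>)"
    and L2: "\<And>g. g \<in> borel_measurable borel \<Longrightarrow> g \<in> quad_funs \<Longrightarrow> L (\<lambda>(x, y, z). g y) = (\<integral>y. g y \<partial>\<nu>)"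
    and L3: "\<And>\<Phi>. (\<lambda>(x, y::'a, z). \<Phi> x \<bullet> (z - x)) \<in> quad_funs \<Longrightarrow> L (\<lambda>(x, y, z). \<Phi> x \<bullet> (z - x)) = 0"
    and L4: "\<And>\<Psi>. (\<lambda>(x::'a, y, z). \<Psi> y \<bullet> (z - y)) \<in> quad_funs \<Longrightarrow> L (\<lambda>(x, y, z). \<Psi> y \<bullet> (z - y)) = 0"
    and L5: "L (\<lambda>(x, y, z). (norm z)\<^sup>2) \<le> V"
    by (rule ex_quad_mean) (rule that)
  interpret quad_mean L by fact
  show ?thesis
  proof (rule representing_measure)
    fix N :: "('a \<times> 'a \<times> 'a) measure" assume N: "prob_space N" "sets N = sets borel"
      and rep: "\<And>h C K. (\<And>w. \<bar>h w\<bar> \<le> K) \<Longrightarrow> C-lipschitz_on UNIV h \<Longrightarrow> (\<integral>w. h w \<partial>N) = L h"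
    have dX: "dist (fst w) (fst w') \<le> dist w w'" "norm (fst w) \<le> norm w" for w w' :: "'a \<times> 'a \<times> 'a"
      by (auto simp: dist_fst_le norm_fst_le[of "fst w" "snd w", simplified])
    have dY: "dist (fst (snd w)) (fst (snd w')) \<le> dist w w'" "norm (fst (snd w)) \<le> norm w" for w w' :: "'a \<times> 'a \<times> 'a"
      using order_trans[OF dist_fst_le dist_snd_le] order_trans[OF norm_fst_le norm_snd_le] by (metis prod.collapse)+
    have dZ: "dist (snd (snd w)) (snd (snd w')) \<le> dist w w'" "norm (snd (snd w)) \<le> norm w" for w w' :: "'a \<times> 'a \<times> 'a"
      using order_trans[OF dist_snd_le dist_snd_le] order_trans[OF norm_snd_le norm_snd_le] by (metis prod.collapse)+
    have qZ: "(\<lambda>w::'a \<times> 'a \<times> 'a. (norm (snd (snd w)))\<^sup>2) \<in> quad_funs"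
      by (rule quad_funs_dominated[OF quad_funs_intros(2)]) (use dZ in \<open>auto intro!: power_mono\<close>)
    have L5': "L (\<lambda>w. (norm (snd (snd w)))\<^sup>2) \<le> V" using L5 by (simp add: case_prod_unfold)
    have le: "(\<integral>\<^sup>+w. ennreal ((norm (snd (snd w)))\<^sup>2) \<partial>N) \<le> ennreal (L (\<lambda>w. (norm (snd (snd w)))\<^sup>2))"
      by (rule second_moment_le[OF N rep dZ(1) qZ])
    have Zm: "(\<lambda>w. snd (snd w)) \<in> borel_measurable N"
      using N(2) by (simp cong: measurable_cong_sets) (intro borel_measurable_continuous_onI continuous_intros)
    have int: "square_integrable N (\<lambda>w. snd (snd w))"
      using le Zm by (intro integrableI_bounded) (auto intro: le_less_trans)
    have "ennreal (second_moment N (\<lambda>w. snd (snd w))) \<le> ennreal (L (\<lambda>w. (norm (snd (snd w)))\<^sup>2))"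
      using le nn_integral_eq_integral[OF int] by simp
    then have "second_moment N (\<lambda>w. snd (snd w)) \<le> L (\<lambda>w. (norm (snd (snd w)))\<^sup>2)"
      by (subst (asm) ennreal_le_iff) (auto intro!: pos qZ)
    with L5' have r0: "second_moment N (\<lambda>w. snd (snd w)) \<le> V" by simp
    have r1: "distr N borel fst = \<mu>"
      by (rule constrained_marginal(1)[where X = fst and Z = "\<lambda>w. snd (snd w)"])
        (fact N rep dX dZ int \<mu> L1[unfolded case_prod_unfold] L3[unfolded case_prod_unfold])+
    have r2: "distr N borel (\<lambda>w. fst (snd w)) = \<nu>"
      by (rule constrained_marginal(1)[where X = "\<lambda>w. fst (snd w)" and Z = "\<lambda>w. snd (snd w)"])
        (fact N rep dY dZ int \<nu> L2[unfolded case_prod_unfold] L4[unfolded case_prod_unfold])+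
    have r3: "(\<integral>w. f (fst w) * ((snd (snd w) - fst w) \<bullet> b) \<partial>N) = 0"
      if f: "f \<in> borel_measurable borel" "bounded (range f)" for f b
    proof -
      obtain K where K: "\<And>x. \<bar>f x\<bar> \<le> K" using f(2) by (auto simp: bounded_iff)
      show ?thesis
        by (rule constrained_marginal(2)[where X = fst and Z = "\<lambda>w. snd (snd w)"])
          (fact N rep dX dZ int \<mu> f K L1[unfolded case_prod_unfold] L3[unfolded case_prod_unfold])+
    qed
    have r4: "(\<integral>w. f (fst (snd w)) * ((snd (snd w) - fst (snd w)) \<bullet> b) \<partial>N) = 0"
      if f: "f \<in> borel_measurable borel" "bounded (range f)" for f b
    proof -
      obtain K where K: "\<And>x. \<bar>f x\<bar> \<le> K" using f(2) by (auto simp: bounded_iff)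
      show ?thesis
        by (rule constrained_marginal(2)[where X = "\<lambda>w. fst (snd w)" and Z = "\<lambda>w. snd (snd w)"])
          (fact N rep dY dZ int \<nu> f K L2[unfolded case_prod_unfold] L4[unfolded case_prod_unfold])+
    qed
    show thesis by (rule that[of N]) (fact N int r0 r1 r2 r3 r4)+
  qed
qed

text \<open>Replacing the third variable by its conditional expectation given the first two keeps the
  martingale constraints and does not increase the second moment.\<close>

lemma ex_GammaQ_costC_le:
  obtains \<gamma> \<zeta> where "(\<gamma>, \<zeta>) \<in> GammaQ \<mu> \<nu>" "costC \<gamma> \<zeta> \<le> ennreal V"
proof -
  obtain N :: "('a \<times> 'a \<times> 'a) measure" where N: "prob_space N" "sets N = sets borel"
    and m1: "distr N borel fst = \<mu>" and m2: "distr N borel (\<lambda>w. fst (snd w)) = \<nu>"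
    and sq: "square_integrable N (\<lambda>w. snd (snd w))" and le: "second_moment N (\<lambda>w. snd (snd w)) \<le> V"
    and z1: "\<And>f b. f \<in> borel_measurable borel \<Longrightarrow> bounded (range f) \<Longrightarrow>
      (\<integral>w. f (fst w) * ((snd (snd w) - fst w) \<bullet> b) \<partial>N) = 0"
    and z2: "\<And>f b. f \<in> borel_measurable borel \<Longrightarrow> bounded (range f) \<Longrightarrow>
      (\<integral>w. f (fst (snd w)) * ((snd (snd w) - fst (snd w)) \<bullet> b) \<partial>N) = 0"
    by (rule ex_triple_law) (rule that)
  interpret P: prob_space N by (rule N)
  note [measurable_cong] = N(2)
  have spN: "space N = UNIV" using N(2) by (auto dest: sets_eq_imp_space_eq)
  define T :: "'a \<times> 'a \<times> 'a \<Rightarrow> 'a \<times> 'a" where "T w = (fst w, fst (snd w))" for w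
  define X where "X w = fst w" for w :: "'a \<times> 'a \<times> 'a"
  define Y where "Y w = fst (snd w)" for w :: "'a \<times> 'a \<times> 'a"
  define Z where "Z w = snd (snd w)" for w :: "'a \<times> 'a \<times> 'a"
  have Xm[measurable]: "X \<in> borel_measurable borel" and Ym[measurable]: "Y \<in> borel_measurable borel"
    and Zm[measurable]: "Z \<in> borel_measurable borel" and Tm[measurable]: "T \<in> borel_measurable borel"
    unfolding X_def Y_def Z_def T_def by (intro borel_measurable_continuous_onI continuous_intros)+
  have fstm[measurable]: "(fst :: 'a \<times> 'a \<Rightarrow> 'a) \<in> borel_measurable borel"
    and sndm[measurable]: "(snd :: 'a \<times> 'a \<Rightarrow> 'a) \<in> borel_measurable borel"
    by (intro borel_measurable_continuous_onI continuous_intros)+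
  have XT: "X w = fst (T w)" and YT: "Y w = snd (T w)" for w by (auto simp: X_def Y_def T_def)
  have TN: "T \<in> measurable N borel" by measurable
  define F where "F = vimage_algebra UNIV T borel"
  have TF[measurable]: "T \<in> measurable F borel" unfolding F_def by (rule measurable_vimage_algebra1) auto
  have "subalgebra N F"
    unfolding subalgebra_def F_def using sets_image_in_sets[OF spN TN] by (simp add: spN)
  then interpret finite_measure_subalgebra N F
    by (auto simp: finite_measure_subalgebra_def finite_measure_subalgebra_axioms_def P.finite_measure_axioms)
  have XF[measurable]: "X \<in> measurable F borel" and YF[measurable]: "Y \<in> measurable F borel"
    unfolding XT YT by measurable
  have sq': "square_integrable N Z" using sq by (simp add: Z_def)
  have intZn: "integrable N (\<lambda>w. norm (Z w))"
  proof (rule Bochner_Integration.integrable_bound)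
    show "integrable N (\<lambda>w. 1 + (norm (Z w))\<^sup>2)" using sq' by simp
  qed (use norm_le_quad in auto)
  have intZ: "integrable N (\<lambda>w. Z w \<bullet> b)" for b
  proof (rule Bochner_Integration.integrable_bound)
    show "integrable N (\<lambda>w. norm (Z w) * norm b)" using intZn by simp
  qed (use Cauchy_Schwarz_ineq2 in auto)
  have intZ2: "integrable N (\<lambda>w. (Z w \<bullet> b)\<^sup>2)" if "b \<in> Basis" for b
  proof (rule Bochner_Integration.integrable_bound[OF sq'])
    show "AE w in N. norm ((Z w \<bullet> b)\<^sup>2) \<le> norm ((norm (Z w))\<^sup>2)"
      using Basis_le_norm[OF that] by (intro AE_I2) (simp add: abs_le_square_iff[symmetric])
  qed measurable
  have intXb: "integrable N (\<lambda>w. X w \<bullet> b)" for b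
  proof -
    have "integrable (distr N borel X) (\<lambda>x. x \<bullet> b)"
      using m1 P2_integral_inner(1)[OF \<mu>, of b] by (simp add: inner_commute X_def[abs_def])
    then show ?thesis by (subst (asm) integrable_distr_eq) auto
  qed
  have intYb: "integrable N (\<lambda>w. Y w \<bullet> b)" for b
  proof -
    have "integrable (distr N borel Y) (\<lambda>x. x \<bullet> b)"
      using m2 P2_integral_inner(1)[OF \<nu>, of b] by (simp add: inner_commute Y_def[abs_def])
    then show ?thesis by (subst (asm) integrable_distr_eq) auto
  qed
  define C where "C b = real_cond_exp N F (\<lambda>w. Z w \<bullet> b)" for b
  have CF[measurable]: "C b \<in> borel_measurable F" for b unfolding C_def by (rule borel_measurable_cond_exp)
  have CN: "integrable N (C b)" for b unfolding C_def by (rule real_cond_exp_int(1)[OF intZ])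
  \<comment> \<open>\<open>C b\<close> depends on the first two coordinates only, so inserting 0 as
    third coordinate factors it through \<open>T\<close> and yields a Borel function on
    pairs.\<close>
  define c where "c b p = C b (fst p, snd p, 0)" for b and p :: "'a \<times> 'a"
  have cm[measurable]: "c b \<in> borel_measurable borel" for b
  proof -
    have "(\<lambda>p :: 'a \<times> 'a. (fst p, snd p, 0 :: 'a)) \<in> measurable borel F"
      unfolding F_def by (rule measurable_vimage_algebra2) (auto simp: T_def)
    then show ?thesis unfolding c_def using CF by (rule measurable_compose)
  qed
  \<comment> \<open>A level set of \<open>C b\<close> belongs to the sigma-algebra generated by
    \<open>T\<close>, so it is a preimage under \<open>T\<close>; it cannot separate two triples
    with equal first two coordinates.\<close>
  have cT: "c b (T w) = C b w" for b w
  proof -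
    have "C b -` {C b w} \<inter> space F \<in> sets F" by (rule measurable_sets[OF CF]) simp
    then obtain A where A: "C b -` {C b w} = T -` A" unfolding F_def by (subst (asm) sets_vimage_algebra2) auto
    have "w \<in> T -` A" using A by auto
    then have "(fst w, fst (snd w), 0) \<in> T -` A" by (simp add: T_def)
    then have "C b (fst w, fst (snd w), 0) = C b w" using A by auto
    then show ?thesis by (simp add: c_def T_def)
  qed
  define \<zeta> where "\<zeta> p = (\<Sum>b\<in>Basis. c b p *\<^sub>R b)" for p :: "'a \<times> 'a"
  have \<zeta>m[measurable]: "\<zeta> \<in> borel_measurable borel" unfolding \<zeta>_def by measurable
  define \<gamma> where "\<gamma> = distr N borel T"
  have coup: "coupling \<mu> \<nu> \<gamma>"
    unfolding coupling_def
  proof (intro conjI)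
    show "prob_space \<gamma>" unfolding \<gamma>_def by (rule P.prob_space_distr[OF TN])
    show "sets \<gamma> = sets borel" by (simp add: \<gamma>_def)
    show "distr \<gamma> borel fst = \<mu>"
      unfolding \<gamma>_def using m1 by (subst distr_distr[OF fstm TN]) (simp add: comp_def T_def)
    show "distr \<gamma> borel snd = \<nu>"
      unfolding \<gamma>_def using m2 by (subst distr_distr[OF sndm TN]) (simp add: comp_def T_def)
  qed
  have \<zeta>T: "\<zeta> (T w) = (\<Sum>b\<in>Basis. C b w *\<^sub>R b)" for w by (simp add: \<zeta>_def cT)
  have int\<zeta>: "integrable \<gamma> \<zeta>"
    unfolding \<gamma>_def by (subst integrable_distr_eq[OF TN \<zeta>m]) (use CN in \<open>simp add: \<zeta>T\<close>)
  \<comment> \<open>Stated for a general map \<open>S\<close> of the pair, since \<open>fst\<close>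
    and \<open>snd\<close> need the same computation. Tests depending on \<open>S (T w)\<close> are
    measurable for \<open>F\<close>, so \<open>C b\<close> may be exchanged for
    \<open>Z w \<bullet> b\<close> under the integral.\<close>
  have cond: "(\<integral>z. \<Phi> (S z) \<bullet> \<zeta> z \<partial>\<gamma>) = (\<integral>x. \<Phi> x \<bullet> x \<partial>\<rho>)"
    if \<Phi>[measurable]: "\<Phi> \<in> borel_measurable borel" and bdd: "bounded (range \<Phi>)"
      and S[measurable]: "S \<in> borel_measurable borel" and \<rho>: "distr N borel (\<lambda>w. S (T w)) = \<rho>"
      and intS: "\<And>b. integrable N (\<lambda>w. S (T w) \<bullet> b)"
      and zero: "\<And>f b. f \<in> borel_measurable borel \<Longrightarrow> bounded (range f) \<Longrightarrow>
        (\<integral>w. f (S (T w)) * ((Z w - S (T w)) \<bullet> b) \<partial>N) = 0"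
    for \<Phi> :: "'a \<Rightarrow> 'a" and S \<rho>
  proof -
    obtain K where K: "\<And>x. norm (\<Phi> x) \<le> K" using bdd by (auto simp: bounded_iff)
    have Kb: "\<bar>\<Phi> x \<bullet> b\<bar> \<le> K" if "b \<in> Basis" for x b using Basis_le_norm[OF that, of "\<Phi> x"] K[of x] by linarith
    have intm: "integrable N (\<lambda>w. (\<Phi> (S (T w)) \<bullet> b) * g w)" if b: "b \<in> Basis" and g: "integrable N g" for b g
    proof (rule Bochner_Integration.integrable_bound)
      show "integrable N (\<lambda>w. K * g w)" using g by simp
      show "AE w in N. norm ((\<Phi> (S (T w)) \<bullet> b) * g w) \<le> norm (K * g w)"
      proof (rule AE_I2)
        fix w
        have "\<bar>\<Phi> (S (T w)) \<bullet> b\<bar> * \<bar>g w\<bar> \<le> \<bar>K\<bar> * \<bar>g w\<bar>"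
          using Kb[OF b, of "S (T w)"] by (intro mult_right_mono) auto
        then show "norm ((\<Phi> (S (T w)) \<bullet> b) * g w) \<le> norm (K * g w)" by (simp add: abs_mult)
      qed
    qed (use g in measurable)
    have "(\<integral>z. \<Phi> (S z) \<bullet> \<zeta> z \<partial>\<gamma>) = (\<integral>w. \<Phi> (S (T w)) \<bullet> \<zeta> (T w) \<partial>N)"
      unfolding \<gamma>_def by (rule integral_distr) measurable
    also have "\<dots> = (\<integral>w. (\<Sum>b\<in>Basis. (\<Phi> (S (T w)) \<bullet> b) * C b w) \<partial>N)"
      by (simp add: \<zeta>T inner_sum_right mult.commute)
    also have "\<dots> = (\<Sum>b\<in>Basis. \<integral>w. (\<Phi> (S (T w)) \<bullet> b) * C b w \<partial>N)"
      by (rule Bochner_Integration.integral_sum) (rule intm[OF _ CN])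
    also have "\<dots> = (\<Sum>b\<in>Basis. \<integral>w. (\<Phi> (S (T w)) \<bullet> b) * (S (T w) \<bullet> b) \<partial>N)"
    proof (rule sum.cong[OF refl])
      fix b :: 'a assume b: "b \<in> Basis"
      have bb: "bounded (range (\<lambda>x. \<Phi> x \<bullet> b))" using Kb[OF b] by (auto intro: boundedI[of _ K])
      have "(\<integral>w. (\<Phi> (S (T w)) \<bullet> b) * C b w \<partial>N) = (\<integral>w. (\<Phi> (S (T w)) \<bullet> b) * (Z w \<bullet> b) \<partial>N)"
        unfolding C_def by (rule real_cond_exp_intg(2)[OF intm[OF b intZ]]) measurable
      also have "\<dots> = (\<integral>w. (\<Phi> (S (T w)) \<bullet> b) * (S (T w) \<bullet> b) \<partial>N)"
        using zero[of "\<lambda>x. \<Phi> x \<bullet> b" b] bb intm[OF b intZ[of b]] intm[OF b intS[of b]]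
        by (simp add: inner_diff_left right_diff_distrib)
      finally show "(\<integral>w. (\<Phi> (S (T w)) \<bullet> b) * C b w \<partial>N) = (\<integral>w. (\<Phi> (S (T w)) \<bullet> b) * (S (T w) \<bullet> b) \<partial>N)" .
    qed
    also have "\<dots> = (\<integral>w. (\<Sum>b\<in>Basis. (\<Phi> (S (T w)) \<bullet> b) * (S (T w) \<bullet> b)) \<partial>N)"
      by (rule Bochner_Integration.integral_sum[symmetric]) (rule intm[OF _ intS])
    also have "\<dots> = (\<integral>w. \<Phi> (S (T w)) \<bullet> S (T w) \<partial>N)" by (simp add: euclidean_inner[symmetric])
    also have "\<dots> = (\<integral>x. \<Phi> x \<bullet> x \<partial>\<rho>)" unfolding \<rho>[symmetric] by (rule integral_distr[symmetric]) measurable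
    finally show ?thesis .
  qed
  have "(\<gamma>, \<zeta>) \<in> GammaQ \<mu> \<nu>"
    unfolding GammaQ_def
  proof (intro CollectI case_prodI conjI allI impI; (elim conjE)?)
    show "coupling \<mu> \<nu> \<gamma>" by (rule coup)
    show "\<zeta> \<in> borel_measurable \<gamma>" unfolding \<gamma>_def by simp
    show "integrable \<gamma> \<zeta>" by (rule int\<zeta>)
    fix \<Phi> :: "'a \<Rightarrow> 'a" assume \<Phi>: "\<Phi> \<in> borel_measurable borel" "bounded (range \<Phi>)"
    show "(\<integral>z. \<Phi> (fst z) \<bullet> \<zeta> z \<partial>\<gamma>) = (\<integral>x. \<Phi> x \<bullet> x \<partial>\<mu>)"
      by (rule cond[OF \<Phi> fstm]) (use m1 intXb z1 in \<open>auto simp: T_def X_def Z_def\<close>)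
    show "(\<integral>z. \<Phi> (snd z) \<bullet> \<zeta> z \<partial>\<gamma>) = (\<integral>x. \<Phi> x \<bullet> x \<partial>\<nu>)"
      by (rule cond[OF \<Phi> sndm]) (use m2 intYb z2 in \<open>auto simp: T_def Y_def Z_def\<close>)
  qed
  moreover have "costC \<gamma> \<zeta> \<le> ennreal V"
  proof -
    \<comment> \<open>Conditional Jensen is applied to each coordinate; squares of coordinates sum
      to the squared norm.\<close>
    have jensen: "integrable N (\<lambda>w. (C b w)\<^sup>2)" "(\<integral>w. (C b w)\<^sup>2 \<partial>N) \<le> (\<integral>w. (Z w \<bullet> b)\<^sup>2 \<partial>N)" if b: "b \<in> Basis" for b
    proof -
      have cvx: "convex_on UNIV (\<lambda>x::real. x\<^sup>2)" by (rule convex_power2)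
      have AEle: "AE w in N. (C b w)\<^sup>2 \<le> real_cond_exp N F (\<lambda>w. (Z w \<bullet> b)\<^sup>2) w"
        unfolding C_def by (rule real_cond_exp_jensens_inequality(2)[where I = UNIV, OF intZ _ _ intZ2[OF b] cvx]) auto
      have ci: "integrable N (real_cond_exp N F (\<lambda>w. (Z w \<bullet> b)\<^sup>2))" by (rule real_cond_exp_int(1)[OF intZ2[OF b]])
      show 1: "integrable N (\<lambda>w. (C b w)\<^sup>2)"
        by (rule Bochner_Integration.integrable_bound[OF ci]) (use AEle CN in auto)
      have "(\<integral>w. (C b w)\<^sup>2 \<partial>N) \<le> (\<integral>w. real_cond_exp N F (\<lambda>w. (Z w \<bullet> b)\<^sup>2) w \<partial>N)"
        by (rule integral_mono_AE[OF 1 ci AEle])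
      then show "(\<integral>w. (C b w)\<^sup>2 \<partial>N) \<le> (\<integral>w. (Z w \<bullet> b)\<^sup>2 \<partial>N)" by (simp add: real_cond_exp_int(2)[OF intZ2[OF b]])
    qed
    have normsq: "(norm x)\<^sup>2 = (\<Sum>b\<in>Basis. (x \<bullet> b)\<^sup>2)" for x :: 'a
      unfolding power2_norm_eq_inner by (subst euclidean_inner) (simp add: power2_eq_square)
    have nz: "(norm (\<zeta> (T w)))\<^sup>2 = (\<Sum>b\<in>Basis. (C b w)\<^sup>2)" for w
      by (subst normsq) (simp add: \<zeta>T inner_sum_left inner_Basis if_distrib sum.delta cong: if_cong)
    have "costC \<gamma> \<zeta> = (\<integral>\<^sup>+w. ennreal ((norm (\<zeta> (T w)))\<^sup>2) \<partial>N)"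
      unfolding costC_def \<gamma>_def by (rule nn_integral_distr[OF TN]) simp
    also have "\<dots> = ennreal (\<integral>w. (\<Sum>b\<in>Basis. (C b w)\<^sup>2) \<partial>N)"
      unfolding nz using jensen(1) by (intro nn_integral_eq_integral) (auto intro!: sum_nonneg)
    also have "(\<integral>w. (\<Sum>b\<in>Basis. (C b w)\<^sup>2) \<partial>N) = (\<Sum>b\<in>Basis. \<integral>w. (C b w)\<^sup>2 \<partial>N)"
      by (rule Bochner_Integration.integral_sum) (rule jensen(1))
    also have "\<dots> \<le> (\<Sum>b\<in>Basis. \<integral>w. (Z w \<bullet> b)\<^sup>2 \<partial>N)" by (rule sum_mono) (rule jensen(2))
    also have "\<dots> = (\<integral>w. (\<Sum>b\<in>Basis. (Z w \<bullet> b)\<^sup>2) \<partial>N)"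
      by (rule Bochner_Integration.integral_sum[symmetric]) (rule intZ2)
    also have "\<dots> = second_moment N Z" by (simp add: normsq)
    also have "\<dots> \<le> V" using le by (simp add: Z_def)
    finally show ?thesis by (simp add: ennreal_leI)
  qed
  ultimately show ?thesis by (rule that)
qed

end

subsection \<open>Convex order\<close>

lemma ext_integral_integrable:
  assumes "integrable M f"
  shows "ext_integral M f = ereal (\<integral>x. f x \<partial>M)"
proof -
  have pos: "(\<integral>\<^sup>+x. ennreal (g x) \<partial>M) = ennreal (\<integral>x. max 0 (g x) \<partial>M)" if "integrable M g" for g
  proof -
    have "(\<integral>\<^sup>+x. ennreal (g x) \<partial>M) = (\<integral>\<^sup>+x. ennreal (max 0 (g x)) \<partial>M)"
      by (intro nn_integral_cong) (simp add: max_def ennreal_neg)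
    also have "\<dots> = ennreal (\<integral>x. max 0 (g x) \<partial>M)"
      using that by (intro nn_integral_eq_integral integrable_max) auto
    finally show ?thesis .
  qed
  have "ext_integral M f = ereal (\<integral>x. max 0 (f x) \<partial>M) - ereal (\<integral>x. max 0 (- f x) \<partial>M)"
    unfolding ext_integral_def using assms by (simp add: pos)
  also have "\<dots> = ereal ((\<integral>x. max 0 (f x) \<partial>M) - (\<integral>x. max 0 (- f x) \<partial>M))" by simp
  also have "(\<integral>x. max 0 (f x) \<partial>M) - (\<integral>x. max 0 (- f x) \<partial>M) = (\<integral>x. max 0 (f x) - max 0 (- f x) \<partial>M)"
    using assms by (intro Bochner_Integration.integral_diff[symmetric] integrable_max) auto
  also have "\<dots> = (\<integral>x. f x \<partial>M)" by (intro Bochner_Integration.integral_cong) (auto simp: max_def)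
  finally show ?thesis .
qed

text \<open>Splitting off an integrable minorant leaves a nonnegative remainder, so the extended
  integral is never a difference of infinities and comparisons reduce to monotone limits of
  nonnegative integrals.\<close>

lemma ext_integral_minorant:
  assumes f[measurable]: "f \<in> borel_measurable M" and a: "integrable M a" and le: "\<And>x. a x \<le> f x"
  shows "ext_integral M f = ereal (\<integral>x. a x \<partial>M) + enn2ereal (\<integral>\<^sup>+x. ennreal (f x - a x) \<partial>M)"
proof (cases "(\<integral>\<^sup>+x. ennreal (f x - a x) \<partial>M) = \<infinity>")
  case False
  have [measurable]: "a \<in> borel_measurable M" using a by simp
  have d: "integrable M (\<lambda>x. f x - a x)" using False le by (intro integrableI_nonneg) (auto simp: less_top)
  from Bochner_Integration.integrable_add[OF d a] have i: "integrable M f" by simp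
  have "(\<integral>\<^sup>+x. ennreal (f x - a x) \<partial>M) = ennreal (\<integral>x. f x - a x \<partial>M)"
    using le by (intro nn_integral_eq_integral d) auto
  moreover have "0 \<le> (\<integral>x. f x - a x \<partial>M)" using le by (intro integral_nonneg_AE) auto
  ultimately show ?thesis using i a by (simp add: ext_integral_integrable)
next
  case True
  have [measurable]: "a \<in> borel_measurable M" using a by simp
  have fin: "(\<integral>\<^sup>+x. ennreal (\<bar>a x\<bar>) \<partial>M) < \<infinity>" using a by (simp add: integrable_iff_bounded)
  have neg: "(\<integral>\<^sup>+x. ennreal (- f x) \<partial>M) < \<infinity>"
  proof (rule le_less_trans[OF _ fin], rule nn_integral_mono, rule ennreal_leI)
    show "- f x \<le> \<bar>a x\<bar>" for x using le[of x] by linarith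
  qed
  have "\<infinity> = (\<integral>\<^sup>+x. ennreal (f x - a x) \<partial>M)" using True by simp
  also have "\<dots> \<le> (\<integral>\<^sup>+x. ennreal (f x) + ennreal (\<bar>a x\<bar>) \<partial>M)"
  proof (rule nn_integral_mono)
    fix x
    have "ennreal (f x - a x) \<le> ennreal (max 0 (f x) + \<bar>a x\<bar>)" by (intro ennreal_leI) auto
    also have "\<dots> = ennreal (f x) + ennreal (\<bar>a x\<bar>)" by (subst ennreal_plus) (auto simp: max_def ennreal_neg)
    finally show "ennreal (f x - a x) \<le> ennreal (f x) + ennreal (\<bar>a x\<bar>)" .
  qed
  also have "\<dots> = (\<integral>\<^sup>+x. ennreal (f x) \<partial>M) + (\<integral>\<^sup>+x. ennreal (\<bar>a x\<bar>) \<partial>M)" by (rule nn_integral_add) auto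
  finally have "(\<integral>\<^sup>+x. ennreal (f x) \<partial>M) = \<infinity>" using fin by (auto simp: top_unique)
  moreover obtain r where "(\<integral>\<^sup>+x. ennreal (- f x) \<partial>M) = ennreal r" "0 \<le> r"
    using neg by (cases "(\<integral>\<^sup>+x. ennreal (- f x) \<partial>M)") auto
  ultimately show ?thesis using True by (simp add: ext_integral_def)
qed

text \<open>Supporting affine functions at the points of a countable dense set suffice: near
  \<open>x\<close> the subgradients are bounded, so support at a nearby point loses little at
  \<open>x\<close>. Countability is what allows a monotone limit over finite maxima.\<close>

lemma convex_eq_countable_sup_affine:
  fixes \<phi> :: "'a::euclidean_space \<Rightarrow> real"
  assumes \<phi>: "convex_on UNIV \<phi>"
  obtains c :: "nat \<Rightarrow> real" and p :: "nat \<Rightarrow> 'a"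
  where "\<And>k x. c k + p k \<bullet> x \<le> \<phi> x" "\<And>x. \<forall>e>0. \<exists>k. \<phi> x - e < c k + p k \<bullet> x"
proof -
  obtain D :: "'a set" where D: "countable D" "\<And>X. open X \<Longrightarrow> X \<noteq> {} \<Longrightarrow> \<exists>d\<in>D. d \<in> X"
    using countable_dense_exists by blast
  have "D \<noteq> {}" using D(2)[of UNIV] by auto
  define d where "d = from_nat_into D"
  have rd: "range d = D" unfolding d_def using D(1) \<open>D \<noteq> {}\<close> by (rule range_from_nat_into[rotated])
  have "\<exists>q. \<forall>w. \<phi> z + q \<bullet> (w - z) \<le> \<phi> w" for z using convex_subgradient_exists[OF \<phi>, of z] by blast
  then obtain s where s: "\<And>z w. \<phi> z + s z \<bullet> (w - z) \<le> \<phi> w" by metis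
  define p where "p k = s (d k)" for k
  define c where "c k = \<phi> (d k) - p k \<bullet> d k" for k
  have cp: "c k + p k \<bullet> x = \<phi> (d k) + p k \<bullet> (x - d k)" for k x by (simp add: c_def inner_diff_right)
  show ?thesis
  proof (rule that)
    show "c k + p k \<bullet> x \<le> \<phi> x" for k x unfolding cp unfolding p_def by (rule s)
    fix x
    show "\<forall>e>0. \<exists>k. \<phi> x - e < c k + p k \<bullet> x"
    proof (intro allI impI)
      fix e :: real assume e: "0 < e"
      have cont: "continuous_on UNIV \<phi>" by (rule convex_on_continuous[OF open_UNIV \<phi>])
      have "bounded (\<phi> ` cball x 2)"
        by (intro compact_imp_bounded compact_continuous_image continuous_on_subset[OF cont]) auto
      then obtain B where B: "0 < B" "\<And>y. y \<in> cball x 2 \<Longrightarrow> \<bar>\<phi> y\<bar> \<le> B" unfolding bounded_pos by auto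
      \<comment> \<open>A unit step along the subgradient stays in the ball of radius 2 around
        \<open>x\<close>, where \<open>\<phi>\<close> varies by at most \<open>2 * B\<close>; the
        subgradient inequality turns this into a bound on its norm.\<close>
      have sb: "norm (s y) \<le> 2 * B" if y: "dist x y < 1" for y
      proof (cases "s y = 0")
        case False
        define v where "v = (1 / norm (s y)) *\<^sub>R s y"
        have nv: "norm v = 1" using False by (simp add: v_def)
        have "dist x (y + v) \<le> dist x y + norm v" by (metis dist_norm dist_triangle add_diff_cancel_left' dist_commute)
        then have "\<phi> (y + v) \<le> B" using B(2)[of "y + v"] y nv by auto
        moreover have "- B \<le> \<phi> y" using B(2)[of y] y by auto
        moreover have "s y \<bullet> v = norm (s y)" using False by (simp add: v_def power2_norm_eq_inner[symmetric] power2_eq_square)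
        ultimately show ?thesis using s[of y "y + v"] by simp
      qed (use B in simp)
      have "isCont \<phi> x" using cont by (simp add: continuous_on_eq_continuous_at)
      then obtain \<delta> where \<delta>: "0 < \<delta>" "\<And>y. dist y x < \<delta> \<Longrightarrow> dist (\<phi> y) (\<phi> x) < e / 2"
        unfolding continuous_at_eps_delta using e by (metis half_gt_zero dist_commute)
      \<comment> \<open>The subgradient bound \<open>2 * B\<close> times \<open>e / (4 * B)\<close>
        is \<open>e / 2\<close>, the other half being used for continuity; the 1 keeps
        \<open>y\<close> in the range of \<open>sb\<close>.\<close>
      define r where "r = min \<delta> (min 1 (e / (4 * B)))"
      have r: "0 < r" using \<delta> e B by (simp add: r_def)
      obtain y where "y \<in> D" "dist x y < r" using D(2)[of "ball x r"] r by auto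
      then obtain k where k: "y = d k" using rd by auto
      have "\<bar>s y \<bullet> (x - y)\<bar> \<le> norm (s y) * norm (x - y)" by (rule Cauchy_Schwarz_ineq2)
      also have "\<dots> \<le> (2 * B) * norm (x - y)" using sb[of y] \<open>dist x y < r\<close> by (intro mult_right_mono) (auto simp: r_def)
      also have "\<dots> < (2 * B) * (e / (4 * B))"
        using \<open>dist x y < r\<close> B by (intro mult_strict_left_mono) (auto simp: r_def dist_norm)
      also have "\<dots> = e / 2" using B by simp
      finally have "\<bar>s y \<bullet> (x - y)\<bar> < e / 2" .
      moreover have "\<bar>\<phi> y - \<phi> x\<bar> < e / 2" using \<delta>(2)[of y] \<open>dist x y < r\<close> by (simp add: r_def dist_real_def dist_commute)
      ultimately have "\<phi> x - e < \<phi> y + s y \<bullet> (x - y)" by linarith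
      then show "\<exists>k. \<phi> x - e < c k + p k \<bullet> x" unfolding cp unfolding p_def k by blast
    qed
  qed
qed

primrec max_affine :: "(nat \<Rightarrow> real) \<Rightarrow> (nat \<Rightarrow> 'a::euclidean_space) \<Rightarrow> nat \<Rightarrow> 'a \<Rightarrow> real" where
  "max_affine c p 0 x = c 0 + p 0 \<bullet> x"
| "max_affine c p (Suc n) x = max (max_affine c p n x) (c (Suc n) + p (Suc n) \<bullet> x)"

text \<open>A Borel selection of subgradients of \<open>max_affine\<close> taking finitely many
  values, hence a bounded test map admissible in the marginal constraints.\<close>

primrec max_affine_slope :: "(nat \<Rightarrow> real) \<Rightarrow> (nat \<Rightarrow> 'a::euclidean_space) \<Rightarrow> nat \<Rightarrow> 'a \<Rightarrow> 'a" where
  "max_affine_slope c p 0 x = p 0"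
| "max_affine_slope c p (Suc n) x =
    (if max_affine c p n x < c (Suc n) + p (Suc n) \<bullet> x then p (Suc n) else max_affine_slope c p n x)"

lemma max_affine_measurable [measurable]: "max_affine c p n \<in> borel_measurable borel"
  by (induction n) simp_all

lemma max_affine_slope_measurable [measurable]: "max_affine_slope c p n \<in> borel_measurable borel"
  by (induction n) simp_all

lemma max_affine_slope_bounded: "norm (max_affine_slope c p n x) \<le> (\<Sum>k\<le>n. norm (p k))"
  by (induction n) (auto intro: add_increasing2 add_increasing sum_nonneg)

lemma max_affine_subgradient:
  "max_affine c p n x + max_affine_slope c p n x \<bullet> (y - x) \<le> max_affine c p n y"
  by (induction n) (auto simp: inner_diff_right max_def)

lemma max_affine_ge: "k \<le> n \<Longrightarrow> c k + p k \<bullet> x \<le> max_affine c p n x"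
  by (induction n) (auto simp: le_Suc_eq max.coboundedI1)

lemma max_affine_le: "(\<And>k. c k + p k \<bullet> x \<le> r) \<Longrightarrow> max_affine c p n x \<le> r"
  by (induction n) auto

lemma max_affine_integrable:
  assumes "finite_measure M" and S: "integrable M (S :: 'w \<Rightarrow> 'a::euclidean_space)"
  shows "integrable M (\<lambda>z. max_affine c p n (S z))"
proof -
  interpret finite_measure M by fact
  show ?thesis using S by (induction n) (auto intro!: integrable_max)
qed

text \<open>Jensen's inequality without conditional expectations: the subgradient inequality from
  \<open>S z\<close> to \<open>\<zeta> z\<close> is integrated and the slope term vanishes by the
  constraint. As only bounded test maps are allowed, this is done for finite maxima of affine
  functions, followed by a monotone limit.\<close>

lemma cx_le_if_martingale:
  fixes \<zeta> S :: "'w \<Rightarrow> 'a::euclidean_space"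
  assumes \<gamma>: "prob_space \<gamma>" and \<zeta>: "integrable \<gamma> \<zeta>" and S: "integrable \<gamma> S"
    and mart: "\<And>\<Phi>. \<Phi> \<in> borel_measurable borel \<Longrightarrow> bounded (range \<Phi>) \<Longrightarrow>
      (\<integral>z. \<Phi> (S z) \<bullet> \<zeta> z \<partial>\<gamma>) = (\<integral>z. \<Phi> (S z) \<bullet> S z \<partial>\<gamma>)"
  shows "cx_le (distr \<gamma> borel S) (distr \<gamma> borel \<zeta>)"
  unfolding cx_le_def
proof (intro allI impI)
  fix \<phi> :: "'a \<Rightarrow> real" assume \<phi>: "convex_on UNIV \<phi>"
  interpret \<gamma>: prob_space \<gamma> by fact
  have [measurable]: "\<zeta> \<in> borel_measurable \<gamma>" "S \<in> borel_measurable \<gamma>" using \<zeta> S by auto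
  have \<phi>m[measurable]: "\<phi> \<in> borel_measurable borel"
    by (rule borel_measurable_continuous_onI[OF convex_on_continuous[OF open_UNIV \<phi>]])
  obtain c :: "nat \<Rightarrow> real" and p :: "nat \<Rightarrow> 'a" where le: "\<And>k x. c k + p k \<bullet> x \<le> \<phi> x" and sup: "\<And>x. \<forall>e>0. \<exists>k. \<phi> x - e < c k + p k \<bullet> x"
    by (rule convex_eq_countable_sup_affine[OF \<phi>]) (rule that)
  \<comment> \<open>The first affine minorant makes all integrands nonnegative after subtraction;
    its integrals along \<open>S\<close> and \<open>\<zeta>\<close> agree by the constraint with a
    constant test map.\<close>
  define a where "a x = c 0 + p 0 \<bullet> x" for x
  have am[measurable]: "a \<in> borel_measurable borel" unfolding a_def by measurable
  have int_a: "integrable \<gamma> (\<lambda>z. a (T z))" if "integrable \<gamma> T" for T unfolding a_def using that by auto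
  have a_eq: "(\<integral>z. a (\<zeta> z) \<partial>\<gamma>) = (\<integral>z. a (S z) \<partial>\<gamma>)"
    using mart[of "\<lambda>_. p 0"] \<zeta> S by (simp add: a_def)
  have aff: "c 0 + p 0 \<bullet> x = a x" for x by (simp add: a_def)
  have am_le: "a x \<le> max_affine c p n x" for n x unfolding a_def by (rule max_affine_ge) simp
  have jensen: "(\<integral>z. max_affine c p n (S z) \<partial>\<gamma>) \<le> (\<integral>z. max_affine c p n (\<zeta> z) \<partial>\<gamma>)" for n
  proof -
    define \<Phi> where "\<Phi> = max_affine_slope c p n"
    have bd: "bounded (range \<Phi>)" unfolding \<Phi>_def
      by (rule boundedI[of _ "\<Sum>k\<le>n. norm (p k)"]) (auto intro: max_affine_slope_bounded)
    have [measurable]: "\<Phi> \<in> borel_measurable borel" unfolding \<Phi>_def by measurable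
    have int\<Phi>: "integrable \<gamma> (\<lambda>z. \<Phi> (S z) \<bullet> T z)" if T: "integrable \<gamma> T" for T
    proof (rule Bochner_Integration.integrable_bound)
      show "integrable \<gamma> (\<lambda>z. (\<Sum>k\<le>n. norm (p k)) * norm (T z))" using T by simp
      show "AE z in \<gamma>. norm (\<Phi> (S z) \<bullet> T z) \<le> norm ((\<Sum>k\<le>n. norm (p k)) * norm (T z))"
      proof (rule AE_I2)
        fix z
        have "\<bar>\<Phi> (S z) \<bullet> T z\<bar> \<le> norm (\<Phi> (S z)) * norm (T z)" by (rule Cauchy_Schwarz_ineq2)
        also have "\<dots> \<le> (\<Sum>k\<le>n. norm (p k)) * norm (T z)"
          unfolding \<Phi>_def by (intro mult_right_mono max_affine_slope_bounded) simp
        finally show "norm (\<Phi> (S z) \<bullet> T z) \<le> norm ((\<Sum>k\<le>n. norm (p k)) * norm (T z))"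
          by (simp add: abs_mult sum_nonneg)
      qed
      have [measurable]: "T \<in> borel_measurable \<gamma>" using T by simp
      show "(\<lambda>z. \<Phi> (S z) \<bullet> T z) \<in> borel_measurable \<gamma>" by measurable
    qed
    have "(\<integral>z. max_affine c p n (S z) \<partial>\<gamma>) = (\<integral>z. max_affine c p n (S z) + \<Phi> (S z) \<bullet> (\<zeta> z - S z) \<partial>\<gamma>)"
      using mart[of \<Phi>] bd int\<Phi>[OF \<zeta>] int\<Phi>[OF S] max_affine_integrable[OF \<gamma>.finite_measure_axioms S]
      by (simp add: inner_diff_right)
    also have "\<dots> \<le> (\<integral>z. max_affine c p n (\<zeta> z) \<partial>\<gamma>)"
    proof (rule integral_mono)
      show "integrable \<gamma> (\<lambda>z. max_affine c p n (S z) + \<Phi> (S z) \<bullet> (\<zeta> z - S z))"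
        using int\<Phi>[OF \<zeta>] int\<Phi>[OF S] max_affine_integrable[OF \<gamma>.finite_measure_axioms S]
        by (simp add: inner_diff_right)
      show "integrable \<gamma> (\<lambda>z. max_affine c p n (\<zeta> z))"
        by (rule max_affine_integrable[OF \<gamma>.finite_measure_axioms \<zeta>])
      show "max_affine c p n (S z) + \<Phi> (S z) \<bullet> (\<zeta> z - S z) \<le> max_affine c p n (\<zeta> z)" for z
        unfolding \<Phi>_def by (rule max_affine_subgradient)
    qed
    finally show ?thesis .
  qed
  have "(\<integral>\<^sup>+z. ennreal (\<phi> (S z) - a (S z)) \<partial>\<gamma>) \<le> (\<integral>\<^sup>+z. ennreal (\<phi> (\<zeta> z) - a (\<zeta> z)) \<partial>\<gamma>)"
  proof (rule LIMSEQ_le_const2)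
    show "(\<lambda>n. \<integral>\<^sup>+z. ennreal (max_affine c p n (S z) - a (S z)) \<partial>\<gamma>) \<longlonglongrightarrow> (\<integral>\<^sup>+z. ennreal (\<phi> (S z) - a (S z)) \<partial>\<gamma>)"
    proof (rule nn_integral_LIMSEQ)
      show "incseq (\<lambda>n z. ennreal (max_affine c p n (S z) - a (S z)))"
        by (rule incseq_SucI) (auto simp: le_fun_def intro!: ennreal_leI)
      show "(\<lambda>z. ennreal (max_affine c p n (S z) - a (S z))) \<in> borel_measurable \<gamma>" for n by measurable
      fix z
      have "(\<lambda>n. max_affine c p n (S z)) \<longlonglongrightarrow> \<phi> (S z)"
      proof (rule LIMSEQ_I)
        fix e :: real assume "0 < e"
        then obtain k where k: "\<phi> (S z) - e < c k + p k \<bullet> S z" using sup by blast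
        show "\<exists>n0. \<forall>n\<ge>n0. norm (max_affine c p n (S z) - \<phi> (S z)) < e"
        proof (intro exI[of _ k] allI impI)
          fix n assume "k \<le> n"
          from max_affine_ge[OF this, of c p "S z"] k max_affine_le[of c p "S z" "\<phi> (S z)" n] le
          show "norm (max_affine c p n (S z) - \<phi> (S z)) < e" by auto
        qed
      qed
      then show "(\<lambda>n. ennreal (max_affine c p n (S z) - a (S z))) \<longlonglongrightarrow> ennreal (\<phi> (S z) - a (S z))"
        by (intro tendsto_ennrealI tendsto_intros)
    qed
    show "\<exists>N. \<forall>n\<ge>N. (\<integral>\<^sup>+z. ennreal (max_affine c p n (S z) - a (S z)) \<partial>\<gamma>) \<le> (\<integral>\<^sup>+z. ennreal (\<phi> (\<zeta> z) - a (\<zeta> z)) \<partial>\<gamma>)"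
    proof (intro exI[of _ 0] allI impI)
      fix n
      have "(\<integral>\<^sup>+z. ennreal (max_affine c p n (S z) - a (S z)) \<partial>\<gamma>) = ennreal (\<integral>z. max_affine c p n (S z) - a (S z) \<partial>\<gamma>)"
        using am_le by (intro nn_integral_eq_integral Bochner_Integration.integrable_diff int_a[OF S]
            max_affine_integrable[OF \<gamma>.finite_measure_axioms S]) auto
      also have "\<dots> \<le> ennreal (\<integral>z. max_affine c p n (\<zeta> z) - a (\<zeta> z) \<partial>\<gamma>)"
        using jensen[of n] a_eq int_a[OF S] int_a[OF \<zeta>] max_affine_integrable[OF \<gamma>.finite_measure_axioms S]
          max_affine_integrable[OF \<gamma>.finite_measure_axioms \<zeta>]
        by (intro ennreal_leI) simp
      also have "\<dots> = (\<integral>\<^sup>+z. ennreal (max_affine c p n (\<zeta> z) - a (\<zeta> z)) \<partial>\<gamma>)"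
        using am_le by (intro nn_integral_eq_integral[symmetric] Bochner_Integration.integrable_diff int_a[OF \<zeta>]
            max_affine_integrable[OF \<gamma>.finite_measure_axioms \<zeta>]) auto
      also have "\<dots> \<le> (\<integral>\<^sup>+z. ennreal (\<phi> (\<zeta> z) - a (\<zeta> z)) \<partial>\<gamma>)"
        using max_affine_le[OF le] by (intro nn_integral_mono ennreal_leI diff_right_mono)
      finally show "(\<integral>\<^sup>+z. ennreal (max_affine c p n (S z) - a (S z)) \<partial>\<gamma>) \<le> (\<integral>\<^sup>+z. ennreal (\<phi> (\<zeta> z) - a (\<zeta> z)) \<partial>\<gamma>)" .
    qed
  qed
  moreover have ext: "ext_integral (distr \<gamma> borel T) \<phi> = ereal (\<integral>z. a (T z) \<partial>\<gamma>) + enn2ereal (\<integral>\<^sup>+z. ennreal (\<phi> (T z) - a (T z)) \<partial>\<gamma>)"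
    if T: "integrable \<gamma> T" for T
  proof -
    have [measurable]: "T \<in> borel_measurable \<gamma>" using T by simp
    have "ext_integral (distr \<gamma> borel T) \<phi> = ext_integral \<gamma> (\<lambda>z. \<phi> (T z))"
      unfolding ext_integral_def by (simp add: nn_integral_distr)
    also have "\<dots> = ereal (\<integral>z. a (T z) \<partial>\<gamma>) + enn2ereal (\<integral>\<^sup>+z. ennreal (\<phi> (T z) - a (T z)) \<partial>\<gamma>)"
      using le by (intro ext_integral_minorant int_a[OF T]) (auto simp: a_def)
    finally show ?thesis .
  qed
  ultimately show "ext_integral (distr \<gamma> borel S) \<phi> \<le> ext_integral (distr \<gamma> borel \<zeta>) \<phi>"
    unfolding ext[OF S] ext[OF \<zeta>] a_eq by (intro add_left_mono) (simp add: less_eq_ennreal.rep_eq)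
qed

lemma cx_le_integral_mono:
  assumes "cx_le \<mu> \<rho>" "convex_on UNIV \<phi>" "integrable \<mu> \<phi>" "integrable \<rho> \<phi>"
  shows "(\<integral>x. \<phi> x \<partial>\<mu>) \<le> (\<integral>x. \<phi> x \<partial>\<rho>)"
  using assms by (auto simp: cx_le_def ext_integral_integrable)

lemma cx_le_bary:
  assumes "\<mu> \<in> P2" "\<rho> \<in> P2" "cx_le \<mu> \<rho>"
  shows "bary \<mu> = bary \<rho>"
proof -
  have "v \<bullet> bary \<mu> \<le> v \<bullet> bary \<rho>" for v
    using cx_le_integral_mono[OF assms(3), of "\<lambda>x. v \<bullet> x"] P2_integral_inner[OF assms(1), of v]
      P2_integral_inner[OF assms(2), of v] convex_on_if_subgradients[of "\<lambda>x. v \<bullet> x" "\<lambda>_. v"]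
    by (simp add: inner_diff_right)
  from this[of "bary \<mu> - bary \<rho>"] have "(bary \<mu> - bary \<rho>) \<bullet> (bary \<mu> - bary \<rho>) \<le> 0"
    by (simp add: inner_diff_right)
  then have "bary \<mu> - bary \<rho> = 0" by (metis inner_eq_zero_iff inner_ge_zero order_antisym)
  then show ?thesis by simp
qed

lemma cx_le_C11:
  assumes "\<mu> \<in> P2" "\<rho> \<in> P2" "cx_le \<mu> \<rho>" "C11 u G"
  shows "(\<integral>x. u x \<partial>\<mu>) + m2 \<mu> / 2 \<le> (\<integral>x. u x \<partial>\<rho>) + m2 \<rho> / 2"
  using cx_le_integral_mono[OF assms(3) C11_convex[OF assms(4)]] C11_integrable[OF assms(1,4)] C11_integrable[OF assms(2,4)]
    P2_D(3)[OF assms(1)] P2_D(3)[OF assms(2)]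
  by (simp add: m2_def)

lemma C11_neg_half_sq: "C11 (\<lambda>x. - (norm x)\<^sup>2 / 2) (\<lambda>x. - x)"
  unfolding C11_def
proof (intro allI)
  fix z w :: 'a
  have "- (norm w)\<^sup>2 / 2 - - (norm z)\<^sup>2 / 2 - - z \<bullet> (w - z) = - ((norm (w - z))\<^sup>2 / 2)"
    unfolding power2_norm_eq_inner by (simp add: inner_commute algebra_simps inner_diff_left inner_diff_right add_divide_distrib diff_divide_distrib)
  then show "\<bar>- (norm w)\<^sup>2 / 2 - - (norm z)\<^sup>2 / 2 - - z \<bullet> (w - z)\<bar> \<le> (norm (w - z))\<^sup>2 / 2" by simp
qed

text \<open>In convex order the potential \<open>- |.|^2/2\<close> is optimal: any admissible
  \<open>u\<close> becomes convex after adding \<open>|.|^2/2\<close>, which gives the matching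
  upper bound.\<close>

lemma Z2_cx_le:
  fixes \<nu> \<rho> :: "'a::euclidean_space measure"
  assumes "\<nu> \<in> P2" "\<rho> \<in> P2" "cx_le \<nu> \<rho>"
  shows "Z2 \<nu> \<rho> = (m2 \<rho> - m2 \<nu>) / 2"
proof (rule antisym)
  show "Z2 \<nu> \<rho> \<le> (m2 \<rho> - m2 \<nu>) / 2"
  proof (rule Z2_least)
    fix u :: "'a \<Rightarrow> real" and G assume "C11 u G"
    from cx_le_C11[OF assms this] show "(\<integral>x. u x \<partial>\<nu>) - (\<integral>x. u x \<partial>\<rho>) \<le> (m2 \<rho> - m2 \<nu>) / 2"
      unfolding diff_divide_distrib by linarith
  qed
  interpret P2_pair \<nu> \<rho> using assms cx_le_bary[OF assms] by (simp add: P2_pair_def)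
  have "(\<integral>x. - (norm x)\<^sup>2 / 2 \<partial>M) = - m2 M / 2" for M :: "'a measure" by (simp add: m2_def)
  with Z2_upper[OF C11_neg_half_sq] show "(m2 \<rho> - m2 \<nu>) / 2 \<le> Z2 \<nu> \<rho>"
    by (simp add: diff_divide_distrib)
qed

subsection \<open>Weak duality and the characterisation of minimisers\<close>

lemma GammaQ_D:
  assumes "(\<gamma>, \<zeta>) \<in> GammaQ \<mu> \<nu>"
  shows "prob_space \<gamma>" "sets \<gamma> = sets borel" "distr \<gamma> borel fst = \<mu>" "distr \<gamma> borel snd = \<nu>"
    "\<zeta> \<in> borel_measurable borel" "integrable \<gamma> \<zeta>" "fst \<in> borel_measurable \<gamma>" "snd \<in> borel_measurable \<gamma>"
    "\<And>\<Phi>. \<Phi> \<in> borel_measurable borel \<Longrightarrow> bounded (range \<Phi>) \<Longrightarrow> (\<integral>z. \<Phi> (fst z) \<bullet> \<zeta> z \<partial>\<gamma>) = (\<integral>z. \<Phi> (fst z) \<bullet> fst z \<partial>\<gamma>)"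
    "\<And>\<Phi>. \<Phi> \<in> borel_measurable borel \<Longrightarrow> bounded (range \<Phi>) \<Longrightarrow> (\<integral>z. \<Phi> (snd z) \<bullet> \<zeta> z \<partial>\<gamma>) = (\<integral>z. \<Phi> (snd z) \<bullet> snd z \<partial>\<gamma>)"
proof -
  show \<gamma>: "prob_space \<gamma>" and sets: "sets \<gamma> = sets borel" and d: "distr \<gamma> borel fst = \<mu>" "distr \<gamma> borel snd = \<nu>"
    and "integrable \<gamma> \<zeta>"
    using assms by (auto simp: GammaQ_def coupling_def)
  have "\<zeta> \<in> borel_measurable \<gamma>" using assms by (auto simp: GammaQ_def)
  then show "\<zeta> \<in> borel_measurable borel" using sets by (simp cong: measurable_cong_sets)
  have "(fst :: 'a \<times> 'a \<Rightarrow> 'a) \<in> borel_measurable borel" "(snd :: 'a \<times> 'a \<Rightarrow> 'a) \<in> borel_measurable borel"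
    by (intro borel_measurable_continuous_onI continuous_intros)+
  then show f: "fst \<in> borel_measurable \<gamma>" and s: "snd \<in> borel_measurable \<gamma>"
    using sets by (simp_all cong: measurable_cong_sets)
  fix \<Phi> :: "'a \<Rightarrow> 'a" assume \<Phi>[measurable]: "\<Phi> \<in> borel_measurable borel" and b: "bounded (range \<Phi>)"
  have "(\<integral>z. \<Phi> (fst z) \<bullet> \<zeta> z \<partial>\<gamma>) = (\<integral>x. \<Phi> x \<bullet> x \<partial>\<mu>)" "(\<integral>z. \<Phi> (snd z) \<bullet> \<zeta> z \<partial>\<gamma>) = (\<integral>x. \<Phi> x \<bullet> x \<partial>\<nu>)"
    using assms \<Phi> b unfolding GammaQ_def by blast+
  moreover have "(\<integral>x. \<Phi> x \<bullet> x \<partial>\<mu>) = (\<integral>z. \<Phi> (fst z) \<bullet> fst z \<partial>\<gamma>)"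
    unfolding d(1)[symmetric] by (rule integral_distr[OF f]) measurable
  moreover have "(\<integral>x. \<Phi> x \<bullet> x \<partial>\<nu>) = (\<integral>z. \<Phi> (snd z) \<bullet> snd z \<partial>\<gamma>)"
    unfolding d(2)[symmetric] by (rule integral_distr[OF s]) measurable
  ultimately show "(\<integral>z. \<Phi> (fst z) \<bullet> \<zeta> z \<partial>\<gamma>) = (\<integral>z. \<Phi> (fst z) \<bullet> fst z \<partial>\<gamma>)"
    "(\<integral>z. \<Phi> (snd z) \<bullet> \<zeta> z \<partial>\<gamma>) = (\<integral>z. \<Phi> (snd z) \<bullet> snd z \<partial>\<gamma>)" by simp_all
qed

lemma integrable_inner_L2:
  fixes f g :: "'w \<Rightarrow> 'a::euclidean_space"
  assumes [measurable]: "f \<in> borel_measurable M" "g \<in> borel_measurable M"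
    and "square_integrable M (\<lambda>z. f z)" "square_integrable M (\<lambda>z. g z)"
  shows "integrable M (\<lambda>z. norm (f z) * norm (g z))" "integrable M (\<lambda>z. f z \<bullet> g z)"
    "square_integrable M (\<lambda>z. f z + g z)" "square_integrable M (\<lambda>z. f z - g z)"
proof -
  have i: "integrable M (\<lambda>z. (norm (f z))\<^sup>2 + (norm (g z))\<^sup>2)" using assms by simp
  have le: "norm (f z) * norm (g z) \<le> (norm (f z))\<^sup>2 + (norm (g z))\<^sup>2" for z
    using sum_squares_bound[of "norm (f z)" "norm (g z)"] mult_nonneg_nonneg[OF norm_ge_zero norm_ge_zero, of "f z" "g z"] by linarith
  show n: "integrable M (\<lambda>z. norm (f z) * norm (g z))"
    by (rule Bochner_Integration.integrable_bound[OF i]) (use le in auto)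
  show inn: "integrable M (\<lambda>z. f z \<bullet> g z)"
    by (rule Bochner_Integration.integrable_bound[OF n]) (use Cauchy_Schwarz_ineq2 in \<open>auto simp: abs_mult\<close>)
  have "(norm (f z + g z))\<^sup>2 = (norm (f z))\<^sup>2 + (norm (g z))\<^sup>2 + 2 * (f z \<bullet> g z)" for z
    unfolding power2_norm_eq_inner by (simp add: inner_add_left inner_add_right inner_commute)
  then show "square_integrable M (\<lambda>z. f z + g z)" using assms inn by simp
  have "(norm (f z - g z))\<^sup>2 = (norm (f z))\<^sup>2 + (norm (g z))\<^sup>2 - 2 * (f z \<bullet> g z)" for z
    unfolding power2_norm_eq_inner by (simp add: inner_diff_left inner_diff_right inner_commute)
  then show "square_integrable M (\<lambda>z. f z - g z)" using assms inn by simp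
qed

text \<open>\<open>GammaQ\<close> tests with bounded maps only, whereas the identity and gradients
  of potentials, of linear growth, are needed. With square integrability on both sides, truncation
  and domination extend the constraint to them.\<close>

lemma marginal_constraint_unbounded:
  fixes \<zeta> S :: "'w \<Rightarrow> 'a::euclidean_space"
  assumes [measurable]: "\<zeta> \<in> borel_measurable M" "S \<in> borel_measurable M"
    and \<zeta>2: "square_integrable M \<zeta>" and S2: "square_integrable M S"
    and mart: "\<And>\<Phi>. \<Phi> \<in> borel_measurable borel \<Longrightarrow> bounded (range \<Phi>) \<Longrightarrow>
      (\<integral>z. \<Phi> (S z) \<bullet> \<zeta> z \<partial>M) = (\<integral>z. \<Phi> (S z) \<bullet> S z \<partial>M)"
    and \<Phi>[measurable]: "\<Phi> \<in> borel_measurable borel" and \<Phi>2: "square_integrable M (\<lambda>z. \<Phi> (S z))"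
  shows "(\<integral>z. \<Phi> (S z) \<bullet> \<zeta> z \<partial>M) = (\<integral>z. \<Phi> (S z) \<bullet> S z \<partial>M)"
proof -
  \<comment> \<open>Large values are replaced by 0, which keeps both the bound \<open>n\<close> and
    domination by \<open>\<Phi>\<close>.\<close>
  define \<Psi> where "\<Psi> n x = (if norm (\<Phi> x) \<le> real n then \<Phi> x else 0)" for n x
  have [measurable]: "\<Psi> n \<in> borel_measurable borel" for n unfolding \<Psi>_def by measurable
  have \<Psi>le: "norm (\<Psi> n x) \<le> norm (\<Phi> x)" for n x by (simp add: \<Psi>_def)
  have lim: "(\<lambda>n. \<integral>z. \<Psi> n (S z) \<bullet> T z \<partial>M) \<longlonglongrightarrow> (\<integral>z. \<Phi> (S z) \<bullet> T z \<partial>M)"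
    if [measurable]: "T \<in> borel_measurable M" and T2: "square_integrable M T" for T
  proof (rule integral_dominated_convergence[where w = "\<lambda>z. norm (\<Phi> (S z)) * norm (T z)"])
    show "integrable M (\<lambda>z. norm (\<Phi> (S z)) * norm (T z))" using \<Phi>2 T2 by (intro integrable_inner_L2) measurable
    show "AE z in M. (\<lambda>n. \<Psi> n (S z) \<bullet> T z) \<longlonglongrightarrow> \<Phi> (S z) \<bullet> T z"
    proof (rule AE_I2, rule tendsto_eventually)
      fix z
      obtain K :: nat where "norm (\<Phi> (S z)) \<le> real K" using real_arch_simple by blast
      then show "eventually (\<lambda>n. \<Psi> n (S z) \<bullet> T z = \<Phi> (S z) \<bullet> T z) sequentially"
        unfolding eventually_sequentially by (intro exI[of _ K]) (auto simp: \<Psi>_def)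
    qed
    show "AE z in M. norm (\<Psi> n (S z) \<bullet> T z) \<le> norm (\<Phi> (S z)) * norm (T z)" for n
    proof (rule AE_I2)
      fix z
      have "norm (\<Psi> n (S z) \<bullet> T z) \<le> norm (\<Psi> n (S z)) * norm (T z)" by (simp add: Cauchy_Schwarz_ineq2)
      also have "\<dots> \<le> norm (\<Phi> (S z)) * norm (T z)" by (intro mult_right_mono \<Psi>le) simp
      finally show "norm (\<Psi> n (S z) \<bullet> T z) \<le> norm (\<Phi> (S z)) * norm (T z)" .
    qed
  qed measurable
  have "(\<integral>z. \<Psi> n (S z) \<bullet> \<zeta> z \<partial>M) = (\<integral>z. \<Psi> n (S z) \<bullet> S z \<partial>M)" for n
    by (rule mart) (auto intro!: boundedI[of _ "real n"] simp: \<Psi>_def)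
  with lim[OF _ \<zeta>2] lim[OF _ S2] show ?thesis by (simp add: LIMSEQ_unique)
qed

context P2_pair begin

lemma V_swap: "P2_pair.V \<nu> \<mu> = V"
  by (simp add: P2_pair.V_def[OF swap] V_def Z2_swap[of \<nu> \<mu>] add.commute)

lemma V_nonneg: "0 \<le> V"
  using dual_bound[of "\<lambda>_. 0" "\<lambda>_. 0" 1 "\<lambda>_. 0" "\<lambda>_. 0"] by simp

lemma Z2_nonneg: "0 \<le> Z2 \<mu> \<nu>"
  using Z2_upper[OF C11_zero] by simp

text \<open>Convex order is used with \<open>u\<close> for \<open>\<mu>\<close> and with
  \<open>- u\<close> for \<open>\<nu>\<close>; in the sum the integrals of \<open>u\<close> against
  \<open>\<rho>\<close> cancel.\<close>

lemma V_le_m2: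
  assumes "\<rho> \<in> P2" "cx_le \<mu> \<rho>" "cx_le \<nu> \<rho>"
  shows "V \<le> m2 \<rho>"
proof -
  obtain u G where u: "C11 u G" "(\<integral>x. u x \<partial>\<mu>) - (\<integral>x. u x \<partial>\<nu>) = Z2 \<mu> \<nu>" by (rule ex_optimal_C11)
  have "(\<integral>x. u x \<partial>\<mu>) + m2 \<mu> / 2 \<le> (\<integral>x. u x \<partial>\<rho>) + m2 \<rho> / 2" by (rule cx_le_C11[OF \<mu> assms(1,2) u(1)])
  moreover have "(\<integral>x. - u x \<partial>\<nu>) + m2 \<nu> / 2 \<le> (\<integral>x. - u x \<partial>\<rho>) + m2 \<rho> / 2"
    by (rule cx_le_C11[OF \<nu> assms(1,3) C11_uminus[OF u(1)]])
  ultimately show ?thesis using u(2) by (simp add: V_def add_divide_distrib)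
qed

lemma GammaQ_cx_le:
  assumes "(\<gamma>, \<zeta>) \<in> GammaQ \<mu> \<nu>"
  shows "cx_le \<mu> (distr \<gamma> borel \<zeta>)" "cx_le \<nu> (distr \<gamma> borel \<zeta>)"
proof -
  note D = GammaQ_D[OF assms]
  have "integrable \<gamma> fst" using P2_integrable_id[OF \<mu>] unfolding D(3)[symmetric]
    by (subst (asm) integrable_distr_eq[OF D(7)]) auto
  from cx_le_if_martingale[OF D(1,6) this D(9)] show "cx_le \<mu> (distr \<gamma> borel \<zeta>)" by (simp add: D(3))
  have "integrable \<gamma> snd" using P2_integrable_id[OF \<nu>] unfolding D(4)[symmetric]
    by (subst (asm) integrable_distr_eq[OF D(8)]) auto
  from cx_le_if_martingale[OF D(1,6) this D(10)] show "cx_le \<nu> (distr \<gamma> borel \<zeta>)" by (simp add: D(4))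
qed

lemma GammaQ_L2:
  fixes f :: "'a \<Rightarrow> real"
  assumes "(\<gamma>, \<zeta>) \<in> GammaQ \<mu> \<nu>"
  shows "square_integrable \<gamma> fst" "square_integrable \<gamma> snd"
    "second_moment \<gamma> fst = m2 \<mu>" "second_moment \<gamma> snd = m2 \<nu>"
    "f \<in> borel_measurable borel \<Longrightarrow> (\<integral>z. f (fst z) \<partial>\<gamma>) = (\<integral>x. f x \<partial>\<mu>)"
    "f \<in> borel_measurable borel \<Longrightarrow> (\<integral>z. f (snd z) \<partial>\<gamma>) = (\<integral>x. f x \<partial>\<nu>)"
    "f \<in> borel_measurable borel \<Longrightarrow> integrable \<mu> f \<Longrightarrow> integrable \<gamma> (\<lambda>z. f (fst z))"
    "f \<in> borel_measurable borel \<Longrightarrow> integrable \<nu> f \<Longrightarrow> integrable \<gamma> (\<lambda>z. f (snd z))"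
proof -
  note D = GammaQ_D[OF assms]
  have 1: "(\<integral>z. f (fst z) \<partial>\<gamma>) = (\<integral>x. f x \<partial>\<mu>)" and 2: "(\<integral>z. f (snd z) \<partial>\<gamma>) = (\<integral>x. f x \<partial>\<nu>)"
    and 3: "integrable \<mu> f \<Longrightarrow> integrable \<gamma> (\<lambda>z. f (fst z))" and 4: "integrable \<nu> f \<Longrightarrow> integrable \<gamma> (\<lambda>z. f (snd z))"
    if "f \<in> borel_measurable borel" for f :: "'a \<Rightarrow> real"
    using integral_distr[OF D(7) that] integral_distr[OF D(8) that] integrable_distr_eq[OF D(7) that]
      integrable_distr_eq[OF D(8) that] by (simp_all add: D(3,4))
  show "f \<in> borel_measurable borel \<Longrightarrow> (\<integral>z. f (fst z) \<partial>\<gamma>) = (\<integral>x. f x \<partial>\<mu>)"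
    "f \<in> borel_measurable borel \<Longrightarrow> (\<integral>z. f (snd z) \<partial>\<gamma>) = (\<integral>x. f x \<partial>\<nu>)"
    "f \<in> borel_measurable borel \<Longrightarrow> integrable \<mu> f \<Longrightarrow> integrable \<gamma> (\<lambda>z. f (fst z))"
    "f \<in> borel_measurable borel \<Longrightarrow> integrable \<nu> f \<Longrightarrow> integrable \<gamma> (\<lambda>z. f (snd z))"
    by (fact 1 2 3 4)+
  show "square_integrable \<gamma> fst" "square_integrable \<gamma> snd"
    using 3[of "\<lambda>x. (norm x)\<^sup>2"] 4[of "\<lambda>x. (norm x)\<^sup>2"] P2_D(3)[OF \<mu>] P2_D(3)[OF \<nu>] by auto
  show "second_moment \<gamma> fst = m2 \<mu>" "second_moment \<gamma> snd = m2 \<nu>"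
    using 1[of "\<lambda>x. (norm x)\<^sup>2"] 2[of "\<lambda>x. (norm x)\<^sup>2"] by (auto simp: m2_def)
qed

text \<open>This is the minimising point of \<open>C11_two_point\<close>.\<close>

definition optimal_density where
  "optimal_density G z = (1/2) *\<^sub>R (fst z + snd z) + (1/2) *\<^sub>R (G (fst z) - G (snd z))" for G :: "'a \<Rightarrow> 'a"

context
  fixes \<gamma> :: "('a \<times> 'a) measure" and \<zeta> :: "'a \<times> 'a \<Rightarrow> 'a"
  assumes GQ: "(\<gamma>, \<zeta>) \<in> GammaQ \<mu> \<nu>"
begin

lemma \<zeta>_measurable: "\<zeta> \<in> borel_measurable \<gamma>"
  using GammaQ_D[OF GQ] by (simp cong: measurable_cong_sets)

lemma C11_gradient_L2:
  assumes u: "C11 u G"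
  shows "square_integrable \<gamma> (\<lambda>z. G (fst z))" "square_integrable \<gamma> (\<lambda>z. G (snd z))"
proof -
  note [measurable] = C11_measurable(2)[OF u]
  have "(\<lambda>x. (norm (G x))\<^sup>2) \<in> quad_funs"
  proof -
    have q: "(\<lambda>x. 2 * (norm (G 0))\<^sup>2 + 2 * (norm x)\<^sup>2) \<in> (quad_funs :: ('a \<Rightarrow> real) set)" by (intro quad_funs_intros)
    show ?thesis
    proof (rule quad_funs_dominated[OF q])
      fix x
      have "norm (G x) \<le> norm (G 0) + norm x"
        using C11_gradient_lipschitz[OF u, of x 0] norm_triangle_sub[of "G x" "G 0"] by simp
      then have "(norm (G x))\<^sup>2 \<le> (norm (G 0) + norm x)\<^sup>2" by (intro power_mono) auto
      also have "\<dots> \<le> 2 * (norm (G 0))\<^sup>2 + 2 * (norm x)\<^sup>2"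
        using sum_squares_bound[of "norm (G 0)" "norm x"] by (simp add: power2_sum)
      finally show "\<bar>(norm (G x))\<^sup>2\<bar> \<le> 2 * (norm (G 0))\<^sup>2 + 2 * (norm x)\<^sup>2" by simp
    qed
  qed
  then have "integrable \<mu> (\<lambda>x. (norm (G x))\<^sup>2)" "integrable \<nu> (\<lambda>x. (norm (G x))\<^sup>2)"
    by (auto intro!: P2_integrable[OF \<mu>] P2_integrable[OF \<nu>])
  then show "square_integrable \<gamma> (\<lambda>z. G (fst z))" "square_integrable \<gamma> (\<lambda>z. G (snd z))"
    by (auto intro!: GammaQ_L2(7)[OF GQ, of "\<lambda>x. (norm (G x))\<^sup>2"] GammaQ_L2(8)[OF GQ, of "\<lambda>x. (norm (G x))\<^sup>2"])
qed

lemma optimal_density_L2: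
  assumes u: "C11 u G"
  shows "optimal_density G \<in> borel_measurable \<gamma>" "square_integrable \<gamma> (\<lambda>z. optimal_density G z)"
proof -
  note [measurable] = C11_measurable(2)[OF u] GammaQ_D(7,8)[OF GQ]
  show "optimal_density G \<in> borel_measurable \<gamma>" unfolding optimal_density_def[abs_def] by measurable
  have 1: "square_integrable \<gamma> (\<lambda>z. fst z + snd z)"
    by (intro integrable_inner_L2(3) GammaQ_L2[OF GQ]) measurable
  have 2: "square_integrable \<gamma> (\<lambda>z. G (fst z) - G (snd z))"
    by (intro integrable_inner_L2(4) C11_gradient_L2[OF u]) measurable
  have 3: "square_integrable \<gamma> (\<lambda>z. (fst z + snd z) + (G (fst z) - G (snd z)))"
    by (rule integrable_inner_L2(3)[OF _ _ 1 2]) measurable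
  have eq: "(norm (optimal_density G z))\<^sup>2 = (norm ((fst z + snd z) + (G (fst z) - G (snd z))))\<^sup>2 / 4" for z
    unfolding optimal_density_def scaleR_right_distrib[symmetric] by (simp add: power_divide)
  show "square_integrable \<gamma> (\<lambda>z. optimal_density G z)" unfolding eq using 3 by simp
qed

lemma constraint_L2:
  assumes \<zeta>2: "square_integrable \<gamma> \<zeta>" and \<Phi>: "\<Phi> \<in> borel_measurable borel"
  shows "square_integrable \<gamma> (\<lambda>z. \<Phi> (fst z)) \<Longrightarrow> (\<integral>z. \<Phi> (fst z) \<bullet> \<zeta> z \<partial>\<gamma>) = (\<integral>z. \<Phi> (fst z) \<bullet> fst z \<partial>\<gamma>)"
    and "square_integrable \<gamma> (\<lambda>z. \<Phi> (snd z)) \<Longrightarrow> (\<integral>z. \<Phi> (snd z) \<bullet> \<zeta> z \<partial>\<gamma>) = (\<integral>z. \<Phi> (snd z) \<bullet> snd z \<partial>\<gamma>)"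
  using marginal_constraint_unbounded[OF \<zeta>_measurable _ \<zeta>2 _ _ \<Phi>, of fst] marginal_constraint_unbounded[OF \<zeta>_measurable _ \<zeta>2 _ _ \<Phi>, of snd]
    GammaQ_D(7-10)[OF GQ] GammaQ_L2(1,2)[OF GQ] by auto

lemma costC_eq: "square_integrable \<gamma> \<zeta> \<Longrightarrow> costC \<gamma> \<zeta> = ennreal (second_moment \<gamma> \<zeta>)"
  unfolding costC_def by (rule nn_integral_eq_integral) auto

text \<open>With the identity as test map, the constraints turn the mixed terms of
  \<open>half_sq_dist\<close> into \<open>m2 \<mu>\<close> and \<open>m2 \<nu>\<close>. Hence the
  two costs differ by a constant, the reason for their common minimisers.\<close>

lemma costZ_eq:
  assumes \<zeta>2: "square_integrable \<gamma> \<zeta>"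
  shows "integrable \<gamma> (half_sq_dist \<zeta>)"
    "(\<integral>z. half_sq_dist \<zeta> z \<partial>\<gamma>) = second_moment \<gamma> \<zeta> - (m2 \<mu> + m2 \<nu>) / 2"
    "costZ \<gamma> \<zeta> = ennreal (second_moment \<gamma> \<zeta> - (m2 \<mu> + m2 \<nu>) / 2)"
proof -
  note [measurable] = \<zeta>_measurable GammaQ_D(7,8)[OF GQ]
  note L2 = GammaQ_L2[OF GQ]
  show i: "integrable \<gamma> (half_sq_dist \<zeta>)"
    by (intro integrable_mult_right Bochner_Integration.integrable_add integrable_inner_L2(4) \<zeta>2 L2) measurable
  have if': "integrable \<gamma> (\<lambda>z. fst z \<bullet> \<zeta> z)" by (intro integrable_inner_L2(2) \<zeta>2 L2) measurable
  have is': "integrable \<gamma> (\<lambda>z. snd z \<bullet> \<zeta> z)" by (intro integrable_inner_L2(2) \<zeta>2 L2) measurable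
  have f: "(\<integral>z. fst z \<bullet> \<zeta> z \<partial>\<gamma>) = m2 \<mu>"
    using constraint_L2(1)[OF \<zeta>2, of "\<lambda>x. x"] L2 by (simp add: power2_norm_eq_inner)
  have s: "(\<integral>z. snd z \<bullet> \<zeta> z \<partial>\<gamma>) = m2 \<nu>"
    using constraint_L2(2)[OF \<zeta>2, of "\<lambda>x. x"] L2 by (simp add: power2_norm_eq_inner)
  have "half_sq_dist \<zeta> z
    = (norm (\<zeta> z))\<^sup>2 - fst z \<bullet> \<zeta> z - snd z \<bullet> \<zeta> z + (norm (fst z))\<^sup>2 / 2 + (norm (snd z))\<^sup>2 / 2" for z
    unfolding power2_norm_eq_inner by (simp add: inner_diff_left inner_diff_right inner_commute algebra_simps add_divide_distrib)
  then have "(\<integral>z. half_sq_dist \<zeta> z \<partial>\<gamma>)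
    = (\<integral>z. (norm (\<zeta> z))\<^sup>2 - fst z \<bullet> \<zeta> z - snd z \<bullet> \<zeta> z + (norm (fst z))\<^sup>2 / 2 + (norm (snd z))\<^sup>2 / 2 \<partial>\<gamma>)" by (simp only:)
  also have "\<dots> = second_moment \<gamma> \<zeta> - m2 \<mu> - m2 \<nu> + m2 \<mu> / 2 + m2 \<nu> / 2"
    using \<zeta>2 if' is' L2(1-4) f s by simp
  finally show e: "(\<integral>z. half_sq_dist \<zeta> z \<partial>\<gamma>) = second_moment \<gamma> \<zeta> - (m2 \<mu> + m2 \<nu>) / 2"
    by (simp add: add_divide_distrib)
  show "costZ \<gamma> \<zeta> = ennreal (second_moment \<gamma> \<zeta> - (m2 \<mu> + m2 \<nu>) / 2)"
    unfolding costZ_def e[symmetric] by (rule nn_integral_eq_integral[OF i]) auto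
qed

text \<open>The extended-valued costs allow densities outside the square-integrable class; these
  cost infinity in both problems, since \<open>fst\<close> is square integrable.\<close>

lemma costs_infinite:
  assumes "\<not> square_integrable \<gamma> \<zeta>"
  shows "costC \<gamma> \<zeta> = \<infinity>" "costZ \<gamma> \<zeta> = \<infinity>"
proof -
  note [measurable] = \<zeta>_measurable GammaQ_D(7,8)[OF GQ]
  note L2 = GammaQ_L2[OF GQ]
  show "costC \<gamma> \<zeta> = \<infinity>"
  proof (rule ccontr)
    assume "costC \<gamma> \<zeta> \<noteq> \<infinity>"
    then have "square_integrable \<gamma> \<zeta>"
      unfolding costC_def by (intro integrableI_nonneg) (auto simp: less_top)
    with assms show False by simp
  qed
  show "costZ \<gamma> \<zeta> = \<infinity>"
  proof (rule ccontr)
    assume "costZ \<gamma> \<zeta> \<noteq> \<infinity>"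
    then have i: "integrable \<gamma> (half_sq_dist \<zeta>)"
      unfolding costZ_def by (intro integrableI_nonneg) (auto simp: less_top)
    have "square_integrable \<gamma> (\<lambda>z. \<zeta> z - fst z)"
    proof (rule Bochner_Integration.integrable_bound)
      show "integrable \<gamma> (\<lambda>z. 2 * (half_sq_dist \<zeta> z))"
        by (rule integrable_mult_right) (rule i)
    qed auto
    then have "square_integrable \<gamma> (\<lambda>z. (\<zeta> z - fst z) + fst z)" by (intro integrable_inner_L2(3) L2) measurable
    with assms show False by simp
  qed
qed

text \<open>Integrated form of \<open>C11_two_point\<close>: the gradient terms vanish by the
  extended constraints, and the squared defect survives as a quantitative surplus over
  \<open>V\<close>.\<close>

lemma weak_duality:
  assumes \<zeta>2: "square_integrable \<gamma> \<zeta>" and u: "C11 u G"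
    and opt: "(\<integral>x. u x \<partial>\<mu>) - (\<integral>x. u x \<partial>\<nu>) = Z2 \<mu> \<nu>"
  shows "square_integrable \<gamma> (\<lambda>z. \<zeta> z - optimal_density G z)"
    "V + second_moment \<gamma> (\<lambda>z. \<zeta> z - optimal_density G z) \<le> second_moment \<gamma> \<zeta>"
proof -
  note [measurable] = \<zeta>_measurable GammaQ_D(7,8)[OF GQ] C11_measurable[OF u] optimal_density_L2(1)[OF u]
  note L2 = GammaQ_L2[OF GQ]
  show i: "square_integrable \<gamma> (\<lambda>z. \<zeta> z - optimal_density G z)"
    by (intro integrable_inner_L2(4) \<zeta>2 optimal_density_L2[OF u]) measurable
  have iu: "integrable \<gamma> (\<lambda>z. u (fst z))" "integrable \<gamma> (\<lambda>z. u (snd z))"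
    using C11_integrable[OF \<mu> u] C11_integrable[OF \<nu> u] by (auto intro!: L2(7,8))
  have i1: "integrable \<gamma> (\<lambda>z. G (fst z) \<bullet> fst z)" "integrable \<gamma> (\<lambda>z. G (snd z) \<bullet> snd z)"
    by (intro integrable_inner_L2(2) L2 C11_gradient_L2[OF u]; measurable)+
  have i2: "integrable \<gamma> (\<lambda>z. G (fst z) \<bullet> \<zeta> z)" "integrable \<gamma> (\<lambda>z. G (snd z) \<bullet> \<zeta> z)"
    by (intro integrable_inner_L2(2) \<zeta>2 C11_gradient_L2[OF u]; measurable)+
  note c = constraint_L2(1)[OF \<zeta>2 C11_measurable(2)[OF u] C11_gradient_L2(1)[OF u]]
    constraint_L2(2)[OF \<zeta>2 C11_measurable(2)[OF u] C11_gradient_L2(2)[OF u]]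
  have "Z2 \<mu> \<nu> + second_moment \<gamma> (\<lambda>z. \<zeta> z - optimal_density G z)
    = (\<integral>z. u (fst z) - u (snd z) + (norm (\<zeta> z - optimal_density G z))\<^sup>2 \<partial>\<gamma>)"
    using iu i opt L2(5,6)[OF C11_measurable(1)[OF u]] by simp
  also have "\<dots> \<le> (\<integral>z. (G (fst z) \<bullet> fst z - G (fst z) \<bullet> \<zeta> z) + (G (snd z) \<bullet> \<zeta> z - G (snd z) \<bullet> snd z)
      + half_sq_dist \<zeta> z \<partial>\<gamma>)"
  proof (rule integral_mono)
    show "integrable \<gamma> (\<lambda>z. u (fst z) - u (snd z) + (norm (\<zeta> z - optimal_density G z))\<^sup>2)" using iu i by simp
    show "integrable \<gamma> (\<lambda>z. (G (fst z) \<bullet> fst z - G (fst z) \<bullet> \<zeta> z) + (G (snd z) \<bullet> \<zeta> z - G (snd z) \<bullet> snd z)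
      + half_sq_dist \<zeta> z)"
      by (intro Bochner_Integration.integrable_add Bochner_Integration.integrable_diff i1 i2 costZ_eq(1)[OF \<zeta>2])
    show "u (fst z) - u (snd z) + (norm (\<zeta> z - optimal_density G z))\<^sup>2
      \<le> (G (fst z) \<bullet> fst z - G (fst z) \<bullet> \<zeta> z) + (G (snd z) \<bullet> \<zeta> z - G (snd z) \<bullet> snd z)
      + half_sq_dist \<zeta> z" for z
      using C11_two_point[OF u, of "fst z" "snd z" "\<zeta> z"] by (simp add: optimal_density_def inner_diff_right)
  qed
  also have "\<dots> = (\<integral>z. half_sq_dist \<zeta> z \<partial>\<gamma>)"
    using i1 i2 c costZ_eq(1)[OF \<zeta>2]
    by (subst Bochner_Integration.integral_add) (auto intro!: Bochner_Integration.integrable_add Bochner_Integration.integrable_diff)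
  also have "\<dots> = second_moment \<gamma> \<zeta> - (m2 \<mu> + m2 \<nu>) / 2" by (rule costZ_eq(2)[OF \<zeta>2])
  finally show "V + second_moment \<gamma> (\<lambda>z. \<zeta> z - optimal_density G z) \<le> second_moment \<gamma> \<zeta>"
    by (simp add: V_def)
qed

lemma V_le_second_moment:
  assumes "square_integrable \<gamma> \<zeta>"
  shows "V \<le> second_moment \<gamma> \<zeta>"
proof -
  obtain u G where u: "C11 u G" "(\<integral>x. u x \<partial>\<mu>) - (\<integral>x. u x \<partial>\<nu>) = Z2 \<mu> \<nu>" by (rule ex_optimal_C11)
  have "0 \<le> second_moment \<gamma> (\<lambda>z. \<zeta> z - optimal_density G z)" by simp
  with weak_duality(2)[OF assms u] show ?thesis by linarith
qed

text \<open>With density \<open>optimal_density G\<close>, the constraints make the second moment depend on the marginals only.\<close>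

lemma second_moment_optimal_density:
  assumes u: "C11 u G" and AE: "AE z in \<gamma>. \<zeta> z = optimal_density G z"
  shows "square_integrable \<gamma> \<zeta>"
    "second_moment \<gamma> \<zeta> = ((\<integral>x. (x + G x) \<bullet> x \<partial>\<mu>) + (\<integral>y. (y - G y) \<bullet> y \<partial>\<nu>)) / 2"
proof -
  note [measurable] = \<zeta>_measurable GammaQ_D(7,8)[OF GQ] C11_measurable[OF u] optimal_density_L2(1)[OF u]
  note L2 = GammaQ_L2[OF GQ]
  show \<zeta>2: "square_integrable \<gamma> \<zeta>"
    by (rule integrable_cong_AE_imp[OF optimal_density_L2(2)[OF u]]) (use AE in auto)
  have p1: "square_integrable \<gamma> (\<lambda>z. fst z + G (fst z))" and p2: "square_integrable \<gamma> (\<lambda>z. snd z - G (snd z))"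
    by (intro integrable_inner_L2(3,4) L2 C11_gradient_L2[OF u]; measurable)+
  have i: "integrable \<gamma> (\<lambda>z. (fst z + G (fst z)) \<bullet> \<zeta> z)" "integrable \<gamma> (\<lambda>z. (snd z - G (snd z)) \<bullet> \<zeta> z)"
    by (intro integrable_inner_L2(2) p1 p2 \<zeta>2; measurable)+
  have "second_moment \<gamma> \<zeta> = (\<integral>z. ((fst z + G (fst z)) \<bullet> \<zeta> z + (snd z - G (snd z)) \<bullet> \<zeta> z) / 2 \<partial>\<gamma>)"
  proof (rule integral_cong_AE)
    show "AE z in \<gamma>. (norm (\<zeta> z))\<^sup>2 = ((fst z + G (fst z)) \<bullet> \<zeta> z + (snd z - G (snd z)) \<bullet> \<zeta> z) / 2"
      using AE
    proof eventually_elim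
      case (elim z)
      have "(norm (\<zeta> z))\<^sup>2 = optimal_density G z \<bullet> \<zeta> z" using elim by (simp add: power2_norm_eq_inner)
      then show ?case by (simp add: optimal_density_def inner_add_left inner_diff_left algebra_simps add_divide_distrib diff_divide_distrib)
    qed
  qed measurable
  also have "\<dots> = ((\<integral>z. (fst z + G (fst z)) \<bullet> \<zeta> z \<partial>\<gamma>) + (\<integral>z. (snd z - G (snd z)) \<bullet> \<zeta> z \<partial>\<gamma>)) / 2" using i by simp
  also have "(\<integral>z. (fst z + G (fst z)) \<bullet> \<zeta> z \<partial>\<gamma>) = (\<integral>x. (x + G x) \<bullet> x \<partial>\<mu>)"
    using constraint_L2(1)[OF \<zeta>2, of "\<lambda>x. x + G x"] p1 L2(5)[of "\<lambda>x. (x + G x) \<bullet> x"] by simp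
  also have "(\<integral>z. (snd z - G (snd z)) \<bullet> \<zeta> z \<partial>\<gamma>) = (\<integral>x. (x - G x) \<bullet> x \<partial>\<nu>)"
    using constraint_L2(2)[OF \<zeta>2, of "\<lambda>x. x - G x"] p2 L2(6)[of "\<lambda>x. (x - G x) \<bullet> x"] by simp
  finally show "second_moment \<gamma> \<zeta> = ((\<integral>x. (x + G x) \<bullet> x \<partial>\<mu>) + (\<integral>y. (y - G y) \<bullet> y \<partial>\<nu>)) / 2" .
qed

lemma push_forward_P2:
  "distr \<gamma> borel \<zeta> \<in> P2 \<longleftrightarrow> square_integrable \<gamma> \<zeta>"
  "m2 (distr \<gamma> borel \<zeta>) = second_moment \<gamma> \<zeta>"
  using prob_space.prob_space_distr[OF GammaQ_D(1)[OF GQ] \<zeta>_measurable]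
  by (auto simp: P2_def m2_def integrable_distr_eq[OF \<zeta>_measurable] integral_distr[OF \<zeta>_measurable])

end

section \<open>Optimal values, projections and equivalence of the conditions\<close>

lemma ex_optimal_pair:
  obtains \<gamma> \<zeta> where "(\<gamma>, \<zeta>) \<in> GammaQ \<mu> \<nu>" "square_integrable \<gamma> \<zeta>" "second_moment \<gamma> \<zeta> = V"
proof -
  obtain \<gamma> \<zeta> where g: "(\<gamma>, \<zeta>) \<in> GammaQ \<mu> \<nu>" and c: "costC \<gamma> \<zeta> \<le> ennreal V" by (rule ex_GammaQ_costC_le)
  have i: "square_integrable \<gamma> \<zeta>"
  proof (rule ccontr)
    assume "\<not> ?thesis"
    from costs_infinite(1)[OF g this] c show False by (simp add: top_unique)
  qed
  have "second_moment \<gamma> \<zeta> \<le> V"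
    using c V_nonneg unfolding costC_eq[OF g i] by (simp add: ennreal_le_iff)
  with V_le_second_moment[OF g i] have "second_moment \<gamma> \<zeta> = V" by simp
  with g i show ?thesis by (rule that)
qed

lemma ex_optimal_dominating:
  obtains \<rho> where "\<rho> \<in> P2" "cx_le \<mu> \<rho>" "cx_le \<nu> \<rho>" "m2 \<rho> = V"
proof -
  obtain \<gamma> \<zeta> where g: "(\<gamma>, \<zeta>) \<in> GammaQ \<mu> \<nu>" and i: "square_integrable \<gamma> \<zeta>"
    and J: "second_moment \<gamma> \<zeta> = V" by (rule ex_optimal_pair)
  show ?thesis
    by (rule that[of "distr \<gamma> borel \<zeta>"]) (use push_forward_P2[OF g] GammaQ_cx_le[OF g] i J in auto)
qed

lemma Ccost_eq: "Ccost \<mu> \<nu> = V"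
  unfolding Ccost_def
proof (rule cInf_eq_minimum)
  obtain \<rho> where "\<rho> \<in> P2" "cx_le \<mu> \<rho>" "cx_le \<nu> \<rho>" "m2 \<rho> = V" by (rule ex_optimal_dominating)
  then show "V \<in> {m2 \<rho> | \<rho>. \<rho> \<in> P2 \<and> cx_le \<mu> \<rho> \<and> cx_le \<nu> \<rho>}" by (intro CollectI exI[of _ \<rho>]) simp
qed (use V_le_m2 in blast)

text \<open>The lower bound for \<open>Z2 \<nu> \<rho>\<close> comes from testing with \<open>- (u + |.|\<^sup>2 / 2) / 2\<close>, where \<open>u\<close> is optimal for
  \<open>Z2 \<mu> \<nu>\<close>.\<close>

lemma Z2_lower_bound:
  assumes \<rho>: "\<rho> \<in> P2" "cx_le \<mu> \<rho>"
  shows "(V - m2 \<nu>) / 2 \<le> Z2 \<nu> \<rho>"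
proof -
  obtain u G where u: "C11 u G" and opt: "(\<integral>x. u x \<partial>\<mu>) - (\<integral>x. u x \<partial>\<nu>) = Z2 \<mu> \<nu>" by (rule ex_optimal_C11)
  interpret np: P2_pair \<nu> \<rho> using \<nu> \<rho> bary cx_le_bary[OF \<mu> \<rho>] by (simp add: P2_pair_def)
  \<comment> \<open>The outer factor 1/2 makes \<open>w\<close> admissible, because
    \<open>u + |.|^2/2\<close> alone has a 2-Lipschitz gradient.\<close>
  define w where "w x = - (u x + (norm x)\<^sup>2 / 2) / 2" for x
  have w: "C11 w (\<lambda>x. - (1/2) *\<^sub>R (G x + x))"
    unfolding C11_def
  proof (intro allI)
    fix x y
    have "w y - w x - (- (1/2) *\<^sub>R (G x + x)) \<bullet> (y - x) = - (u y - u x - G x \<bullet> (y - x)) / 2 - (norm (y - x))\<^sup>2 / 4"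
      unfolding w_def power2_norm_eq_inner
      by (simp add: inner_commute algebra_simps inner_add_left inner_diff_left inner_diff_right add_divide_distrib diff_divide_distrib)
    moreover have "\<bar>u y - u x - G x \<bullet> (y - x)\<bar> \<le> (norm (y - x))\<^sup>2 / 2" using u unfolding C11_def by blast
    moreover have "\<bar>- a / 2 - b / 4\<bar> \<le> b / 2" if "\<bar>a\<bar> \<le> b / 2" for a b :: real
      using that by linarith
    ultimately show "\<bar>w y - w x - (- (1/2) *\<^sub>R (G x + x)) \<bullet> (y - x)\<bar> \<le> (norm (y - x))\<^sup>2 / 2" by (simp only:)
  qed
  have int: "(\<integral>x. w x \<partial>M) = - ((\<integral>x. u x \<partial>M) + m2 M / 2) / 2" if "M \<in> P2" for M
    using C11_integrable[OF that u] P2_D(3)[OF that] by (simp add: w_def m2_def)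
  \<comment> \<open>Convexity of \<open>u + |.|^2/2\<close> trades \<open>\<rho>\<close> for
    \<open>\<mu>\<close>. Only domination of \<open>\<mu>\<close> enters, so the bound covers every
    competitor in \<open>zproj \<mu> \<nu>\<close>.\<close>
  have "(V - m2 \<nu>) / 2 \<le> (\<integral>x. w x \<partial>\<nu>) - (\<integral>x. w x \<partial>\<rho>)"
    using cx_le_C11[OF \<mu> \<rho> u] opt unfolding int[OF \<nu>] int[OF \<rho>(1)] V_def by (simp add: field_simps)
  also have "\<dots> \<le> Z2 \<nu> \<rho>" by (rule np.Z2_upper[OF w])
  finally show ?thesis .
qed

text \<open>For a measure dominating both marginals, \<open>Z2 \<nu> \<rho>\<close> is an increasing
  affine function of \<open>m2 \<rho>\<close>. Competitors dominating only \<open>\<mu>\<close> are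
  handled by \<open>Z2_lower_bound\<close>, whose value is attained by a measure dominating
  both.\<close>

lemma zproj_iff:
  assumes "cx_le \<mu> \<rho>" "cx_le \<nu> \<rho>"
  shows "\<rho> \<in> zproj \<mu> \<nu> \<longleftrightarrow> \<rho> \<in> P2 \<and> m2 \<rho> = V"
proof
  assume r: "\<rho> \<in> P2 \<and> m2 \<rho> = V"
  then have eq: "Z2 \<nu> \<rho> = (V - m2 \<nu>) / 2" using Z2_cx_le[OF \<nu>, of \<rho>] assms by simp
  show "\<rho> \<in> zproj \<mu> \<nu>"
    unfolding zproj_def
  proof (intro CollectI conjI ballI impI)
    fix \<rho>' assume "\<rho>' \<in> P2" "cx_le \<mu> \<rho>'"
    then show "Z2 \<nu> \<rho> \<le> Z2 \<nu> \<rho>'" unfolding eq by (rule Z2_lower_bound)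
  qed (use r assms in auto)
next
  assume z: "\<rho> \<in> zproj \<mu> \<nu>"
  then have P: "\<rho> \<in> P2" by (simp add: zproj_def)
  obtain \<rho>' where r: "\<rho>' \<in> P2" "cx_le \<mu> \<rho>'" "cx_le \<nu> \<rho>'" "m2 \<rho>' = V" by (rule ex_optimal_dominating)
  have "Z2 \<nu> \<rho> \<le> Z2 \<nu> \<rho>'" using z r by (auto simp: zproj_def)
  then have "m2 \<rho> \<le> V" using Z2_cx_le[OF \<nu> P assms(2)] Z2_cx_le[OF \<nu> r(1,3)] r(4) by simp
  with V_le_m2[OF P assms] P show "\<rho> \<in> P2 \<and> m2 \<rho> = V" by simp
qed

lemma C_minimizer_iff:
  "cx_le \<mu> \<rho> \<Longrightarrow> cx_le \<nu> \<rho> \<Longrightarrow> C_minimizer \<mu> \<nu> \<rho> \<longleftrightarrow> \<rho> \<in> P2 \<and> m2 \<rho> = V"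
  by (auto simp: C_minimizer_def Ccost_eq)

definition optimal_pair where
  "optimal_pair \<gamma> \<zeta> \<longleftrightarrow> square_integrable \<gamma> \<zeta> \<and> second_moment \<gamma> \<zeta> = V"
  for \<gamma> :: "('a \<times> 'a) measure" and \<zeta> :: "'a \<times> 'a \<Rightarrow> 'a"

lemma costs_ge:
  assumes "(\<gamma>, \<zeta>) \<in> GammaQ \<mu> \<nu>"
  shows "ennreal V \<le> costC \<gamma> \<zeta>" "ennreal (Z2 \<mu> \<nu>) \<le> costZ \<gamma> \<zeta>"
    and "costC \<gamma> \<zeta> = ennreal V \<longleftrightarrow> optimal_pair \<gamma> \<zeta>" "costZ \<gamma> \<zeta> = ennreal (Z2 \<mu> \<nu>) \<longleftrightarrow> optimal_pair \<gamma> \<zeta>"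
proof -
  have "ennreal V \<le> costC \<gamma> \<zeta> \<and> ennreal (Z2 \<mu> \<nu>) \<le> costZ \<gamma> \<zeta> \<and> (costC \<gamma> \<zeta> = ennreal V \<longleftrightarrow> optimal_pair \<gamma> \<zeta>)
    \<and> (costZ \<gamma> \<zeta> = ennreal (Z2 \<mu> \<nu>) \<longleftrightarrow> optimal_pair \<gamma> \<zeta>)"
  proof (cases "square_integrable \<gamma> \<zeta>")
    case True
    define J where "J = second_moment \<gamma> \<zeta>"
    have J: "V \<le> J" unfolding J_def by (rule V_le_second_moment[OF assms True])
    have C: "costC \<gamma> \<zeta> = ennreal J" unfolding J_def by (rule costC_eq[OF assms True])
    have Z: "costZ \<gamma> \<zeta> = ennreal (J - (m2 \<mu> + m2 \<nu>) / 2)" unfolding J_def by (rule costZ_eq(3)[OF assms True])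
    have JZ: "Z2 \<mu> \<nu> \<le> J - (m2 \<mu> + m2 \<nu>) / 2" using J by (simp add: V_def)
    have opt: "optimal_pair \<gamma> \<zeta> \<longleftrightarrow> J = V" using True by (simp add: optimal_pair_def J_def)
    \<comment> \<open>\<open>ennreal\<close> collapses negative reals to 0, so passing back to real
      equality requires nonnegative numbers.\<close>
    have "ennreal J = ennreal V \<longleftrightarrow> J = V" using J V_nonneg by (subst ennreal_inj) auto
    moreover have "ennreal (J - (m2 \<mu> + m2 \<nu>) / 2) = ennreal (Z2 \<mu> \<nu>) \<longleftrightarrow> J = V"
      using JZ Z2_nonneg order_trans[OF Z2_nonneg JZ] by (subst ennreal_inj) (auto simp: V_def)
    ultimately show ?thesis unfolding C Z opt using J JZ by (simp add: ennreal_leI)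
  next
    case False
    then show ?thesis using costs_infinite[OF assms] by (simp add: optimal_pair_def)
  qed
  then show "ennreal V \<le> costC \<gamma> \<zeta>" "ennreal (Z2 \<mu> \<nu>) \<le> costZ \<gamma> \<zeta>"
    "costC \<gamma> \<zeta> = ennreal V \<longleftrightarrow> optimal_pair \<gamma> \<zeta>" "costZ \<gamma> \<zeta> = ennreal (Z2 \<mu> \<nu>) \<longleftrightarrow> optimal_pair \<gamma> \<zeta>" by auto
qed

text \<open>Both costs obey the same scheme, a lower bound attained exactly by optimal pairs;
  existence of one such pair makes the bound a minimum.\<close>

lemma argminGQ_eq:
  assumes ge: "\<And>\<gamma> \<zeta>. (\<gamma>, \<zeta>) \<in> GammaQ \<mu> \<nu> \<Longrightarrow> ennreal v \<le> cost \<gamma> \<zeta>"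
    and eq: "\<And>\<gamma> \<zeta>. (\<gamma>, \<zeta>) \<in> GammaQ \<mu> \<nu> \<Longrightarrow> cost \<gamma> \<zeta> = ennreal v \<longleftrightarrow> optimal_pair \<gamma> \<zeta>" and v: "0 \<le> v"
  shows "is_min_GQ \<mu> \<nu> cost v" "argminGQ \<mu> \<nu> cost = {(\<gamma>, \<zeta>) \<in> GammaQ \<mu> \<nu>. optimal_pair \<gamma> \<zeta>}"
proof -
  obtain \<gamma>0 \<zeta>0 where g: "(\<gamma>0, \<zeta>0) \<in> GammaQ \<mu> \<nu>" and "square_integrable \<gamma>0 \<zeta>0"
    "second_moment \<gamma>0 \<zeta>0 = V" by (rule ex_optimal_pair)
  then have c0: "cost \<gamma>0 \<zeta>0 = ennreal v" using eq by (simp add: optimal_pair_def)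
  show "is_min_GQ \<mu> \<nu> cost v"
    unfolding is_min_GQ_def
  proof (intro conjI)
    show "\<exists>(\<gamma>, \<zeta>)\<in>GammaQ \<mu> \<nu>. enn2ereal (cost \<gamma> \<zeta>) = ereal v" using g c0 v by (intro bexI[OF _ g]) simp
    show "\<forall>(\<gamma>, \<zeta>)\<in>GammaQ \<mu> \<nu>. ereal v \<le> enn2ereal (cost \<gamma> \<zeta>)"
      using ge v by (auto simp: less_eq_ennreal.rep_eq)
  qed
  show "argminGQ \<mu> \<nu> cost = {(\<gamma>, \<zeta>) \<in> GammaQ \<mu> \<nu>. optimal_pair \<gamma> \<zeta>}"
  proof (intro set_eqI iffI)
    fix x assume "x \<in> argminGQ \<mu> \<nu> cost"
    then obtain \<gamma> \<zeta> where x: "x = (\<gamma>, \<zeta>)" "(\<gamma>, \<zeta>) \<in> GammaQ \<mu> \<nu>" "cost \<gamma> \<zeta> \<le> cost \<gamma>0 \<zeta>0"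
      using g by (auto simp: argminGQ_def)
    then have "cost \<gamma> \<zeta> = ennreal v" using ge[OF x(2)] c0 by simp
    then show "x \<in> {(\<gamma>, \<zeta>) \<in> GammaQ \<mu> \<nu>. optimal_pair \<gamma> \<zeta>}" using x eq by simp
  next
    fix x assume "x \<in> {(\<gamma>, \<zeta>) \<in> GammaQ \<mu> \<nu>. optimal_pair \<gamma> \<zeta>}"
    then obtain \<gamma> \<zeta> where x: "x = (\<gamma>, \<zeta>)" "(\<gamma>, \<zeta>) \<in> GammaQ \<mu> \<nu>" "optimal_pair \<gamma> \<zeta>" by auto
    then show "x \<in> argminGQ \<mu> \<nu> cost" using eq[OF x(2)] ge by (auto simp: argminGQ_def)
  qed
qed

text \<open>Forward, the surplus in \<open>weak_duality\<close> must vanish. Backward, an optimal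
  potential exists, so the hypothesis is not vacuous; the prescribed density then fixes the second
  moment through \<open>G\<close> and the marginals, and an optimal pair, having the same density by
  the forward direction, shows that this number is \<open>V\<close>.\<close>

lemma optimal_pair_iff_density:
  assumes g: "(\<gamma>, \<zeta>) \<in> GammaQ \<mu> \<nu>"
  shows "optimal_pair \<gamma> \<zeta> \<longleftrightarrow> (\<forall>u G. optimal_potential \<mu> \<nu> u G \<longrightarrow> (AE z in \<gamma>. \<zeta> z = optimal_density G z))"
proof -
  have density: "AE z in \<gamma>. \<zeta> z = optimal_density G z"
    if g: "(\<gamma>, \<zeta>) \<in> GammaQ \<mu> \<nu>" and o: "optimal_pair \<gamma> \<zeta>" and u: "C11 u G"
      and opt: "(\<integral>x. u x \<partial>\<mu>) - (\<integral>x. u x \<partial>\<nu>) = Z2 \<mu> \<nu>" for \<gamma> \<zeta> u G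
  proof -
    have i: "square_integrable \<gamma> \<zeta>" using o by (simp add: optimal_pair_def)
    note w = weak_duality[OF g i u opt]
    have "second_moment \<gamma> (\<lambda>z. \<zeta> z - optimal_density G z) \<le> 0" using w(2) o by (simp add: optimal_pair_def)
    moreover have "0 \<le> second_moment \<gamma> (\<lambda>z. \<zeta> z - optimal_density G z)" by simp
    ultimately have "second_moment \<gamma> (\<lambda>z. \<zeta> z - optimal_density G z) = 0" by linarith
    then have "AE z in \<gamma>. (norm (\<zeta> z - optimal_density G z))\<^sup>2 = 0"
      by (subst (asm) integral_nonneg_eq_0_iff_AE[OF w(1)]) auto
    then show ?thesis by eventually_elim simp
  qed
  show ?thesis
  proof
    assume "optimal_pair \<gamma> \<zeta>"
    then show "\<forall>u G. optimal_potential \<mu> \<nu> u G \<longrightarrow> (AE z in \<gamma>. \<zeta> z = optimal_density G z)"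
      using density[OF g] by (auto simp: optimal_potential_def lip1_grad_iff_C11)
  next
    assume all: "\<forall>u G. optimal_potential \<mu> \<nu> u G \<longrightarrow> (AE z in \<gamma>. \<zeta> z = optimal_density G z)"
    obtain u G where u: "C11 u G" and opt: "(\<integral>x. u x \<partial>\<mu>) - (\<integral>x. u x \<partial>\<nu>) = Z2 \<mu> \<nu>" by (rule ex_optimal_C11)
    obtain \<gamma>0 \<zeta>0 where g0: "(\<gamma>0, \<zeta>0) \<in> GammaQ \<mu> \<nu>" and i0: "square_integrable \<gamma>0 \<zeta>0"
      and J0: "second_moment \<gamma>0 \<zeta>0 = V" by (rule ex_optimal_pair)
    have "AE z in \<gamma>. \<zeta> z = optimal_density G z"
      using all u opt by (simp add: optimal_potential_def lip1_grad_iff_C11)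
    note sm = second_moment_optimal_density[OF g u this]
    have "optimal_pair \<gamma>0 \<zeta>0" using i0 J0 by (simp add: optimal_pair_def)
    note sm0 = second_moment_optimal_density[OF g0 u density[OF g0 this u opt]]
    show "optimal_pair \<gamma> \<zeta>" using sm sm0 J0 by (simp add: optimal_pair_def)
  qed
qed

end

theorem theorem1p1:
  fixes \<mu> \<nu> :: "'a::euclidean_space measure"
  assumes "\<mu> \<in> P2" and "\<nu> \<in> P2" and "bary \<mu> = bary \<nu>"
  shows "is_min_GQ \<mu> \<nu> costZ (Z2 \<mu> \<nu>)
    \<and> is_min_GQ \<mu> \<nu> costC (Ccost \<mu> \<nu>)
    \<and> argminGQ \<mu> \<nu> costZ = argminGQ \<mu> \<nu> costC
    \<and> argminGQ \<mu> \<nu> costZ \<noteq> {}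
    \<and> (\<forall>\<gamma> \<zeta>. (\<gamma>, \<zeta>) \<in> GammaQ \<mu> \<nu> \<longrightarrow>
         (let i = ((\<gamma>, \<zeta>) \<in> argminGQ \<mu> \<nu> costZ \<or> (\<gamma>, \<zeta>) \<in> argminGQ \<mu> \<nu> costC);
              \<rho> = distr \<gamma> borel \<zeta>
          in (i \<longleftrightarrow> (\<forall>u G. optimal_potential \<mu> \<nu> u G \<longrightarrow>
                       (AE z in \<gamma>. \<zeta> z = (1/2) *\<^sub>R (fst z + snd z) + (1/2) *\<^sub>R (G (fst z) - G (snd z)))))
           \<and> (i \<longleftrightarrow> C_minimizer \<mu> \<nu> \<rho>)
           \<and> (i \<longleftrightarrow> \<rho> \<in> zproj \<mu> \<nu>)
           \<and> (i \<longleftrightarrow> \<rho> \<in> zproj \<nu> \<mu>)))"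
proof -
  interpret P2_pair \<mu> \<nu> using assms by (simp add: P2_pair_def)
  have Z: "is_min_GQ \<mu> \<nu> costZ (Z2 \<mu> \<nu>)" "argminGQ \<mu> \<nu> costZ = {(\<gamma>, \<zeta>) \<in> GammaQ \<mu> \<nu>. optimal_pair \<gamma> \<zeta>}"
    by (rule argminGQ_eq; fact costs_ge Z2_nonneg)+
  have C: "is_min_GQ \<mu> \<nu> costC V" "argminGQ \<mu> \<nu> costC = {(\<gamma>, \<zeta>) \<in> GammaQ \<mu> \<nu>. optimal_pair \<gamma> \<zeta>}"
    by (rule argminGQ_eq; fact costs_ge V_nonneg)+
  obtain \<gamma> \<zeta> where "(\<gamma>, \<zeta>) \<in> GammaQ \<mu> \<nu>" "integrable \<gamma> (\<lambda>z. (norm (\<zeta> z))\<^sup>2)" "(\<integral>z. (norm (\<zeta> z))\<^sup>2 \<partial>\<gamma>) = V"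
    by (rule ex_optimal_pair)
  then have "(\<gamma>, \<zeta>) \<in> argminGQ \<mu> \<nu> costZ" unfolding Z(2) by (simp add: optimal_pair_def)
  then have ne: "argminGQ \<mu> \<nu> costZ \<noteq> {}" by blast
  have main: "(optimal_pair \<gamma> \<zeta> \<longleftrightarrow> (\<forall>u G. optimal_potential \<mu> \<nu> u G \<longrightarrow>
        (AE z in \<gamma>. \<zeta> z = (1/2) *\<^sub>R (fst z + snd z) + (1/2) *\<^sub>R (G (fst z) - G (snd z)))))
      \<and> (optimal_pair \<gamma> \<zeta> \<longleftrightarrow> C_minimizer \<mu> \<nu> (distr \<gamma> borel \<zeta>))
      \<and> (optimal_pair \<gamma> \<zeta> \<longleftrightarrow> distr \<gamma> borel \<zeta> \<in> zproj \<mu> \<nu>)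
      \<and> (optimal_pair \<gamma> \<zeta> \<longleftrightarrow> distr \<gamma> borel \<zeta> \<in> zproj \<nu> \<mu>)" if g: "(\<gamma>, \<zeta>) \<in> GammaQ \<mu> \<nu>" for \<gamma> \<zeta>
  proof -
    \<comment> \<open>All conditions on the push-forward reduce to this one; the projection with
      exchanged roles follows by symmetry of \<open>V\<close>.\<close>
    have "optimal_pair \<gamma> \<zeta> \<longleftrightarrow> distr \<gamma> borel \<zeta> \<in> P2 \<and> m2 (distr \<gamma> borel \<zeta>) = V"
      by (simp add: push_forward_P2[OF g] optimal_pair_def)
    then show ?thesis
      using optimal_pair_iff_density[OF g] C_minimizer_iff[OF GammaQ_cx_le[OF g]] zproj_iff[OF GammaQ_cx_le[OF g]]
        P2_pair.zproj_iff[OF swap GammaQ_cx_le(2,1)[OF g]]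
      by (simp add: V_swap optimal_density_def)
  qed
  have i: "((\<gamma>, \<zeta>) \<in> argminGQ \<mu> \<nu> costZ \<or> (\<gamma>, \<zeta>) \<in> argminGQ \<mu> \<nu> costC) \<longleftrightarrow> optimal_pair \<gamma> \<zeta>"
    if "(\<gamma>, \<zeta>) \<in> GammaQ \<mu> \<nu>" for \<gamma> \<zeta>
    using that by (simp add: Z(2) C(2))
  show ?thesis
  proof (intro conjI allI impI)
    show "is_min_GQ \<mu> \<nu> costZ (Z2 \<mu> \<nu>)" by (rule Z(1))
    show "is_min_GQ \<mu> \<nu> costC (Ccost \<mu> \<nu>)" unfolding Ccost_eq by (rule C(1))
    show "argminGQ \<mu> \<nu> costZ = argminGQ \<mu> \<nu> costC" unfolding Z(2) C(2) ..
    show "argminGQ \<mu> \<nu> costZ \<noteq> {}" by (rule ne)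
  qed (unfold Let_def i, rule main)
qed

end
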